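(* Assume there are constants $0<\delta\le M$ with $-M\le\Delta(t)\le-\delta$ for all $t\in[0,T_1]$, and let $z^*$ be the boundary function with $\mathcal C=\{z>z^*(t)\}$ if $0<\gamma<1$ and $\mathcal C=\{z<z^*(t)\}$ if $\gamma>1$. Then for every $t\in[0,T_1)$: if $\gamma>1$, $$\tilde{\mathbb E}\Big[\int_t^{T_1}e^{\vartheta(u-t)}\big(1+\Delta(u)(\mu^T(u)Z^{t,z^*(t)}(u))^{-\tilde\gamma}\big)1_{\{Z^{t,z^*(t)}(u)<z^*(u)\}}du\Big]=0;$$ if $0<\gamma<1$, the same identity holds with the indicator $1_{\{Z^{t,z^*(t)}(u)>z^*(u)\}}$. In either case $\lim_{t\to T_1-}z^*(t)=(-\Delta(T_1))^{1/\tilde\gamma}\mu^T(T_1)^{-1}$.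
   Context: Setting: a filtered probability space with the usual conditions carrying a standard Brownian motion $B$; $0<T_1<T<\infty$; constants $r,\mu,\sigma,\rho,\mu_w,\sigma_w,\alpha,\beta>0$, $\kappa=(\mu-r)/\sigma$; $\xi(t)=\exp(-\kappa B(t)-(\kappa^2/2+r)t)$, $\xi^t(s)=\xi(s)/\xi(t)$; $\mathcal W^{t,w}(s)=w\exp((\mu_w-\sigma_w^2/2)(s-t)+\sigma_w(B(s)-B(t)))$; $\vartheta=-r+\mu_w-\kappa\sigma_w<0$; $q(s)=(e^{\vartheta(T_1-s)}-1)/\vartheta$; $p^T(s)=\int_s^T e^{(\alpha-\beta-r)(u-s)}du$, $\mu^T=1+\alpha p^T$; $Y^{t,y}(s)=ye^{\rho(s-t)}\xi^t(s)$. Power utilities: $\gamma>0,\gamma\neq1$, $K:[0,T]\to(0,\infty)$ smooth, $U_1(t,x)=x^{1-\gamma}/(1-\gamma)$, $U_2(t,x)=K(t)x^{1-\gamma}/(1-\gamma)$; $\tilde\gamma=(1-\gamma)/\gamma$; $\Delta(t)=(1-K(t)^{1/\gamma})/\tilde\gamma$. $\hat V_i(t,y)=\sup_{c>0}\{U_i(t,c)-y\mu^T(t)c\}$; $\tilde V(t,y)=\mathbb E\int_t^Te^{-\rho(u-t)}\hat V_2(u,Y^{t,y}(u))du$. Measure change: $\mathcal E(t)=\exp(-\frac12(\sigma_w-\kappa)^2t+(\sigma_w-\kappa)B(t))$, $d\tilde{\mathbb P}=\mathcal E(T_1)d\mathbb P$, $\tilde{\mathbb E}$ its expectation. For $z>0$,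 $Z^{t,z}(s)=z\,(Y^{t,1}(s))^{1/(1-\gamma)}(\mathcal W^{t,1}(s))^{\gamma/(1-\gamma)}$. Reduced problem $\tilde w(t,z)=\sup_{\tau}\tilde{\mathbb E}\big[\int_t^\tau e^{\vartheta(u-t)}\hat V_1(u,Z^{t,z}(u))du+e^{\vartheta(\tau-t)}(\tilde V(\tau,Z^{t,z}(\tau))-q(\tau))\big]$ over stopping times $t\le\tau\le T_1$. Continuation region $\mathcal C=\{(t,z)\in[0,T_1)\times(0,\infty):\tilde w(t,z)>\tilde V(t,z)-q(t)\}$. *)

theory Defs
  imports "HOL-Probability.Probability"
begin

definition usual_filtration :: "'a measure \<Rightarrow> (real \<Rightarrow> 'a measure) \<Rightarrow> bool" where
  "usual_filtration M F \<longleftrightarrow>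
     filtration (space M) F \<and>
     (\<forall>t. sets (F t) \<subseteq> sets M) \<and>
     (\<forall>t. sets (F t) = (\<Inter>s\<in>{t<..}. sets (F s))) \<and>
     (\<forall>N. N \<subseteq> space M \<and> (\<exists>A\<in>null_sets M. N \<subseteq> A) \<longrightarrow> N \<in> sets (F 0))"

definition brownian_motion :: "'a measure \<Rightarrow> (real \<Rightarrow> 'a measure) \<Rightarrow> (real \<Rightarrow> 'a \<Rightarrow> real) \<Rightarrow> bool" where
  "brownian_motion M F B \<longleftrightarrow>
     (\<forall>\<omega>\<in>space M. B 0 \<omega> = 0) \<and>
     (\<forall>\<omega>\<in>space M. continuous_on {0..} (\<lambda>t. B t \<omega>)) \<and>
     (\<forall>t\<ge>0. B t \<in> borel_measurable (F t)) \<and>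
     (\<forall>s t. 0 \<le> s \<and> s < t \<longrightarrow>
        prob_space.indep_set M (sets (F s))
          {(\<lambda>\<omega>. B t \<omega> - B s \<omega>) -` A \<inter> space M | A. A \<in> sets borel} \<and>
        distributed M lborel (\<lambda>\<omega>. B t \<omega> - B s \<omega>) (\<lambda>x. ennreal (normal_density 0 (sqrt (t - s)) x)))"

definition smooth_on :: "real set \<Rightarrow> (real \<Rightarrow> real) \<Rightarrow> bool" where
  "smooth_on S f \<longleftrightarrow> (\<exists>D :: nat \<Rightarrow> real \<Rightarrow> real. (\<forall>x\<in>S. D 0 x = f x) \<and>
      (\<forall>n. \<forall>x\<in>S. (D n has_real_derivative D (Suc n) x) (at x within S)))"

definition kappa :: "real \<Rightarrow> real \<Rightarrow> real \<Rightarrow> real" where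
  "kappa \<mu> r \<sigma> = (\<mu> - r) / \<sigma>"

definition xi :: "real \<Rightarrow> real \<Rightarrow> (real \<Rightarrow> 'a \<Rightarrow> real) \<Rightarrow> real \<Rightarrow> 'a \<Rightarrow> real" where
  "xi \<kappa> r B t \<omega> = exp (- \<kappa> * B t \<omega> - (\<kappa>\<^sup>2 / 2 + r) * t)"

definition xi_from :: "real \<Rightarrow> real \<Rightarrow> (real \<Rightarrow> 'a \<Rightarrow> real) \<Rightarrow> real \<Rightarrow> real \<Rightarrow> 'a \<Rightarrow> real" where
  "xi_from \<kappa> r B t s \<omega> = xi \<kappa> r B s \<omega> / xi \<kappa> r B t \<omega>"

definition Wproc :: "real \<Rightarrow> real \<Rightarrow> (real \<Rightarrow> 'a \<Rightarrow> real) \<Rightarrow> real \<Rightarrow> real \<Rightarrow> real \<Rightarrow> 'a \<Rightarrow> real" where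
  "Wproc \<mu>w \<sigma>w B t w s \<omega> = w * exp ((\<mu>w - \<sigma>w\<^sup>2 / 2) * (s - t) + \<sigma>w * (B s \<omega> - B t \<omega>))"

definition theta :: "real \<Rightarrow> real \<Rightarrow> real \<Rightarrow> real \<Rightarrow> real" where
  "theta r \<mu>w \<kappa> \<sigma>w = - r + \<mu>w - \<kappa> * \<sigma>w"

definition qfun :: "real \<Rightarrow> real \<Rightarrow> real \<Rightarrow> real" where
  "qfun th T1 s = (exp (th * (T1 - s)) - 1) / th"

definition pT :: "real \<Rightarrow> real \<Rightarrow> real \<Rightarrow> real \<Rightarrow> real \<Rightarrow> real" where
  "pT \<alpha> \<beta> r T s = (LBINT u=s..T. exp ((\<alpha> - \<beta> - r) * (u - s)))"

definition muT :: "real \<Rightarrow> real \<Rightarrow> real \<Rightarrow> real \<Rightarrow> real \<Rightarrow> real" where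
  "muT \<alpha> \<beta> r T s = 1 + \<alpha> * pT \<alpha> \<beta> r T s"

definition Yproc :: "real \<Rightarrow> real \<Rightarrow> real \<Rightarrow> (real \<Rightarrow> 'a \<Rightarrow> real) \<Rightarrow> real \<Rightarrow> real \<Rightarrow> real \<Rightarrow> 'a \<Rightarrow> real" where
  "Yproc \<rho> \<kappa> r B t y s \<omega> = y * exp (\<rho> * (s - t)) * xi_from \<kappa> r B t s \<omega>"

definition U1 :: "real \<Rightarrow> real \<Rightarrow> real \<Rightarrow> real" where
  "U1 \<gamma> t x = x powr (1 - \<gamma>) / (1 - \<gamma>)"

definition U2 :: "real \<Rightarrow> (real \<Rightarrow> real) \<Rightarrow> real \<Rightarrow> real \<Rightarrow> real" where
  "U2 \<gamma> K t x = K t * x powr (1 - \<gamma>) / (1 - \<gamma>)"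

definition gtilde :: "real \<Rightarrow> real" where
  "gtilde \<gamma> = (1 - \<gamma>) / \<gamma>"

definition Delta :: "real \<Rightarrow> (real \<Rightarrow> real) \<Rightarrow> real \<Rightarrow> real" where
  "Delta \<gamma> K t = (1 - K t powr (1 / \<gamma>)) / gtilde \<gamma>"

definition Vhat :: "(real \<Rightarrow> real \<Rightarrow> real) \<Rightarrow> (real \<Rightarrow> real) \<Rightarrow> real \<Rightarrow> real \<Rightarrow> real" where
  "Vhat U m t y = (SUP c\<in>{0<..}. U t c - y * m t * c)"

definition Vtilde where
  "Vtilde M B \<gamma> K \<alpha> \<beta> r T \<rho> \<kappa> t y =
     integral\<^sup>L M (\<lambda>\<omega>. LBINT u=t..T. exp (- \<rho> * (u - t)) *
        Vhat (U2 \<gamma> K) (muT \<alpha> \<beta> r T) u (Yproc \<rho> \<kappa> r B t y u \<omega>))"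

definition Ecal :: "real \<Rightarrow> real \<Rightarrow> (real \<Rightarrow> 'a \<Rightarrow> real) \<Rightarrow> real \<Rightarrow> 'a \<Rightarrow> real" where
  "Ecal \<sigma>w \<kappa> B t \<omega> = exp (- (1/2) * (\<sigma>w - \<kappa>)\<^sup>2 * t + (\<sigma>w - \<kappa>) * B t \<omega>)"

text \<open>Expectation under \<open>d\<tilde>P = Ecal(T1) dP\<close>.\<close>
definition Etilde :: "'a measure \<Rightarrow> real \<Rightarrow> real \<Rightarrow> (real \<Rightarrow> 'a \<Rightarrow> real) \<Rightarrow> real \<Rightarrow> ('a \<Rightarrow> real) \<Rightarrow> real" where
  "Etilde M \<sigma>w \<kappa> B T1 X = integral\<^sup>L M (\<lambda>\<omega>. Ecal \<sigma>w \<kappa> B T1 \<omega> * X \<omega>)"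

definition Zproc :: "real \<Rightarrow> real \<Rightarrow> real \<Rightarrow> real \<Rightarrow> real \<Rightarrow> real \<Rightarrow> (real \<Rightarrow> 'a \<Rightarrow> real)
    \<Rightarrow> real \<Rightarrow> real \<Rightarrow> real \<Rightarrow> 'a \<Rightarrow> real" where
  "Zproc \<gamma> \<rho> \<kappa> r \<mu>w \<sigma>w B t z s \<omega> =
     z * (Yproc \<rho> \<kappa> r B t 1 s \<omega>) powr (1 / (1 - \<gamma>)) * (Wproc \<mu>w \<sigma>w B t 1 s \<omega>) powr (\<gamma> / (1 - \<gamma>))"

definition wtilde where
  "wtilde M F B \<gamma> K \<alpha> \<beta> r T T1 \<rho> \<kappa> \<mu>w \<sigma>w t z =
     (let th = theta r \<mu>w \<kappa> \<sigma>w; Z = Zproc \<gamma> \<rho> \<kappa> r \<mu>w \<sigma>w B t z in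
      SUP \<tau>\<in>{\<tau>. stopping_time F \<tau> \<and> (\<forall>\<omega>\<in>space M. t \<le> \<tau> \<omega> \<and> \<tau> \<omega> \<le> T1)}.
        Etilde M \<sigma>w \<kappa> B T1 (\<lambda>\<omega>.
           (LBINT u=t..\<tau> \<omega>. exp (th * (u - t)) * Vhat (U1 \<gamma>) (muT \<alpha> \<beta> r T) u (Z u \<omega>))
           + exp (th * (\<tau> \<omega> - t)) *
             (Vtilde M B \<gamma> K \<alpha> \<beta> r T \<rho> \<kappa> (\<tau> \<omega>) (Z (\<tau> \<omega>) \<omega>) - qfun th T1 (\<tau> \<omega>))))"

definition contregion where
  "contregion M F B \<gamma> K \<alpha> \<beta> r T T1 \<rho> \<kappa> \<mu>w \<sigma>w =
     {(t, z). 0 \<le> t \<and> t < T1 \<and> 0 < z \<and>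
        wtilde M F B \<gamma> K \<alpha> \<beta> r T T1 \<rho> \<kappa> \<mu>w \<sigma>w t z >
        Vtilde M B \<gamma> K \<alpha> \<beta> r T \<rho> \<kappa> t z - qfun (theta r \<mu>w \<kappa> \<sigma>w) T1 t}"

end

theory Submission
  imports Defs
begin

text \<open>
  Put \<open>y = - gt * ln z - c * t\<close> with \<open>gt = gtilde \<gamma>\<close> and a suitable constant \<open>c\<close>. Under the changed measure
  the exponential of this coordinate along \<open>Z\<close> is an exponential martingale driven by a Brownian motion, and
  optional stopping turns the gain of a stopping time \<open>\<tau>\<close> over immediate stopping into the expectation of
  the integral of \<open>reward u (Y u) = exp (\<theta> * u) * (1 - a u * exp (Y u))\<close> over \<open>[t, \<tau>)\<close>. For both signs of
  \<open>gt\<close> the continuation region becomes the set of points below a boundary \<open>b\<close>.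

  The problem is compared with its Bermudan versions, whose values are given by a backward recursion with
  Gaussian kernels. Shifting time in this recursion shows that \<open>b t - L * t\<close> is decreasing, so \<open>b\<close> is
  continuous up to a countable set. Summing the recursion along the path started on the boundary expresses
  the integral of the reward over the Bermudan continuation region as the value that re-enters from the
  stopping region. This is at most the integral of the absolute reward over a shrinking layer above the
  boundary, up to large deviations of one increment, and it tends to 0: if the volatility is nonzero, \<open>Y\<close>
  has no atoms; if it is zero, the times at which the constant path lies on the boundary with nonzero reward
  are countably many. The limit at the horizon follows from a quadratic supersolution of the recursion.
\<close>

section \<open>Preliminaries\<close>

subsection \<open>Rounding to a grid\<close>

definition grid_floor :: "real \<Rightarrow> real \<Rightarrow> real \<Rightarrow> real" where
  "grid_floor s h u = s + h * of_int \<lfloor>(u - s) / h\<rfloor>"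

definition grid_ceiling :: "real \<Rightarrow> real \<Rightarrow> real \<Rightarrow> real" where
  "grid_ceiling s h u = s + h * of_int \<lceil>(u - s) / h\<rceil>"

lemma grid_floor_le: "0 < h \<Longrightarrow> grid_floor s h u \<le> u"
  using floor_divide_lower[of h "u - s"] by (simp add: grid_floor_def mult.commute)

lemma less_grid_floor_add: "0 < h \<Longrightarrow> u < grid_floor s h u + h"
  using floor_divide_upper[of h "u - s"] by (simp add: grid_floor_def algebra_simps)

lemma le_grid_ceiling: "0 < h \<Longrightarrow> u \<le> grid_ceiling s h u"
  using ceiling_divide_upper[of h "u - s"] by (simp add: grid_ceiling_def mult.commute)

lemma grid_ceiling_less_add: "0 < h \<Longrightarrow> grid_ceiling s h u < u + h"
  using ceiling_divide_lower[of h "u - s"] by (simp add: grid_ceiling_def algebra_simps)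

lemma start_le_grid_floor: "0 < h \<Longrightarrow> s \<le> u \<Longrightarrow> s \<le> grid_floor s h u"
  by (simp add: grid_floor_def)

lemma start_le_grid_ceiling: "0 < h \<Longrightarrow> s \<le> u \<Longrightarrow> s \<le> grid_ceiling s h u"
  using le_grid_ceiling by (rule order_trans[rotated])

lemma grid_floor_eq_start: "s \<le> u \<Longrightarrow> u < s + h \<Longrightarrow> grid_floor s h u = s"
proof -
  assume "s \<le> u" "u < s + h"
  then have "\<lfloor>(u - s) / h\<rfloor> = 0" by (intro floor_unique) auto
  then show ?thesis by (simp add: grid_floor_def)
qed

lemma grid_floor_shift: "0 < h \<Longrightarrow> grid_floor (s + h) h u = grid_floor s h u"
proof -
  assume "0 < h"
  then have eq: "(u - (s + h)) / h = (u - s) / h - 1" by (simp add: field_simps)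
  show ?thesis unfolding grid_floor_def eq floor_diff_one by (simp add: algebra_simps)
qed

lemma grid_ceiling_le_iff: "0 < h \<Longrightarrow> grid_ceiling s h u \<le> v \<longleftrightarrow> u \<le> grid_floor s h v"
proof -
  assume h: "0 < h"
  have "grid_ceiling s h u \<le> v \<longleftrightarrow> real_of_int \<lceil>(u - s) / h\<rceil> \<le> (v - s) / h"
    using h by (simp add: grid_ceiling_def field_simps)
  also have "\<dots> \<longleftrightarrow> (u - s) / h \<le> real_of_int \<lfloor>(v - s) / h\<rfloor>"
    by (simp add: le_floor_iff[symmetric] ceiling_le_iff)
  also have "\<dots> \<longleftrightarrow> u \<le> grid_floor s h v"
    using h by (simp add: grid_floor_def field_simps)
  finally show ?thesis .
qed

lemma grid_steps_less:
  assumes "0 < h" "s + h \<le> T"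
  shows "nat \<lfloor>(T - (s + h)) / h\<rfloor> < nat \<lfloor>(T - s) / h\<rfloor>"
proof -
  have "(T - (s + h)) / h = (T - s) / h - 1" "1 \<le> (T - s) / h"
    using assms by (simp_all add: field_simps)
  then have "\<lfloor>(T - (s + h)) / h\<rfloor> = \<lfloor>(T - s) / h\<rfloor> - 1" "1 \<le> \<lfloor>(T - s) / h\<rfloor>"
    by (simp_all only: floor_diff_one one_le_floor)
  then show ?thesis by simp
qed

lemma finite_grid:
  assumes "0 < h"
  shows "finite {i. s + real i * h \<le> T}"
proof (rule finite_subset)
  show "{i. s + real i * h \<le> T} \<subseteq> {..nat \<lfloor>(T - s) / h\<rfloor>}"
    using assms by (auto simp: le_nat_floor field_simps)
qed simp

lemma grid_floor_tendsto:
  assumes "h \<longlonglongrightarrow> 0" "\<And>n. 0 < h n"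
  shows "(\<lambda>n. grid_floor s (h n) u) \<longlonglongrightarrow> u"
proof (rule tendsto_sandwich)
  show "\<forall>\<^sub>F n in sequentially. u - h n \<le> grid_floor s (h n) u"
    using less_grid_floor_add[OF assms(2), of u s] by (intro always_eventually allI) (simp add: less_imp_le diff_le_eq)
  show "\<forall>\<^sub>F n in sequentially. grid_floor s (h n) u \<le> u"
    using grid_floor_le[OF assms(2)] by simp
  show "(\<lambda>n. u - h n) \<longlonglongrightarrow> u" using tendsto_diff[OF tendsto_const assms(1)] by simp
qed simp


subsection \<open>Limits of integrals\<close>

lemma tendsto_min_Suc: "(\<lambda>n. min x (real (Suc n))) \<longlonglongrightarrow> x"
proof (rule tendsto_eventually)
  obtain n0 where "x \<le> real n0" using real_arch_simple by blast
  then show "\<forall>\<^sub>F n in sequentially. min x (real (Suc n)) = x"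
    by (intro eventually_sequentiallyI[of n0]) auto
qed

lemma minus_square_divide_le_min:
  fixes z l :: real
  assumes "0 < l" "0 \<le> z"
  shows "z - z\<^sup>2 / l \<le> min z l"
proof (cases "z \<le> l")
  case False
  then have "z * l \<le> z\<^sup>2" using assms by (simp add: power2_eq_square)
  then have "z \<le> z\<^sup>2 / l" using assms by (simp add: field_simps)
  then show ?thesis using False assms by simp
qed (use assms in simp)

lemma (in prob_space) expectation_min_bounds:
  fixes Z :: "'a \<Rightarrow> real"
  assumes l: "0 < l" and nonneg: "\<And>\<omega>. 0 \<le> Z \<omega>"
    and mean: "has_bochner_integral M Z m"
    and sq: "integrable M (\<lambda>\<omega>. (Z \<omega>)\<^sup>2)" "(\<integral>\<omega>. (Z \<omega>)\<^sup>2 \<partial>M) \<le> C"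
  shows "m - C / l \<le> (\<integral>\<omega>. min (Z \<omega>) l \<partial>M)" "(\<integral>\<omega>. min (Z \<omega>) l \<partial>M) \<le> m"
proof -
  have Z_int: "integrable M Z" "(\<integral>\<omega>. Z \<omega> \<partial>M) = m"
    using mean by (auto simp: has_bochner_integral_iff)
  have trunc_int: "integrable M (\<lambda>\<omega>. min (Z \<omega>) l)"
    using Z_int(1) by simp
  have "m - C / l \<le> (\<integral>\<omega>. Z \<omega> - (Z \<omega>)\<^sup>2 / l \<partial>M)"
    using Z_int sq l by (subst Bochner_Integration.integral_diff) (auto simp: divide_right_mono)
  also have "\<dots> \<le> (\<integral>\<omega>. min (Z \<omega>) l \<partial>M)"
    using Z_int(1) sq trunc_int l nonneg by (intro integral_mono minus_square_divide_le_min) auto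
  finally show "m - C / l \<le> (\<integral>\<omega>. min (Z \<omega>) l \<partial>M)" .
  have "(\<integral>\<omega>. min (Z \<omega>) l \<partial>M) \<le> (\<integral>\<omega>. Z \<omega> \<partial>M)"
    using Z_int(1) trunc_int by (intro integral_mono) auto
  then show "(\<integral>\<omega>. min (Z \<omega>) l \<partial>M) \<le> m" using Z_int(2) by simp
qed

text \<open>A bound on the second moments makes the sequence uniformly integrable.\<close>

lemma (in prob_space) has_bochner_integral_limit_of_bounded_second_moment:
  fixes Z :: "nat \<Rightarrow> 'a \<Rightarrow> real"
  assumes lim: "\<And>\<omega>. \<omega> \<in> space M \<Longrightarrow> (\<lambda>n. Z n \<omega>) \<longlonglongrightarrow> Z' \<omega>"
    and nonneg: "\<And>n \<omega>. 0 \<le> Z n \<omega>"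
    and mean: "\<And>n. has_bochner_integral M (Z n) m"
    and sq: "\<And>n. integrable M (\<lambda>\<omega>. (Z n \<omega>)\<^sup>2)" "\<And>n. (\<integral>\<omega>. (Z n \<omega>)\<^sup>2 \<partial>M) \<le> C"
  shows "has_bochner_integral M Z' m"
proof -
  have Z_meas[measurable]: "Z n \<in> borel_measurable M" for n
    by (rule borel_measurable_has_bochner_integral[OF mean])
  have Z'_meas[measurable]: "Z' \<in> borel_measurable M"
    by (rule borel_measurable_LIMSEQ_real[OF lim]) auto
  have Z'_nonneg: "0 \<le> Z' \<omega>" if "\<omega> \<in> space M" for \<omega>
    using LIMSEQ_le_const[OF lim[OF that]] nonneg by blast
  define E where "E l = (\<integral>\<omega>. min (Z' \<omega>) l \<partial>M)" for l
  have trunc_int: "integrable M (\<lambda>\<omega>. min (Z' \<omega>) l)" if "0 < l" for l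
    using that Z'_nonneg by (auto intro!: integrable_const_bound[where B = l] AE_I2)
  have trunc_lim: "(\<lambda>n. \<integral>\<omega>. min (Z n \<omega>) l \<partial>M) \<longlonglongrightarrow> E l" if "0 < l" for l
    unfolding E_def
  proof (rule integral_dominated_convergence[where w = "\<lambda>_. l"])
    show "AE \<omega> in M. (\<lambda>n. min (Z n \<omega>) l) \<longlonglongrightarrow> min (Z' \<omega>) l"
      using lim by (intro AE_I2 tendsto_min) auto
  qed (use that nonneg in auto)
  note bounds = expectation_min_bounds[OF _ nonneg mean sq]
  have lower: "m - C / l \<le> E l" if "0 < l" for l
    using LIMSEQ_le_const[OF trunc_lim[OF that]] bounds(1)[OF that] by blast
  have upper: "E l \<le> m" if "0 < l" for l
    using LIMSEQ_le_const2[OF trunc_lim[OF that]] bounds(2)[OF that] by blast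
  have "(\<lambda>n. E (real (Suc n))) \<longlonglongrightarrow> m"
  proof (rule tendsto_sandwich[where h = "\<lambda>_. m"])
    show "(\<lambda>n. m - C / real (Suc n)) \<longlonglongrightarrow> m"
      using tendsto_diff[OF tendsto_const LIMSEQ_Suc[OF lim_const_over_n[of C]], of m] by simp
  qed (use lower upper in \<open>auto intro!: always_eventually\<close>)
  then show ?thesis
    unfolding E_def by (intro has_bochner_integral_monotone_convergence[where f = "\<lambda>n \<omega>. min (Z' \<omega>) (real (Suc n))"])
      (auto intro!: trunc_int AE_I2 monoI min.mono tendsto_min_Suc Z'_meas simp del: of_nat_Suc)
qed

lemma set_integral_tendsto_of_eventually_eq:
  fixes f :: "'a \<Rightarrow> real"
  assumes f: "set_integrable M S f" and A: "\<And>n. A n \<in> sets M" "\<And>n. A n \<subseteq> S" and B: "B \<in> sets M" "B \<subseteq> S"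
    and lim: "AE x in M. \<forall>\<^sub>F n in sequentially. indicator (A n) x * f x = indicator B x * f x"
  shows "(\<lambda>n. LINT x:A n|M. f x) \<longlonglongrightarrow> (LINT x:B|M. f x)"
  unfolding set_lebesgue_integral_def real_scaleR_def
proof (rule integral_dominated_convergence)
  show "integrable M (\<lambda>x. indicator S x * \<bar>f x\<bar>)"
    using set_integrable_abs[OF f] by (simp add: set_integrable_def)
  show "(\<lambda>x. indicator (A n) x * f x) \<in> borel_measurable M" "(\<lambda>x. indicator B x * f x) \<in> borel_measurable M" for n
    using set_integrable_subset[OF f A] set_integrable_subset[OF f B] by (auto simp: set_integrable_def)
  show "AE x in M. norm (indicator (A n) x * f x) \<le> indicator S x * \<bar>f x\<bar>" for n
    using A(2)[of n] by (intro AE_I2) (auto simp: abs_mult split: split_indicator)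
  show "AE x in M. (\<lambda>n. indicator (A n) x * f x) \<longlonglongrightarrow> indicator B x * f x"
    using lim by eventually_elim (rule tendsto_eventually)
qed


subsection \<open>Sets isolated from the right\<close>

lemma countable_if_right_isolated:
  fixes E :: "real set"
  assumes "\<And>u. u \<in> E \<Longrightarrow> \<exists>e>0. \<forall>v\<in>E. u < v \<longrightarrow> u + e \<le> v"
  shows "countable E"
proof -
  obtain e where e: "\<And>u. u \<in> E \<Longrightarrow> 0 < e u" "\<And>u v. u \<in> E \<Longrightarrow> v \<in> E \<Longrightarrow> u < v \<Longrightarrow> u + e u \<le> v"
    using assms by metis
  define G where "G u = {u<..<u + e u}" for u
  have "disjnt (G u) (G v)" if "u \<in> E" "v \<in> E" "u < v" for u v
    using e(2)[OF that] by (auto simp: G_def disjnt_iff)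
  then have disj: "disjnt (G u) (G v)" if "u \<in> E" "v \<in> E" "u \<noteq> v" for u v
    using that by (cases "u < v") (auto simp: disjnt_sym)
  have nonempty: "G u \<noteq> {}" if "u \<in> E" for u using e(1)[OF that] by (simp add: G_def)
  have "inj_on G E"
    using disj nonempty by (intro inj_onI) (metis disjnt_self_iff_empty)
  moreover have "countable (G ` E)"
    using disj by (intro countable_disjoint_open_subsets) (auto simp: G_def pairwise_def)
  ultimately show ?thesis by (rule countable_image_inj_on[rotated])
qed


section \<open>Brownian motion up to a horizon\<close>

subsection \<open>Centered normal distributions\<close>

definition gaussian :: "real \<Rightarrow> real measure" where
  "gaussian v = density lborel (\<lambda>x. ennreal (normal_density 0 (sqrt v) x))"

lemma sets_gaussian[simp, measurable_cong]: "sets (gaussian v) = sets borel"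
  by (simp add: gaussian_def)

lemma space_gaussian[simp]: "space (gaussian v) = UNIV"
  by (simp add: gaussian_def)

lemma prob_space_gaussian: "0 < v \<Longrightarrow> prob_space (gaussian v)"
  unfolding gaussian_def by (rule prob_space_normal_density) simp

lemma normal_density_exp_tilt:
  assumes "0 < v"
  shows "normal_density 0 (sqrt v) x * exp (p * x - p\<^sup>2 / 2 * v) = normal_density (p * v) (sqrt v) x"
proof -
  have "- x\<^sup>2 / (2 * v) + (p * x - p\<^sup>2 / 2 * v) = - (x - p * v)\<^sup>2 / (2 * v)"
    using assms by (simp add: field_simps power2_eq_square)
  then show ?thesis
    using assms by (simp add: normal_density_def exp_add[symmetric] mult.assoc)
qed

lemma gaussian_exp_martingale:
  assumes "0 < v"
  shows "has_bochner_integral (gaussian v) (\<lambda>x. exp (p * x - p\<^sup>2 / 2 * v)) 1"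
  unfolding gaussian_def
proof (rule has_bochner_integral_density)
  show "has_bochner_integral lborel (\<lambda>x. normal_density 0 (sqrt v) x *\<^sub>R exp (p * x - p\<^sup>2 / 2 * v)) 1"
    unfolding real_scaleR_def normal_density_exp_tilt[OF assms]
    using assms by (simp add: has_bochner_integral_iff)
qed (use assms in auto)

lemma gaussian_exp_moment:
  assumes "0 < v"
  shows "has_bochner_integral (gaussian v) (\<lambda>x. exp (p * x)) (exp (p\<^sup>2 / 2 * v))"
  using has_bochner_integral_mult_right[OF gaussian_exp_martingale[OF assms, of p], of "exp (p\<^sup>2 / 2 * v)"]
  by (simp add: exp_diff)

lemma gaussian_even_moment:
  assumes "0 < v"
  shows "has_bochner_integral (gaussian v) (\<lambda>x. x ^ (2 * k)) (fact (2 * k) / (2 ^ k * fact k) * v ^ k)"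
  unfolding gaussian_def using assms normal_moment_even[of "sqrt v" 0 k]
  by (intro has_bochner_integral_density) (auto simp: power_divide)

lemma gaussian_mean:
  assumes "0 < v"
  shows "has_bochner_integral (gaussian v) (\<lambda>x. x) 0"
  unfolding gaussian_def using assms normal_moment_nz_1[of "sqrt v" 0]
  by (intro has_bochner_integral_density) auto

lemma gaussian_variance: "0 < v \<Longrightarrow> has_bochner_integral (gaussian v) (\<lambda>x. x\<^sup>2) v"
  using gaussian_even_moment[of v 1] by simp

lemma gaussian_fourth_moment: "0 < v \<Longrightarrow> has_bochner_integral (gaussian v) (\<lambda>x. x ^ 4) (3 * v\<^sup>2)"
  using gaussian_even_moment[of v 2] by (simp add: fact_numeral)

lemma gaussian_second_moment_about:
  assumes "0 < v"
  shows "has_bochner_integral (gaussian v) (\<lambda>x. (w + x)\<^sup>2) (w\<^sup>2 + v)"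
proof -
  interpret gaussian: prob_space "gaussian v" using assms by (rule prob_space_gaussian)
  have "has_bochner_integral (gaussian v) (\<lambda>x. w\<^sup>2 + (2 * w * x + x\<^sup>2)) (w\<^sup>2 + (2 * w * 0 + v))"
    using gaussian.prob_space
    by (intro has_bochner_integral_add has_bochner_integral_mult_right gaussian_mean gaussian_variance assms)
      (simp add: has_bochner_integral_iff)
  then show ?thesis by (simp add: power2_sum algebra_simps)
qed

lemma AE_gaussian_neq: "AE x in gaussian v. x \<noteq> c"
  unfolding gaussian_def using AE_lborel_singleton[of c] by (subst AE_density) auto

lemma nn_integral_gaussian_exp_tilt:
  assumes "0 < v" and C[measurable]: "C \<in> sets borel"
  shows "(\<integral>\<^sup>+x. indicator C (x - c * v) * ennreal (exp (c * x - c\<^sup>2 / 2 * v)) \<partial>gaussian v) = emeasure (gaussian v) C"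
proof -
  have "(\<integral>\<^sup>+x. indicator C (x - c * v) * ennreal (exp (c * x - c\<^sup>2 / 2 * v)) \<partial>gaussian v)
      = (\<integral>\<^sup>+x. ennreal (normal_density 0 (sqrt v) x) * (indicator C (x - c * v) * ennreal (exp (c * x - c\<^sup>2 / 2 * v))) \<partial>lborel)"
    unfolding gaussian_def by (subst nn_integral_density) auto
  also have "\<dots> = (\<integral>\<^sup>+x. ennreal (normal_density (c * v) (sqrt v) x) * indicator C (x - c * v) \<partial>lborel)"
    using normal_density_exp_tilt[OF assms(1), of _ c]
    by (intro nn_integral_cong) (simp add: ennreal_mult[symmetric] split: split_indicator)
  also have "\<dots> = (\<integral>\<^sup>+x. ennreal (normal_density 0 (sqrt v) x) * indicator C x \<partial>lborel)"
    by (subst nn_integral_real_affine[of _ 1 "c * v"]) (auto simp: normal_density_def intro!: nn_integral_cong)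
  also have "\<dots> = emeasure (gaussian v) C"
    unfolding gaussian_def by (subst emeasure_density) auto
  finally show ?thesis .
qed


subsection \<open>Increments\<close>

locale brownian_on = prob_space N for N :: "'a measure" +
  fixes F :: "real \<Rightarrow> 'a measure" and W :: "real \<Rightarrow> 'a \<Rightarrow> real" and T :: real
  assumes filtration: "filtration (space N) F"
    and sets_F_subset: "sets (F u) \<subseteq> sets N"
    and W_continuous: "\<omega> \<in> space N \<Longrightarrow> continuous_on UNIV (\<lambda>u. W u \<omega>)"
    and W_adapted: "0 \<le> u \<Longrightarrow> u \<le> T \<Longrightarrow> W u \<in> borel_measurable (F u)"
    and W_measurable[measurable]: "W u \<in> borel_measurable N"
    and W_increment: "0 \<le> s \<Longrightarrow> s < u \<Longrightarrow> u \<le> T \<Longrightarrow> A \<in> sets (F s) \<Longrightarrow> C \<in> sets borel \<Longrightarrow>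
      emeasure N (A \<inter> {\<omega> \<in> space N. W u \<omega> - W s \<omega> \<in> C}) = emeasure N A * emeasure (gaussian (u - s)) C"
begin

lemma space_F[simp]: "space (F u) = space N"
  using filtration by (simp add: filtration_def)

lemma sets_F_mono: "s \<le> u \<Longrightarrow> sets (F s) \<subseteq> sets (F u)"
  using filtration by (simp add: filtration_def)

lemma subalgebra_F: "subalgebra N (F u)"
  using sets_F_subset by (simp add: subalgebra_def)

lemma space_in_sets_F[simp]: "space N \<in> sets (F u)"
  using sets.top[of "F u"] by simp

lemma W_adapted_le: "0 \<le> s \<Longrightarrow> s \<le> u \<Longrightarrow> u \<le> T \<Longrightarrow> W s \<in> borel_measurable (F u)"
  using W_adapted[of s] sets_F_mono[of s u] by (auto simp: measurable_def)

lemma W_jointly_measurable[measurable]: "(\<lambda>x. W (fst x) (snd x)) \<in> borel_measurable (borel \<Otimes>\<^sub>M N)"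
proof (rule borel_measurable_LIMSEQ_real)
  fix n :: nat
  show "(\<lambda>x. W (grid_floor 0 (1 / real (Suc n)) (fst x)) (snd x)) \<in> borel_measurable (borel \<Otimes>\<^sub>M N)"
    unfolding grid_floor_def
    by (rule measurable_compose_countable[where f = "\<lambda>k x. W (0 + 1 / real (Suc n) * of_int k) (snd x)"]) measurable
next
  fix x assume "x \<in> space ((borel :: real measure) \<Otimes>\<^sub>M N)"
  then have x: "snd x \<in> space N" by (auto simp: space_pair_measure)
  have "(\<lambda>n. grid_floor 0 (1 / real (Suc n)) (fst x)) \<longlonglongrightarrow> fst x"
    by (rule grid_floor_tendsto[OF LIMSEQ_Suc[OF lim_const_over_n]]) simp
  then show "(\<lambda>n. W (grid_floor 0 (1 / real (Suc n)) (fst x)) (snd x)) \<longlonglongrightarrow> W (fst x) (snd x)"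
    using continuous_on_tendsto_compose[OF W_continuous[OF x]] by auto
qed

context
  fixes s u :: real
  assumes su: "0 \<le> s" "s < u" "u \<le> T"
begin

interpretation restr: prob_space "restr_to_subalg N (F s)"
  by (rule prob_space_restr_to_subalg[OF subalgebra_F]) unfold_locales

interpretation gaussian: prob_space "gaussian (u - s)"
  using su by (intro prob_space_gaussian) simp

interpretation restr_gaussian: pair_sigma_finite "restr_to_subalg N (F s)" "gaussian (u - s)" ..

lemma measurable_pair_increment[measurable]:
  "(\<lambda>\<omega>. (\<omega>, W u \<omega> - W s \<omega>)) \<in> measurable N (F s \<Otimes>\<^sub>M borel)"
proof -
  have "(\<lambda>\<omega>. \<omega>) \<in> measurable N (F s)"
    using sets_F_subset[of s] by (auto simp: measurable_def dest: sets.sets_into_space)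
  then show ?thesis by (intro measurable_Pair) auto
qed

lemma sets_restr_gaussian: "sets (restr_to_subalg N (F s) \<Otimes>\<^sub>M gaussian (u - s)) = sets (F s \<Otimes>\<^sub>M borel)"
  by (rule sets_pair_measure_cong[OF sets_restr_to_subalg[OF subalgebra_F] sets_gaussian])

lemma distr_pair_increment:
  "distr N (F s \<Otimes>\<^sub>M borel) (\<lambda>\<omega>. (\<omega>, W u \<omega> - W s \<omega>)) = restr_to_subalg N (F s) \<Otimes>\<^sub>M gaussian (u - s)"
proof (rule pair_measure_eqI[symmetric])
  show "sigma_finite_measure (restr_to_subalg N (F s))" "sigma_finite_measure (gaussian (u - s))"
    by unfold_locales
  show "sets (restr_to_subalg N (F s) \<Otimes>\<^sub>M gaussian (u - s)) = sets (distr N (F s \<Otimes>\<^sub>M borel) (\<lambda>\<omega>. (\<omega>, W u \<omega> - W s \<omega>)))"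
    by (simp only: sets_distr sets_restr_gaussian)
  fix A C assume "A \<in> sets (restr_to_subalg N (F s))" "C \<in> sets (gaussian (u - s))"
  then have A: "A \<in> sets (F s)" and C: "C \<in> sets borel"
    using sets_restr_to_subalg[OF subalgebra_F] by auto
  have "emeasure (distr N (F s \<Otimes>\<^sub>M borel) (\<lambda>\<omega>. (\<omega>, W u \<omega> - W s \<omega>))) (A \<times> C)
      = emeasure N (A \<inter> {\<omega> \<in> space N. W u \<omega> - W s \<omega> \<in> C})"
    using A C by (subst emeasure_distr) (auto intro!: arg_cong[of _ _ "emeasure N"])
  then show "emeasure (restr_to_subalg N (F s)) A * emeasure (gaussian (u - s)) C =
      emeasure (distr N (F s \<Otimes>\<^sub>M borel) (\<lambda>\<omega>. (\<omega>, W u \<omega> - W s \<omega>))) (A \<times> C)"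
    using su A C by (simp add: emeasure_restr_to_subalg[OF subalgebra_F] W_increment)
qed

lemma distr_increment: "distr N borel (\<lambda>\<omega>. W u \<omega> - W s \<omega>) = gaussian (u - s)"
proof (rule measure_eqI)
  fix C assume "C \<in> sets (distr N borel (\<lambda>\<omega>. W u \<omega> - W s \<omega>))"
  then have C: "C \<in> sets borel" by simp
  have "emeasure (distr N borel (\<lambda>\<omega>. W u \<omega> - W s \<omega>)) C = emeasure N (space N \<inter> {\<omega> \<in> space N. W u \<omega> - W s \<omega> \<in> C})"
    using C by (subst emeasure_distr) (auto intro!: arg_cong[of _ _ "emeasure N"])
  also have "\<dots> = emeasure (gaussian (u - s)) C"
    using su C W_increment[of s u "space N" C] by (simp add: emeasure_space_1)
  finally show "emeasure (distr N borel (\<lambda>\<omega>. W u \<omega> - W s \<omega>)) C = emeasure (gaussian (u - s)) C" .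
qed simp

lemma has_bochner_integral_increment:
  fixes g :: "real \<Rightarrow> real"
  assumes "has_bochner_integral (gaussian (u - s)) g m"
  shows "has_bochner_integral N (\<lambda>\<omega>. g (W u \<omega> - W s \<omega>)) m"
proof -
  have [measurable]: "g \<in> borel_measurable borel"
    using borel_measurable_has_bochner_integral[OF assms] by simp
  show ?thesis
    using assms unfolding distr_increment[symmetric]
    by (simp add: has_bochner_integral_iff integral_distr integrable_distr_eq)
qed

lemma nn_integral_pair_increment:
  assumes g: "g \<in> borel_measurable (F s \<Otimes>\<^sub>M borel)"
  shows "(\<integral>\<^sup>+\<omega>. g (\<omega>, W u \<omega> - W s \<omega>) \<partial>N) = (\<integral>\<^sup>+\<omega>. \<integral>\<^sup>+x. g (\<omega>, x) \<partial>gaussian (u - s) \<partial>N)"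
proof -
  have g_restr: "g \<in> borel_measurable (restr_to_subalg N (F s) \<Otimes>\<^sub>M gaussian (u - s))"
    using g measurable_cong_sets[OF sets_restr_gaussian refl] by blast
  have inner: "(\<lambda>\<omega>. \<integral>\<^sup>+x. g (\<omega>, x) \<partial>gaussian (u - s)) \<in> borel_measurable (F s)"
    using g by (intro gaussian.borel_measurable_nn_integral) (simp cong: measurable_cong_sets sets_pair_measure_cong)
  have "(\<integral>\<^sup>+\<omega>. g (\<omega>, W u \<omega> - W s \<omega>) \<partial>N) = (\<integral>\<^sup>+x. g x \<partial>distr N (F s \<Otimes>\<^sub>M borel) (\<lambda>\<omega>. (\<omega>, W u \<omega> - W s \<omega>)))"
    using g by (subst nn_integral_distr) auto
  also have "\<dots> = (\<integral>\<^sup>+\<omega>. \<integral>\<^sup>+x. g (\<omega>, x) \<partial>gaussian (u - s) \<partial>restr_to_subalg N (F s))"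
    unfolding distr_pair_increment using g_restr by (subst gaussian.nn_integral_fst[symmetric]) auto
  also have "\<dots> = (\<integral>\<^sup>+\<omega>. \<integral>\<^sup>+x. g (\<omega>, x) \<partial>gaussian (u - s) \<partial>N)"
    using inner by (rule nn_integral_subalgebra2[OF subalgebra_F])
  finally show ?thesis .
qed

lemma has_bochner_integral_pair_increment:
  fixes g :: "'a \<times> real \<Rightarrow> real"
  assumes g: "g \<in> borel_measurable (F s \<Otimes>\<^sub>M borel)"
    and int: "integrable N (\<lambda>\<omega>. g (\<omega>, W u \<omega> - W s \<omega>))"
  shows "has_bochner_integral N (\<lambda>\<omega>. \<integral>x. g (\<omega>, x) \<partial>gaussian (u - s)) (\<integral>\<omega>. g (\<omega>, W u \<omega> - W s \<omega>) \<partial>N)"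
proof -
  have inner: "(\<lambda>\<omega>. \<integral>x. g (\<omega>, x) \<partial>gaussian (u - s)) \<in> borel_measurable (F s)"
    using g by (intro gaussian.borel_measurable_lebesgue_integral) (simp cong: measurable_cong_sets sets_pair_measure_cong)
  have g_int: "integrable (restr_to_subalg N (F s) \<Otimes>\<^sub>M gaussian (u - s)) g"
    using int g unfolding distr_pair_increment[symmetric] by (subst integrable_distr_eq) auto
  have "(\<integral>\<omega>. g (\<omega>, W u \<omega> - W s \<omega>) \<partial>N) = (\<integral>x. g x \<partial>distr N (F s \<Otimes>\<^sub>M borel) (\<lambda>\<omega>. (\<omega>, W u \<omega> - W s \<omega>)))"
    using g by (subst integral_distr) auto
  also have "\<dots> = (\<integral>\<omega>. \<integral>x. g (\<omega>, x) \<partial>gaussian (u - s) \<partial>restr_to_subalg N (F s))"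
    unfolding distr_pair_increment using g_int by (subst restr_gaussian.integral_fst'[symmetric]) auto
  also have "\<dots> = (\<integral>\<omega>. \<integral>x. g (\<omega>, x) \<partial>gaussian (u - s) \<partial>N)"
    using inner by (intro integral_subalgebra2[OF subalgebra_F]) simp
  finally show ?thesis
    using integrable_from_subalg[OF subalgebra_F restr_gaussian.integrable_fst'[OF g_int]] inner
    by (simp add: has_bochner_integral_iff)
qed

end


subsection \<open>Change of measure\<close>

definition tilt :: "real \<Rightarrow> real \<Rightarrow> real \<Rightarrow> 'a \<Rightarrow> real" where
  "tilt c s u \<omega> = exp (c * (W u \<omega> - W s \<omega>) - c\<^sup>2 / 2 * (u - s))"

definition tilted :: "real \<Rightarrow> 'a measure" where
  "tilted c = density N (\<lambda>\<omega>. ennreal (tilt c 0 T \<omega>))"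

lemma space_tilted[simp]: "space (tilted c) = space N"
  by (simp add: tilted_def)

lemma sets_tilted[simp, measurable_cong]: "sets (tilted c) = sets N"
  by (simp add: tilted_def)

lemma tilt_measurable[measurable]: "tilt c s u \<in> borel_measurable N"
  unfolding tilt_def by measurable

lemma tilt_adapted:
  assumes "0 \<le> s" "s \<le> u" "u \<le> T"
  shows "(\<lambda>\<omega>. ennreal (tilt c s u \<omega>)) \<in> borel_measurable (F u)"
proof -
  have [measurable]: "W s \<in> borel_measurable (F u)" "W u \<in> borel_measurable (F u)"
    using assms by (auto intro: W_adapted_le)
  show ?thesis unfolding tilt_def by measurable
qed

lemma tilt_mult: "ennreal (tilt c s u \<omega>) * ennreal (tilt c u v \<omega>) = ennreal (tilt c s v \<omega>)"
  by (simp add: tilt_def ennreal_mult[symmetric] exp_add[symmetric]) (simp add: field_simps)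

lemma nn_integral_mult_tilt:
  assumes "0 \<le> u" "u \<le> T" and G: "G \<in> borel_measurable (F u)"
  shows "(\<integral>\<^sup>+\<omega>. G \<omega> * ennreal (tilt c u T \<omega>) \<partial>N) = (\<integral>\<^sup>+\<omega>. G \<omega> \<partial>N)"
proof (cases "u = T")
  case False
  then have u: "u < T" using assms by simp
  have meas: "(\<lambda>x. G (fst x) * ennreal (exp (c * snd x - c\<^sup>2 / 2 * (T - u)))) \<in> borel_measurable (F u \<Otimes>\<^sub>M borel)"
    using measurable_compose[OF measurable_fst G] by (rule borel_measurable_times_ennreal) measurable
  have "(\<integral>\<^sup>+x. ennreal (exp (c * x - c\<^sup>2 / 2 * (T - u))) \<partial>gaussian (T - u)) = 1"
    using gaussian_exp_martingale[of "T - u" c] u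
    by (subst nn_integral_eq_integral) (auto simp: has_bochner_integral_iff)
  then have "(\<integral>\<^sup>+x. G \<omega> * ennreal (exp (c * x - c\<^sup>2 / 2 * (T - u))) \<partial>gaussian (T - u)) = G \<omega>" for \<omega>
    by (subst nn_integral_cmult) auto
  then show ?thesis
    using nn_integral_pair_increment[OF assms(1) u order_refl meas] unfolding tilt_def by simp
qed (simp add: tilt_def)

lemma emeasure_tilted:
  assumes A: "A \<in> sets (F s)" and s: "0 \<le> s" "s \<le> T"
  shows "emeasure (tilted c) A = (\<integral>\<^sup>+\<omega>. indicator A \<omega> * ennreal (tilt c 0 s \<omega>) \<partial>N)"
proof -
  have A_sets: "A \<in> sets N" using A sets_F_subset by auto
  have "emeasure (tilted c) A = (\<integral>\<^sup>+\<omega>. (indicator A \<omega> * ennreal (tilt c 0 s \<omega>)) * ennreal (tilt c s T \<omega>) \<partial>N)"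
    using A_sets unfolding mult.assoc tilt_mult tilted_def
    by (subst emeasure_density) (auto intro!: nn_integral_cong simp: mult.commute)
  also have "\<dots> = (\<integral>\<^sup>+\<omega>. indicator A \<omega> * ennreal (tilt c 0 s \<omega>) \<partial>N)"
    using s A tilt_adapted[of 0 s c]
    by (intro nn_integral_mult_tilt borel_measurable_times_ennreal borel_measurable_indicator) auto
  finally show ?thesis .
qed

lemma prob_space_tilted:
  assumes "0 \<le> T"
  shows "prob_space (tilted c)"
proof (rule prob_spaceI)
  have "emeasure (tilted c) (space N) = (\<integral>\<^sup>+\<omega>. indicator (space N) \<omega> * ennreal (tilt c 0 0 \<omega>) \<partial>N)"
    using assms by (intro emeasure_tilted) auto
  then show "emeasure (tilted c) (space (tilted c)) = 1"
    by (simp add: tilt_def emeasure_space_1)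
qed

lemma tilted_increment:
  assumes su: "0 \<le> s" "s < u" "u \<le> T" and A: "A \<in> sets (F s)" and C: "C \<in> sets borel"
  shows "emeasure (tilted c) (A \<inter> {\<omega> \<in> space N. (W u \<omega> - W s \<omega>) - c * (u - s) \<in> C})
    = emeasure (tilted c) A * emeasure (gaussian (u - s)) C"
proof -
  define R where "R = {\<omega> \<in> space N. (W u \<omega> - W s \<omega>) - c * (u - s) \<in> C}"
  define D where "D \<omega> = indicator A \<omega> * ennreal (tilt c 0 s \<omega>)" for \<omega>
  define E where "E x = indicator C (x - c * (u - s)) * ennreal (exp (c * x - c\<^sup>2 / 2 * (u - s)))" for x
  have D_meas: "D \<in> borel_measurable (F s)"
    unfolding D_def[abs_def] using A tilt_adapted[of 0 s c] su
    by (intro borel_measurable_times_ennreal borel_measurable_indicator) auto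
  have E_meas[measurable]: "E \<in> borel_measurable borel"
    unfolding E_def[abs_def] using C by measurable
  have "(\<lambda>\<omega>. (W u \<omega> - W s \<omega>) - c * (u - s)) \<in> borel_measurable (F u)"
    by (intro borel_measurable_diff borel_measurable_const W_adapted_le) (use su in auto)
  from measurable_sets[OF this C] have "R \<in> sets (F u)"
    by (simp add: R_def vimage_def Int_def conj_commute)
  moreover have "A \<in> sets (F u)" using A sets_F_mono[of s u] su by auto
  ultimately have "emeasure (tilted c) (A \<inter> R) = (\<integral>\<^sup>+\<omega>. indicator (A \<inter> R) \<omega> * ennreal (tilt c 0 u \<omega>) \<partial>N)"
    using su by (intro emeasure_tilted) auto
  also have "\<dots> = (\<integral>\<^sup>+\<omega>. D \<omega> * E (W u \<omega> - W s \<omega>) \<partial>N)"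
    unfolding tilt_mult[of c 0 s _ u, symmetric]
    by (intro nn_integral_cong) (auto simp: D_def E_def R_def tilt_def[of c s u] split: split_indicator)
  also have "\<dots> = (\<integral>\<^sup>+\<omega>. \<integral>\<^sup>+x. D \<omega> * E x \<partial>gaussian (u - s) \<partial>N)"
    using nn_integral_pair_increment[OF su, of "\<lambda>x. D (fst x) * E (snd x)"]
      borel_measurable_times_ennreal[OF measurable_compose[OF measurable_fst D_meas] measurable_compose[OF measurable_snd E_meas]]
    by simp
  also have "\<dots> = (\<integral>\<^sup>+\<omega>. D \<omega> * emeasure (gaussian (u - s)) C \<partial>N)"
    using su C nn_integral_gaussian_exp_tilt[of "u - s" C c, folded E_def]
    by (intro nn_integral_cong) (subst nn_integral_cmult, auto)
  also have "\<dots> = (\<integral>\<^sup>+\<omega>. D \<omega> \<partial>N) * emeasure (gaussian (u - s)) C"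
    using D_meas by (intro nn_integral_multc) (rule measurable_from_subalg[OF subalgebra_F])
  also have "(\<integral>\<^sup>+\<omega>. D \<omega> \<partial>N) = emeasure (tilted c) A"
    using emeasure_tilted[OF A] su by (simp add: D_def)
  finally show ?thesis unfolding R_def .
qed

theorem girsanov:
  assumes "0 \<le> T"
  shows "brownian_on (tilted c) F (\<lambda>u \<omega>. W u \<omega> - c * u) T"
proof (intro brownian_on.intro brownian_on_axioms.intro)
  show "prob_space (tilted c)" using assms by (rule prob_space_tilted)
  show "filtration (space (tilted c)) F" using filtration by simp
  show "sets (F u) \<subseteq> sets (tilted c)" for u using sets_F_subset by simp
  show "continuous_on UNIV (\<lambda>u. W u \<omega> - c * u)" if "\<omega> \<in> space (tilted c)" for \<omega>
    using W_continuous[of \<omega>] that by (intro continuous_intros) auto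
  show "(\<lambda>\<omega>. W u \<omega> - c * u) \<in> borel_measurable (F u)" if "0 \<le> u" "u \<le> T" for u
    using W_adapted[OF that] by measurable
  show "(\<lambda>\<omega>. W u \<omega> - c * u) \<in> borel_measurable (tilted c)" for u by measurable
  fix s u A and C :: "real set" assume "0 \<le> s" "s < u" "u \<le> T" "A \<in> sets (F s)" "C \<in> sets borel"
  from tilted_increment[OF this, of c]
  show "emeasure (tilted c) (A \<inter> {\<omega> \<in> space (tilted c). (W u \<omega> - c * u) - (W s \<omega> - c * s) \<in> C})
      = emeasure (tilted c) A * emeasure (gaussian (u - s)) C"
    by (simp add: algebra_simps)
qed

end


subsection \<open>Integrals over time and probability space\<close>

lemma (in prob_space) time_product_integrals:
  fixes E :: "real \<times> 'a \<Rightarrow> real"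
  assumes E[measurable]: "E \<in> borel_measurable (borel \<Otimes>\<^sub>M M)" and E_nonneg: "\<And>x. 0 \<le> E x"
    and g[measurable]: "g \<in> borel_measurable borel" and I[measurable]: "I \<in> sets borel"
    and marginal: "\<And>u. u \<in> I \<Longrightarrow> has_bochner_integral M (\<lambda>\<omega>. E (u, \<omega>)) (m u)"
    and int: "set_integrable lborel I (\<lambda>u. g u * m u)"
  shows "set_integrable (lborel \<Otimes>\<^sub>M M) (I \<times> space M) (\<lambda>x. g (fst x) * E x)" (is ?int)
    and "has_bochner_integral M (\<lambda>\<omega>. LBINT u:I. g u * E (u, \<omega>)) (LBINT u:I. g u * m u)" (is ?val)
proof -
  interpret time: pair_sigma_finite lborel M ..
  define G where "G x = indicator I (fst x) * (g (fst x) * E x)" for x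
  have G_meas[measurable]: "G \<in> borel_measurable (lborel \<Otimes>\<^sub>M M)"
    unfolding G_def by measurable
  have m: "integrable M (\<lambda>\<omega>. E (u, \<omega>))" "(\<integral>\<omega>. E (u, \<omega>) \<partial>M) = m u" "0 \<le> m u" if "u \<in> I" for u
    using marginal[OF that] Bochner_Integration.integral_nonneg[of M "\<lambda>\<omega>. E (u, \<omega>)"] E_nonneg
    by (auto simp: has_bochner_integral_iff)
  have inner: "integrable M (\<lambda>\<omega>. G (u, \<omega>))" "(\<integral>\<omega>. G (u, \<omega>) \<partial>M) = indicator I u * (g u * m u)" for u
    using m[of u] by (auto simp: G_def split: split_indicator)
  have "(\<integral>\<omega>. norm (G (u, \<omega>)) \<partial>M) = norm (indicator I u * (g u * m u))" for u
    using m[of u] E_nonneg by (auto simp: G_def abs_mult split: split_indicator)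
  then have G_int: "integrable (lborel \<Otimes>\<^sub>M M) G"
    using int inner by (intro time.Fubini_integrable) (auto simp: set_integrable_def)
  have "indicator (I \<times> space M) x *\<^sub>R (g (fst x) * E x) = G x" if "x \<in> space (lborel \<Otimes>\<^sub>M M)" for x
    using that by (auto simp: G_def space_pair_measure indicator_def)
  then show ?int
    unfolding set_integrable_def using G_int by (subst Bochner_Integration.integrable_cong[OF refl]) auto
  have "case_prod (\<lambda>u \<omega>. G (u, \<omega>)) = G" by auto
  then have "has_bochner_integral M (\<lambda>\<omega>. LBINT u. G (u, \<omega>)) (LBINT u. \<integral>\<omega>. G (u, \<omega>) \<partial>M)"
    using time.integrable_snd[of "\<lambda>u \<omega>. G (u, \<omega>)"] time.integral_snd[of "\<lambda>u \<omega>. G (u, \<omega>)"]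
      time.integral_fst[of "\<lambda>u \<omega>. G (u, \<omega>)"] G_int
    by (simp add: has_bochner_integral_iff)
  then show ?val
    unfolding inner by (simp add: G_def set_lebesgue_integral_def)
qed

lemma (in pair_sigma_finite) set_integral_Times:
  fixes f :: "'a \<times> 'b \<Rightarrow> real"
  assumes "set_integrable (M1 \<Otimes>\<^sub>M M2) (A \<times> B) f"
  shows "(LINT x:A \<times> B|M1 \<Otimes>\<^sub>M M2. f x) = (LINT u:A|M1. LINT v:B|M2. f (u, v))"
  using integral_fst'[OF assms[unfolded set_integrable_def]]
  by (simp add: set_lebesgue_integral_def indicator_times mult.assoc)

lemma (in pair_sigma_finite) has_bochner_integral_set_integral_snd:
  fixes f :: "'a \<times> 'b \<Rightarrow> real"
  assumes "set_integrable (M1 \<Otimes>\<^sub>M M2) E f"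
  shows "has_bochner_integral M2 (\<lambda>v. LINT u:{u. (u, v) \<in> E}|M1. f (u, v)) (LINT x:E|M1 \<Otimes>\<^sub>M M2. f x)"
proof -
  have "integrable (M1 \<Otimes>\<^sub>M M2) (case_prod (\<lambda>u v. indicator E (u, v) * f (u, v)))"
    using assms by (simp add: set_integrable_def split_beta')
  from integrable_snd[OF this] integral_snd[OF this] show ?thesis
    by (simp add: has_bochner_integral_iff set_lebesgue_integral_def indicator_def split_beta')
qed

lemma set_integrable_Ico:
  fixes g :: "real \<Rightarrow> real"
  assumes "continuous_on UNIV g"
  shows "set_integrable lborel {a..<b} g"
  by (rule set_integrable_subset[OF borel_integrable_atLeastAtMost'[of a b]])
    (auto intro: continuous_on_subset[OF assms])


subsection \<open>Stopping times\<close>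

context brownian_on
begin

definition admissible :: "real \<Rightarrow> ('a \<Rightarrow> real) \<Rightarrow> bool" where
  "admissible s \<tau> \<longleftrightarrow> stopping_time F \<tau> \<and> (\<forall>\<omega>\<in>space N. s \<le> \<tau> \<omega> \<and> \<tau> \<omega> \<le> T)"

lemma admissibleD:
  assumes "admissible s \<tau>"
  shows "stopping_time F \<tau>" "\<And>\<omega>. \<omega> \<in> space N \<Longrightarrow> s \<le> \<tau> \<omega>" "\<And>\<omega>. \<omega> \<in> space N \<Longrightarrow> \<tau> \<omega> \<le> T"
  using assms by (auto simp: admissible_def)

lemma admissible_const: "s \<le> u \<Longrightarrow> u \<le> T \<Longrightarrow> admissible s (\<lambda>_. u)"
  by (simp add: admissible_def stopping_time_const)

lemma admissible_le_horizon: "admissible s \<tau> \<Longrightarrow> s \<le> T"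
  using not_empty by (fastforce simp: admissible_def)

lemma admissible_min: "admissible s \<tau> \<Longrightarrow> s \<le> u \<Longrightarrow> admissible s (\<lambda>\<omega>. min u (\<tau> \<omega>))"
  using stopping_time_min[OF stopping_time_const, of F \<tau> u] by (auto simp: admissible_def)

lemma stopping_time_measurable: "stopping_time F \<tau> \<Longrightarrow> \<tau> \<in> borel_measurable N"
  by (rule measurable_stopping_time[of F]) (use sets_F_subset in auto)

lemma admissible_if:
  assumes "D \<in> sets (F s)" "s \<le> s'" "admissible s' \<tau>"
  shows "admissible s (\<lambda>\<omega>. if \<omega> \<in> D then \<tau> \<omega> else s)"
  unfolding admissible_def
proof (intro conjI ballI)
  show "stopping_time F (\<lambda>\<omega>. if \<omega> \<in> D then \<tau> \<omega> else s)"
  proof (rule stopping_timeI)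
    fix v
    show "Measurable.pred (F v) (\<lambda>\<omega>. (if \<omega> \<in> D then \<tau> \<omega> else s) \<le> v)"
    proof (cases "s \<le> v")
      case True
      then have [measurable]: "D \<in> sets (F v)" using assms(1) sets_F_mono by blast
      have [measurable]: "Measurable.pred (F v) (\<lambda>\<omega>. \<tau> \<omega> \<le> v)"
        by (rule stopping_timeD[OF admissibleD(1)[OF assms(3)]])
      have "(\<lambda>\<omega>. (if \<omega> \<in> D then \<tau> \<omega> else s) \<le> v) = (\<lambda>\<omega>. \<omega> \<in> D \<longrightarrow> \<tau> \<omega> \<le> v)"
        using True by auto
      then show ?thesis by simp
    next
      case False
      then have "\<not> (if \<omega> \<in> D then \<tau> \<omega> else s) \<le> v" if "\<omega> \<in> space N" for \<omega>
        using admissibleD(2)[OF assms(3) that] assms(2) by auto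
      then have "{\<omega> \<in> space (F v). (if \<omega> \<in> D then \<tau> \<omega> else s) \<le> v} = {}" by auto
      then show ?thesis by (simp only: pred_def sets.empty_sets)
    qed
  qed
  fix \<omega> assume \<omega>: "\<omega> \<in> space N"
  show "s \<le> (if \<omega> \<in> D then \<tau> \<omega> else s)" "(if \<omega> \<in> D then \<tau> \<omega> else s) \<le> T"
    using admissibleD(2,3)[OF assms(3) \<omega>] assms(2) by auto
qed

text \<open>Capping at the last grid point rather than at \<open>T\<close> keeps the values on the grid.\<close>

definition grid_stop :: "real \<Rightarrow> real \<Rightarrow> ('a \<Rightarrow> real) \<Rightarrow> 'a \<Rightarrow> real" where
  "grid_stop s h \<tau> \<omega> = min (grid_ceiling s h (\<tau> \<omega>)) (grid_floor s h T)"

lemma stopping_time_grid_ceiling: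
  assumes "0 < h" "stopping_time F \<tau>"
  shows "stopping_time F (\<lambda>\<omega>. grid_ceiling s h (\<tau> \<omega>))"
proof (rule stopping_timeI)
  fix v
  have "Measurable.pred (F (grid_floor s h v)) (\<lambda>\<omega>. \<tau> \<omega> \<le> grid_floor s h v)"
    by (rule stopping_timeD[OF assms(2)])
  then have "Measurable.pred (F v) (\<lambda>\<omega>. \<tau> \<omega> \<le> grid_floor s h v)"
    using sets_F_mono[OF grid_floor_le[OF assms(1)], of s v] by (auto simp: pred_def)
  then show "Measurable.pred (F v) (\<lambda>\<omega>. grid_ceiling s h (\<tau> \<omega>) \<le> v)"
    by (simp add: grid_ceiling_le_iff[OF assms(1)])
qed

lemma admissible_grid_stop:
  assumes "0 < h" "admissible s \<tau>"
  shows "admissible s (grid_stop s h \<tau>)"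
  unfolding admissible_def
proof (intro conjI ballI)
  show "stopping_time F (grid_stop s h \<tau>)"
    unfolding grid_stop_def
    using assms by (intro stopping_time_min stopping_time_const stopping_time_grid_ceiling) (auto dest: admissibleD)
  show "s \<le> grid_stop s h \<tau> \<omega>" if "\<omega> \<in> space N" for \<omega>
    using assms admissibleD(2)[OF assms(2) that] admissible_le_horizon[OF assms(2)]
    by (simp add: grid_stop_def start_le_grid_ceiling start_le_grid_floor)
  show "grid_stop s h \<tau> \<omega> \<le> T" for \<omega>
    using grid_floor_le[OF assms(1), of s T] by (simp add: grid_stop_def)
qed

lemma grid_stop_on_grid:
  assumes "0 < h" "admissible s \<tau>" "\<omega> \<in> space N"
  shows "\<exists>i. grid_stop s h \<tau> \<omega> = s + real i * h"
proof -
  define k where "k = min \<lceil>(\<tau> \<omega> - s) / h\<rceil> \<lfloor>(T - s) / h\<rfloor>"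
  have eq: "grid_stop s h \<tau> \<omega> = s + h * of_int k"
    using assms(1) by (simp add: grid_stop_def grid_ceiling_def grid_floor_def k_def min_def)
  moreover have "0 \<le> k"
    using admissibleD(2)[OF admissible_grid_stop[OF assms(1,2)] assms(3)] assms(1) unfolding eq
    by (simp add: zero_le_mult_iff)
  ultimately show ?thesis by (intro exI[of _ "nat k"]) (simp add: mult.commute)
qed

lemma grid_stop_tendsto:
  assumes "admissible s \<tau>" "\<omega> \<in> space N" "h \<longlonglongrightarrow> 0" "\<And>n. 0 < h n"
  shows "(\<lambda>n. grid_stop s (h n) \<tau> \<omega>) \<longlonglongrightarrow> \<tau> \<omega>"
proof (rule tendsto_sandwich)
  have "\<tau> \<omega> \<le> T" by (rule admissibleD(3)[OF assms(1,2)])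
  then have bounds: "\<tau> \<omega> - h n \<le> grid_stop s (h n) \<tau> \<omega>" "grid_stop s (h n) \<tau> \<omega> \<le> \<tau> \<omega> + h n" for n
    using less_grid_floor_add[OF assms(4), of T s n] assms(4)[of n]
      le_grid_ceiling[OF assms(4), of "\<tau> \<omega>" s n] grid_ceiling_less_add[OF assms(4), of s n "\<tau> \<omega>"]
    by (simp_all add: grid_stop_def min_def)
  show "\<forall>\<^sub>F n in sequentially. \<tau> \<omega> - h n \<le> grid_stop s (h n) \<tau> \<omega>"
    "\<forall>\<^sub>F n in sequentially. grid_stop s (h n) \<tau> \<omega> \<le> \<tau> \<omega> + h n"
    using bounds by auto
  show "(\<lambda>n. \<tau> \<omega> - h n) \<longlonglongrightarrow> \<tau> \<omega>" "(\<lambda>n. \<tau> \<omega> + h n) \<longlonglongrightarrow> \<tau> \<omega>"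
    using tendsto_diff[OF tendsto_const assms(3)] tendsto_add[OF tendsto_const assms(3)] by simp_all
qed

end


subsection \<open>Exponential martingales\<close>

locale log_martingale = brownian_on N F W T
  for N :: "'a measure" and F :: "real \<Rightarrow> 'a measure" and W :: "real \<Rightarrow> 'a \<Rightarrow> real" and T :: real +
  fixes \<nu> :: real
begin

definition Y :: "real \<Rightarrow> real \<Rightarrow> real \<Rightarrow> 'a \<Rightarrow> real" where
  "Y t y u \<omega> = y + \<nu> * (W u \<omega> - W t \<omega>) - \<nu>\<^sup>2 / 2 * (u - t)"

definition transition :: "real \<Rightarrow> (real \<Rightarrow> real) \<Rightarrow> real \<Rightarrow> real" where
  "transition h g x = (\<integral>z. g (x + \<nu> * z - \<nu>\<^sup>2 / 2 * h) \<partial>gaussian h)"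

lemma Y_measurable[measurable]: "Y t y u \<in> borel_measurable N"
  unfolding Y_def by measurable

lemma Y_adapted: "0 \<le> t \<Longrightarrow> t \<le> u \<Longrightarrow> u \<le> T \<Longrightarrow> Y t y u \<in> borel_measurable (F u)"
  unfolding Y_def using W_adapted_le[of u u] W_adapted_le[of t u] by measurable

lemma Y_jointly_measurable[measurable]: "(\<lambda>x. Y t y (fst x) (snd x)) \<in> borel_measurable (borel \<Otimes>\<^sub>M N)"
  unfolding Y_def by measurable

lemma Y_continuous: "\<omega> \<in> space N \<Longrightarrow> continuous_on UNIV (\<lambda>u. Y t y u \<omega>)"
  unfolding Y_def by (intro continuous_intros W_continuous)

lemma Y_start[simp]: "Y t y t \<omega> = y"
  by (simp add: Y_def)

lemma Y_increment: "Y t y u \<omega> = Y t y s \<omega> + \<nu> * (W u \<omega> - W s \<omega>) - \<nu>\<^sup>2 / 2 * (u - s)"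
  by (simp add: Y_def field_simps)

lemma transition_measurable[measurable]:
  assumes "0 < h" and [measurable]: "g \<in> borel_measurable borel"
  shows "transition h g \<in> borel_measurable borel"
proof -
  interpret gaussian: prob_space "gaussian h" using assms(1) by (rule prob_space_gaussian)
  show ?thesis unfolding transition_def[abs_def] by measurable
qed

lemma transition_integrable:
  fixes g :: "real \<Rightarrow> real"
  assumes "0 < h" and [measurable]: "g \<in> borel_measurable borel" and "\<And>x. \<bar>g x\<bar> \<le> C"
  shows "integrable (gaussian h) (\<lambda>z. g (x + \<nu> * z - \<nu>\<^sup>2 / 2 * h))"
proof -
  interpret gaussian: prob_space "gaussian h" using assms(1) by (rule prob_space_gaussian)
  show ?thesis using assms(3) by (intro gaussian.integrable_const_bound[where B = C]) auto
qed

lemma Y_zero_volatility: "\<nu> = 0 \<Longrightarrow> Y t y u \<omega> = y"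
  unfolding Y_def by simp

lemma transition_zero_volatility: "\<nu> = 0 \<Longrightarrow> 0 < h \<Longrightarrow> transition h g x = g x"
  unfolding transition_def using prob_space.prob_space[OF prob_space_gaussian[of h]] by simp

lemma transition_exp:
  assumes "0 < h"
  shows "transition h (\<lambda>x. exp (p * x)) x = exp ((p\<^sup>2 - p) * \<nu>\<^sup>2 / 2 * h) * exp (p * x)"
proof -
  have "transition h (\<lambda>x. exp (p * x)) x = (\<integral>z. exp (p * x - p * \<nu>\<^sup>2 / 2 * h) * exp ((p * \<nu>) * z) \<partial>gaussian h)"
    unfolding transition_def by (simp add: exp_add[symmetric] algebra_simps)
  also have "\<dots> = exp (p * x - p * \<nu>\<^sup>2 / 2 * h) * exp ((p * \<nu>)\<^sup>2 / 2 * h)"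
    using has_bochner_integral_integral_eq[OF gaussian_exp_moment[OF assms, of "p * \<nu>"]] by simp
  also have "\<dots> = exp ((p\<^sup>2 - p) * \<nu>\<^sup>2 / 2 * h) * exp (p * x)"
    by (simp add: exp_add[symmetric]) (simp add: field_simps power_mult_distrib)
  finally show ?thesis .
qed

lemma Y_markov:
  assumes t: "0 \<le> t" "t \<le> s" and h: "0 < h" "s + h \<le> T" and A: "A \<in> sets (F s)"
    and g[measurable]: "g \<in> borel_measurable borel"
    and int: "integrable N (\<lambda>\<omega>. g (Y t y (s + h) \<omega>))"
  shows "set_integrable N A (\<lambda>\<omega>. transition h g (Y t y s \<omega>))"
    and "(LINT \<omega>:A|N. g (Y t y (s + h) \<omega>)) = (LINT \<omega>:A|N. transition h g (Y t y s \<omega>))"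
proof -
  define G where "G x = indicator A (fst x) * g (Y t y s (fst x) + \<nu> * snd x - \<nu>\<^sup>2 / 2 * h)" for x :: "'a \<times> real"
  have "Y t y s \<in> borel_measurable (F s)" using t h by (intro Y_adapted) auto
  from measurable_compose[OF measurable_fst this]
  have "(\<lambda>x. Y t y s (fst x) + \<nu> * snd x - \<nu>\<^sup>2 / 2 * h) \<in> borel_measurable (F s \<Otimes>\<^sub>M borel)" by measurable
  from measurable_compose[OF this g] measurable_compose[OF measurable_fst borel_measurable_indicator[OF A]]
  have G_meas: "G \<in> borel_measurable (F s \<Otimes>\<^sub>M borel)"
    unfolding G_def by (rule borel_measurable_times[rotated])
  have G_increment: "G (\<omega>, W (s + h) \<omega> - W s \<omega>) = indicator A \<omega> * g (Y t y (s + h) \<omega>)" for \<omega>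
    unfolding G_def using Y_increment[of t y "s + h" \<omega> s] by simp
  have G_transition: "(\<integral>x. G (\<omega>, x) \<partial>gaussian (s + h - s)) = indicator A \<omega> * transition h g (Y t y s \<omega>)" for \<omega>
    unfolding G_def transition_def by simp
  have "integrable N (\<lambda>\<omega>. indicator A \<omega> * g (Y t y (s + h) \<omega>))"
    using integrable_mult_indicator[OF _ int, of A] A sets_F_subset by auto
  with has_bochner_integral_pair_increment[of s "s + h" G] G_meas t h
  have "has_bochner_integral N (\<lambda>\<omega>. indicator A \<omega> * transition h g (Y t y s \<omega>)) (\<integral>\<omega>. indicator A \<omega> * g (Y t y (s + h) \<omega>) \<partial>N)"
    unfolding G_increment G_transition by simp
  then show "set_integrable N A (\<lambda>\<omega>. transition h g (Y t y s \<omega>))"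
    "(LINT \<omega>:A|N. g (Y t y (s + h) \<omega>)) = (LINT \<omega>:A|N. transition h g (Y t y s \<omega>))"
    by (simp_all add: has_bochner_integral_iff set_integrable_def set_lebesgue_integral_def)
qed

lemma AE_Y_neq:
  assumes "\<nu> \<noteq> 0" "0 \<le> t" "t < u" "u \<le> T"
  shows "AE \<omega> in N. Y t y u \<omega> \<noteq> c"
proof -
  define c' where "c' = (c - y + \<nu>\<^sup>2 / 2 * (u - t)) / \<nu>"
  have "AE x in distr N borel (\<lambda>\<omega>. W u \<omega> - W t \<omega>). x \<noteq> c'"
    unfolding distr_increment[OF assms(2-4)] by (rule AE_gaussian_neq)
  then have "AE \<omega> in N. W u \<omega> - W t \<omega> \<noteq> c'" by (subst (asm) AE_distr_iff) auto
  then show ?thesis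
    by eventually_elim (use assms(1) in \<open>auto simp: Y_def c'_def field_simps\<close>)
qed

lemma exp_Y_moment:
  assumes "0 \<le> t" "t \<le> u" "u \<le> T"
  shows "has_bochner_integral N (\<lambda>\<omega>. exp (p * Y t y u \<omega>)) (exp (p * y + (p\<^sup>2 - p) * \<nu>\<^sup>2 / 2 * (u - t)))"
proof (cases "t = u")
  case True
  then show ?thesis by (simp add: has_bochner_integral_iff prob_space)
next
  case False
  then have "has_bochner_integral N (\<lambda>\<omega>. exp (p * \<nu> * (W u \<omega> - W t \<omega>))) (exp ((p * \<nu>)\<^sup>2 / 2 * (u - t)))"
    using assms by (intro has_bochner_integral_increment gaussian_exp_moment) auto
  from has_bochner_integral_mult_right[OF this, of "exp (p * y - p * \<nu>\<^sup>2 / 2 * (u - t))"]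
  show ?thesis
    unfolding Y_def exp_add[symmetric] by (rule has_bochner_integral_cong[THEN iffD1, rotated -1])
      (simp_all add: field_simps power_mult_distrib)
qed

lemma exp_Y_integrable: "0 \<le> t \<Longrightarrow> t \<le> u \<Longrightarrow> u \<le> T \<Longrightarrow> integrable N (\<lambda>\<omega>. exp (p * Y t y u \<omega>))"
  using exp_Y_moment by (simp add: has_bochner_integral_iff)

lemma exp_Y_conditional:
  assumes "0 \<le> t" "t \<le> s" "s \<le> u" "u \<le> T" "A \<in> sets (F s)"
  shows "(LINT \<omega>:A|N. exp (p * Y t y u \<omega>))
    = exp ((p\<^sup>2 - p) * \<nu>\<^sup>2 / 2 * (u - s)) * (LINT \<omega>:A|N. exp (p * Y t y s \<omega>))"
proof (cases "s = u")
  case False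
  then have "(LINT \<omega>:A|N. exp (p * Y t y u \<omega>)) = (LINT \<omega>:A|N. transition (u - s) (\<lambda>x. exp (p * x)) (Y t y s \<omega>))"
    using Y_markov(2)[of t s "u - s" A "\<lambda>x. exp (p * x)" y] exp_Y_integrable[of t u p y] assms by simp
  then show ?thesis using False assms by (simp add: transition_exp)
qed simp

lemma exp_Y_simple_stopping:
  assumes t: "0 \<le> t" and S: "finite S" "S \<subseteq> {t..T}"
    and \<sigma>: "\<And>\<omega>. \<omega> \<in> space N \<Longrightarrow> \<sigma> \<omega> \<in> S" "stopping_time F \<sigma>"
  shows "has_bochner_integral N (\<lambda>\<omega>. exp (p * Y t y (\<sigma> \<omega>) \<omega>))
    (\<integral>\<omega>. exp (- ((p\<^sup>2 - p) * \<nu>\<^sup>2 / 2 * (T - \<sigma> \<omega>))) * exp (p * Y t y T \<omega>) \<partial>N)"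
proof -
  define c where "c = (p\<^sup>2 - p) * \<nu>\<^sup>2 / 2"
  define A where "A s = {\<omega> \<in> space N. \<sigma> \<omega> = s}" for s
  have A_F: "A s \<in> sets (F s)" for s
    using filtration.stopping_time_eq_const[OF filtration \<sigma>(2), of s] by (simp add: A_def pred_def)
  then have A_sets: "A s \<in> sets N" for s using sets_F_subset by blast
  have collapse: "(\<Sum>s\<in>S. indicator (A s) \<omega> * f s) = f (\<sigma> \<omega>)" if "\<omega> \<in> space N" for f :: "real \<Rightarrow> real" and \<omega>
  proof -
    have "(\<Sum>s\<in>S. indicator (A s) \<omega> * f s) = (\<Sum>s\<in>S. if s = \<sigma> \<omega> then f s else 0)"
      using that by (intro sum.cong) (auto simp: A_def indicator_def)
    then show ?thesis using S(1) \<sigma>(1)[OF that] by simp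
  qed
  have int: "integrable N (\<lambda>\<omega>. indicator (A s) \<omega> * exp (p * Y t y u \<omega>))" if "t \<le> u" "u \<le> T" for s u
    using integrable_mult_indicator[OF A_sets exp_Y_integrable[OF t that, of p y]] by simp
  have S_int: "integrable N (\<lambda>\<omega>. indicator (A s) \<omega> * exp (p * Y t y s \<omega>))"
    "integrable N (\<lambda>\<omega>. indicator (A s) \<omega> * (exp (- (c * (T - s))) * exp (p * Y t y T \<omega>)))" if "s \<in> S" for s
    using int[of s s] integrable_mult_right[OF int[of T s], of "exp (- (c * (T - s)))"] that S(2)
    by (auto simp: mult.left_commute)
  have S_eq: "(\<integral>\<omega>. indicator (A s) \<omega> * exp (p * Y t y s \<omega>) \<partial>N)
      = (\<integral>\<omega>. indicator (A s) \<omega> * (exp (- (c * (T - s))) * exp (p * Y t y T \<omega>)) \<partial>N)" if "s \<in> S" for s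
  proof -
    have "(\<integral>\<omega>. indicator (A s) \<omega> * exp (p * Y t y T \<omega>) \<partial>N)
        = exp (c * (T - s)) * (\<integral>\<omega>. indicator (A s) \<omega> * exp (p * Y t y s \<omega>) \<partial>N)"
      using exp_Y_conditional[OF t _ _ order_refl A_F[of s], of p y] S(2) that
      by (auto simp: c_def[symmetric] set_lebesgue_integral_def)
    then show ?thesis
      unfolding mult.left_commute[of "indicator _ _"] Bochner_Integration.integral_mult_right_zero
      by (simp add: exp_minus)
  qed
  have "has_bochner_integral N (\<lambda>\<omega>. \<Sum>s\<in>S. indicator (A s) \<omega> * exp (p * Y t y s \<omega>))
      (\<Sum>s\<in>S. \<integral>\<omega>. indicator (A s) \<omega> * (exp (- (c * (T - s))) * exp (p * Y t y T \<omega>)) \<partial>N)"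
    using S_int S_eq by (intro has_bochner_integral_sum) (simp add: has_bochner_integral_iff)
  also have "(\<Sum>s\<in>S. \<integral>\<omega>. indicator (A s) \<omega> * (exp (- (c * (T - s))) * exp (p * Y t y T \<omega>)) \<partial>N)
      = (\<integral>\<omega>. (\<Sum>s\<in>S. indicator (A s) \<omega> * (exp (- (c * (T - s))) * exp (p * Y t y T \<omega>))) \<partial>N)"
    using S_int by (intro Bochner_Integration.integral_sum[symmetric])
  also have "\<dots> = (\<integral>\<omega>. exp (- (c * (T - \<sigma> \<omega>))) * exp (p * Y t y T \<omega>) \<partial>N)"
    by (intro Bochner_Integration.integral_cong refl collapse)
  finally show ?thesis
    unfolding c_def[symmetric] by (subst (asm) has_bochner_integral_cong[OF refl collapse refl])
qed

theorem exp_Y_optional_stopping: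
  assumes t: "0 \<le> t" and \<tau>: "admissible t \<tau>"
  shows "has_bochner_integral N (\<lambda>\<omega>. exp (Y t y (\<tau> \<omega>) \<omega>)) (exp y)"
proof -
  have tT: "t \<le> T" using \<tau> by (rule admissible_le_horizon)
  define h where "h n = 1 / real (Suc n)" for n
  have h: "h \<longlonglongrightarrow> 0" "\<And>n. 0 < h n"
    unfolding h_def using LIMSEQ_Suc[OF lim_const_over_n[of 1]] by simp_all
  define \<sigma> where "\<sigma> n = grid_stop t (h n) \<tau>" for n
  have \<sigma>: "admissible t (\<sigma> n)" for n
    unfolding \<sigma>_def using h(2) \<tau> by (rule admissible_grid_stop)
  define S where "S n = (\<lambda>i. t + real i * h n) ` {i. t + real i * h n \<le> T}" for n
  have "finite (S n)" for n unfolding S_def using h(2) by (intro finite_imageI finite_grid)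
  moreover have "\<sigma> n \<omega> \<in> S n" if "\<omega> \<in> space N" for n \<omega>
    using grid_stop_on_grid[OF h(2) \<tau> that, of n] admissibleD(3)[OF \<sigma> that, of n]
    by (auto simp: S_def \<sigma>_def)
  moreover have "S n \<subseteq> {t..T}" for n using h(2)[of n] by (auto simp: S_def)
  ultimately have simple: "has_bochner_integral N (\<lambda>\<omega>. exp (p * Y t y (\<sigma> n \<omega>) \<omega>))
      (\<integral>\<omega>. exp (- ((p\<^sup>2 - p) * \<nu>\<^sup>2 / 2 * (T - \<sigma> n \<omega>))) * exp (p * Y t y T \<omega>) \<partial>N)" for p n
    using admissibleD(1)[OF \<sigma>] by (intro exp_Y_simple_stopping[OF t, where S = "S n"]) simp_all
  show ?thesis
  proof (rule has_bochner_integral_limit_of_bounded_second_moment)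
    show "(\<lambda>n. exp (Y t y (\<sigma> n \<omega>) \<omega>)) \<longlonglongrightarrow> exp (Y t y (\<tau> \<omega>) \<omega>)" if "\<omega> \<in> space N" for \<omega>
      using continuous_on_tendsto_compose[OF Y_continuous[OF that] grid_stop_tendsto[OF \<tau> that h]]
      by (intro tendsto_exp) (simp add: \<sigma>_def)
    show "has_bochner_integral N (\<lambda>\<omega>. exp (Y t y (\<sigma> n \<omega>) \<omega>)) (exp y)" for n
      using simple[of 1 n] exp_Y_moment[OF t tT order_refl, of 1 y] by (simp add: has_bochner_integral_iff)
    have square: "(exp (Y t y (\<sigma> n \<omega>) \<omega>))\<^sup>2 = exp (2 * Y t y (\<sigma> n \<omega>) \<omega>)" for n \<omega> by (simp add: exp_double)
    show "integrable N (\<lambda>\<omega>. (exp (Y t y (\<sigma> n \<omega>) \<omega>))\<^sup>2)" for n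
      unfolding square using simple[of 2 n] by (simp add: has_bochner_integral_iff)
    show "(\<integral>\<omega>. (exp (Y t y (\<sigma> n \<omega>) \<omega>))\<^sup>2 \<partial>N) \<le> (\<integral>\<omega>. exp (2 * Y t y T \<omega>) \<partial>N)" for n
      unfolding square has_bochner_integral_integral_eq[OF simple[of 2 n]]
    proof (rule integral_mono_AE'[OF exp_Y_integrable[OF t tT order_refl] AE_I2])
      fix \<omega> assume "\<omega> \<in> space N"
      then have "0 \<le> (2\<^sup>2 - 2) * \<nu>\<^sup>2 / 2 * (T - \<sigma> n \<omega>)"
        using admissibleD(3)[OF \<sigma>] by (intro mult_nonneg_nonneg) auto
      then show "exp (- ((2\<^sup>2 - 2) * \<nu>\<^sup>2 / 2 * (T - \<sigma> n \<omega>))) * exp (2 * Y t y T \<omega>) \<le> exp (2 * Y t y T \<omega>)"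
        by (intro mult_left_le_one_le) auto
    qed auto
  qed simp
qed

lemma exp_Y_optional_stopping_tail:
  assumes t: "0 \<le> t" and \<tau>: "admissible t \<tau>" and g: "continuous_on UNIV g"
  shows "has_bochner_integral N
    (\<lambda>\<omega>. (LBINT u:{t..<\<tau> \<omega>}. g u * exp (Y t y u \<omega>)) + exp (Y t y (\<tau> \<omega>) \<omega>) * (v + (LBINT u:{\<tau> \<omega>..<T}. g u)))
    (exp y * (v + (LBINT u:{t..<T}. g u)))"
proof -
  have [measurable]: "\<tau> \<in> borel_measurable N"
    using admissibleD(1)[OF \<tau>] by (rule stopping_time_measurable)
  define E where "E x = exp (Y t y (min (fst x) (\<tau> (snd x))) (snd x))" for x
  have E_meas: "E \<in> borel_measurable (borel \<Otimes>\<^sub>M N)"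
    using measurable_compose[of "\<lambda>x. (min (fst x) (\<tau> (snd x)), snd x)" "borel \<Otimes>\<^sub>M N" "borel \<Otimes>\<^sub>M N", OF _ Y_jointly_measurable[of t y]]
    unfolding E_def by simp
  have "has_bochner_integral N (\<lambda>\<omega>. E (u, \<omega>)) (exp y)" if "u \<in> {t..<T}" for u
    using exp_Y_optional_stopping[OF t admissible_min[OF \<tau>]] that by (simp add: E_def)
  moreover have "set_integrable lborel {t..<T} (\<lambda>u. g u * exp y)"
    by (intro set_integrable_Ico continuous_intros g)
  ultimately have "has_bochner_integral N (\<lambda>\<omega>. LBINT u:{t..<T}. g u * E (u, \<omega>)) (LBINT u:{t..<T}. g u * exp y)"
    using g by (intro time_product_integrals(2)[OF E_meas]) (auto simp: E_def borel_measurable_continuous_onI)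
  from has_bochner_integral_add[OF this has_bochner_integral_mult_left[OF exp_Y_optional_stopping[OF t \<tau>]]]
  have "has_bochner_integral N (\<lambda>\<omega>. (LBINT u:{t..<T}. g u * E (u, \<omega>)) + exp (Y t y (\<tau> \<omega>) \<omega>) * v)
      ((LBINT u:{t..<T}. g u * exp y) + exp y * v)" .
  moreover have "(LBINT u:{t..<T}. g u * E (u, \<omega>)) + exp (Y t y (\<tau> \<omega>) \<omega>) * v
      = (LBINT u:{t..<\<tau> \<omega>}. g u * exp (Y t y u \<omega>)) + exp (Y t y (\<tau> \<omega>) \<omega>) * (v + (LBINT u:{\<tau> \<omega>..<T}. g u))"
    if \<omega>: "\<omega> \<in> space N" for \<omega>
  proof -
    have \<tau>\<omega>: "t \<le> \<tau> \<omega>" "\<tau> \<omega> \<le> T" using admissibleD[OF \<tau>] \<omega> by auto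
    have "continuous_on UNIV (\<lambda>u. g u * E (u, \<omega>))"
      unfolding E_def fst_conv snd_conv
      by (intro continuous_intros g continuous_on_compose2[OF Y_continuous[OF \<omega>]]) auto
    then have "(LBINT u:{t..<\<tau> \<omega>} \<union> {\<tau> \<omega>..<T}. g u * E (u, \<omega>))
        = (LBINT u:{t..<\<tau> \<omega>}. g u * E (u, \<omega>)) + (LBINT u:{\<tau> \<omega>..<T}. g u * E (u, \<omega>))"
      by (intro set_integral_Un set_integrable_Ico) auto
    also have "(LBINT u:{t..<\<tau> \<omega>}. g u * E (u, \<omega>)) = (LBINT u:{t..<\<tau> \<omega>}. g u * exp (Y t y u \<omega>))"
      by (intro set_lebesgue_integral_cong) (auto simp: E_def)
    also have "(LBINT u:{\<tau> \<omega>..<T}. g u * E (u, \<omega>)) = (LBINT u:{\<tau> \<omega>..<T}. g u * exp (Y t y (\<tau> \<omega>) \<omega>))"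
      by (intro set_lebesgue_integral_cong) (auto simp: E_def min_def)
    finally show ?thesis
      using \<tau>\<omega> by (simp add: ivl_disj_un algebra_simps)
  qed
  ultimately show ?thesis
    by (subst (asm) has_bochner_integral_cong[OF refl _ refl]) (auto simp: algebra_simps)
qed

end


section \<open>An optimal stopping problem for the exponential martingale\<close>

locale stopping_problem = log_martingale N F W T \<nu>
  for N :: "'a measure" and F :: "real \<Rightarrow> 'a measure" and W :: "real \<Rightarrow> 'a \<Rightarrow> real" and T \<nu> :: real +
  fixes \<theta> L :: real and a :: "real \<Rightarrow> real"
  assumes horizon_pos: "0 < T"
    and a_continuous: "continuous_on UNIV a"
    and a_pos: "0 < a u"
    and a_growth: "v \<le> w \<Longrightarrow> a v \<le> exp (L * (w - v)) * a w"
begin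

subsection \<open>Running reward\<close>

definition reward :: "real \<Rightarrow> real \<Rightarrow> real" where
  "reward u y = exp (\<theta> * u) * (1 - a u * exp y)"

definition path_reward :: "real \<Rightarrow> real \<Rightarrow> real \<times> 'a \<Rightarrow> real" where
  "path_reward t y x = reward (fst x) (Y t y (fst x) (snd x))"

definition reward_max :: real where
  "reward_max = exp (\<bar>\<theta>\<bar> * T)"

definition frozen_gain :: "real \<Rightarrow> real \<Rightarrow> real \<Rightarrow> real" where
  "frozen_gain s s' y = (LBINT u:{s..<s'}. reward u y)"

abbreviation time_space :: "(real \<times> 'a) measure" where
  "time_space \<equiv> lborel \<Otimes>\<^sub>M N"

sublocale time_space: pair_sigma_finite lborel N ..

lemma a_measurable[measurable]: "a \<in> borel_measurable borel"
  using a_continuous by (rule borel_measurable_continuous_onI)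

lemma isCont_a: "isCont a u"
  using a_continuous by (simp add: continuous_on_eq_continuous_at)

lemma reward_continuous: "continuous_on UNIV (\<lambda>u. reward u y)"
  unfolding reward_def by (intro continuous_intros a_continuous)

lemma reward_max_pos: "0 < reward_max"
  by (simp add: reward_max_def)

lemma abs_discount_le: "0 \<le> u \<Longrightarrow> u \<le> T \<Longrightarrow> \<bar>\<theta> * u\<bar> \<le> \<bar>\<theta>\<bar> * T"
  unfolding abs_mult by (intro mult_left_mono) auto

lemma reward_le: "0 \<le> u \<Longrightarrow> u \<le> T \<Longrightarrow> reward u y \<le> reward_max"
proof -
  assume "0 \<le> u" "u \<le> T"
  then have "exp (\<theta> * u) \<le> reward_max"
    using abs_discount_le[of u] by (simp add: reward_max_def)
  moreover have "reward u y \<le> exp (\<theta> * u) * 1"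
    unfolding reward_def using a_pos[of u] by (intro mult_left_mono) auto
  ultimately show ?thesis by simp
qed

lemma reward_antimono: "y \<le> y' \<Longrightarrow> reward u y' \<le> reward u y"
  using a_pos[of u] by (simp add: reward_def)

lemma reward_time_shift:
  assumes "v \<le> w"
  shows "exp (- \<theta> * (w - v)) * reward w y \<le> reward v (y - L * (w - v))"
proof -
  have "a v * exp (y - L * (w - v)) \<le> exp (L * (w - v)) * a w * exp (y - L * (w - v))"
    using a_growth[OF assms] by (intro mult_right_mono) auto
  also have "\<dots> = a w * exp y" by (simp add: exp_diff)
  finally have "exp (\<theta> * v) * (1 - a w * exp y) \<le> reward v (y - L * (w - v))"
    unfolding reward_def by (intro mult_left_mono) auto
  moreover have "exp (- \<theta> * (w - v)) * reward w y = exp (\<theta> * v) * (1 - a w * exp y)"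
    unfolding reward_def mult.assoc[symmetric] exp_add[symmetric] by (simp add: algebra_simps)
  ultimately show ?thesis by simp
qed

lemma path_reward_integrable:
  assumes t: "0 \<le> t" and A: "A \<in> sets time_space" "A \<subseteq> {t..<T} \<times> space N"
  shows "set_integrable time_space A (path_reward t y)"
proof -
  have "set_integrable time_space ({t..<T} \<times> space N) (\<lambda>x. exp (\<theta> * fst x) * 1)"
    by (rule time_product_integrals(1)[where m = "\<lambda>_. 1"])
      (auto intro!: set_integrable_Ico continuous_intros simp: has_bochner_integral_iff prob_space)
  moreover have "set_integrable time_space ({t..<T} \<times> space N) (\<lambda>x. exp (\<theta> * fst x) * a (fst x) * exp (Y t y (fst x) (snd x)))"
    using exp_Y_moment[OF t, of _ 1 y]
    by (intro time_product_integrals(1)[where m = "\<lambda>_. exp y" and g = "\<lambda>u. exp (\<theta> * u) * a u"])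
      (auto intro!: set_integrable_Ico continuous_intros a_continuous)
  ultimately have "set_integrable time_space ({t..<T} \<times> space N)
      (\<lambda>x. exp (\<theta> * fst x) * 1 - exp (\<theta> * fst x) * a (fst x) * exp (Y t y (fst x) (snd x)))"
    by (rule set_integral_diff)
  also have "(\<lambda>x. exp (\<theta> * fst x) * 1 - exp (\<theta> * fst x) * a (fst x) * exp (Y t y (fst x) (snd x))) = path_reward t y"
    by (simp add: path_reward_def reward_def fun_eq_iff algebra_simps)
  finally show ?thesis using A by (rule set_integrable_subset)
qed

lemma reward_integrable: "set_integrable lborel {s..<s'} (\<lambda>u. reward u y)"
  by (rule set_integrable_Ico[OF reward_continuous])

lemma frozen_gain_affine:
  "frozen_gain s s' y = (LBINT u:{s..<s'}. exp (\<theta> * u)) - (LBINT u:{s..<s'}. exp (\<theta> * u) * a u) * exp y"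
proof -
  have "frozen_gain s s' y = (LBINT u:{s..<s'}. exp (\<theta> * u) - exp (\<theta> * u) * a u * exp y)"
    unfolding frozen_gain_def reward_def by (simp add: algebra_simps)
  also have "\<dots> = (LBINT u:{s..<s'}. exp (\<theta> * u)) - (LBINT u:{s..<s'}. exp (\<theta> * u) * a u * exp y)"
    by (intro set_integral_diff set_integrable_Ico continuous_intros a_continuous)
  finally show ?thesis by simp
qed

lemma frozen_gain_diff_le:
  assumes "w \<le> T" "z \<le> y"
  shows "frozen_gain v w z - frozen_gain v w y \<le> (LBINT u:{v..<T}. exp (\<theta> * u) * a u) * (exp y - exp z)"
proof -
  have "set_integrable lborel {v..<w'} (\<lambda>u. exp (\<theta> * u) * a u)" for w'
    by (intro set_integrable_Ico continuous_intros a_continuous)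
  then have "(LBINT u:{v..<w}. exp (\<theta> * u) * a u) \<le> (LBINT u:{v..<T}. exp (\<theta> * u) * a u)"
    unfolding set_lebesgue_integral_def set_integrable_def
    using assms(1) a_pos by (intro integral_mono) (auto simp: less_imp_le split: split_indicator)
  then have "(LBINT u:{v..<w}. exp (\<theta> * u) * a u) * (exp y - exp z)
      \<le> (LBINT u:{v..<T}. exp (\<theta> * u) * a u) * (exp y - exp z)"
    using assms(2) by (intro mult_right_mono) auto
  then show ?thesis by (simp add: frozen_gain_affine algebra_simps)
qed

lemma frozen_gain_measurable[measurable]: "frozen_gain s s' \<in> borel_measurable borel"
  unfolding frozen_gain_affine[abs_def] by measurable

lemma frozen_gain_antimono: "y \<le> y' \<Longrightarrow> frozen_gain s s' y' \<le> frozen_gain s s' y"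
  unfolding frozen_gain_def by (intro set_integral_mono reward_integrable reward_antimono)

lemma frozen_gain_add:
  assumes "s \<le> u" "u \<le> s'"
  shows "frozen_gain s s' y = frozen_gain s u y + frozen_gain u s' y"
  unfolding frozen_gain_def using assms
  by (subst set_integral_Un[symmetric]) (auto intro: reward_integrable simp: ivl_disj_un)

lemma frozen_gain_le:
  assumes "s \<le> s'" and "\<And>u. s \<le> u \<Longrightarrow> u < s' \<Longrightarrow> reward u y \<le> c"
  shows "frozen_gain s s' y \<le> (s' - s) * c"
proof -
  have "frozen_gain s s' y \<le> (LBINT u:{s..<s'}. c)"
    unfolding frozen_gain_def using assms(2)
    by (intro set_integral_mono reward_integrable set_integrable_Ico continuous_intros) auto
  then show ?thesis using assms(1) by (simp add: set_lebesgue_integral_def)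
qed

lemma frozen_gain_ge:
  assumes "s \<le> s'" and "\<And>u. s \<le> u \<Longrightarrow> u < s' \<Longrightarrow> c \<le> reward u y"
  shows "(s' - s) * c \<le> frozen_gain s s' y"
proof -
  have "(LBINT u:{s..<s'}. c) \<le> frozen_gain s s' y"
    unfolding frozen_gain_def using assms(2)
    by (intro set_integral_mono reward_integrable set_integrable_Ico continuous_intros) auto
  then show ?thesis using assms(1) by (simp add: set_lebesgue_integral_def)
qed

lemma frozen_gain_le_reward_max:
  assumes "0 \<le> s" "s \<le> s'" "s' \<le> T"
  shows "frozen_gain s s' y \<le> (s' - s) * reward_max"
  using assms by (intro frozen_gain_le reward_le) auto

lemma frozen_gain_time_shift:
  assumes "s' \<le> s"
  shows "exp (- \<theta> * (s - s')) * frozen_gain s (s + h) y \<le> frozen_gain s' (s' + h) (y - L * (s - s'))"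
proof -
  define d where "d = s - s'"
  have d: "0 \<le> d" using assms by (simp add: d_def)
  have "exp (- \<theta> * d) * frozen_gain s (s + h) y = (LBINT u:{s..<s+h}. exp (- \<theta> * d) * reward u y)"
    by (simp add: frozen_gain_def)
  also have "\<dots> \<le> (LBINT u:{s..<s+h}. reward (u - d) (y - L * d))"
  proof (rule set_integral_mono)
    show "set_integrable lborel {s..<s+h} (\<lambda>u. reward (u - d) (y - L * d))"
      unfolding reward_def
      by (intro set_integrable_Ico continuous_intros continuous_on_compose2[OF a_continuous]) auto
    show "exp (- \<theta> * d) * reward u y \<le> reward (u - d) (y - L * d)" for u
      using reward_time_shift[of "u - d" u y] d by simp
  qed (intro set_integrable_mult_right reward_integrable)
  also have "\<dots> = frozen_gain s' (s' + h) (y - L * d)"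
    unfolding frozen_gain_def set_lebesgue_integral_def
    by (subst (2) lborel_integral_real_affine[of 1 _ "- d"])
      (auto simp: d_def indicator_def algebra_simps intro!: Bochner_Integration.integral_cong)
  finally show ?thesis by (simp add: d_def)
qed

lemma path_reward_block:
  assumes t: "0 \<le> t" "t \<le> s" and s: "s \<le> s'" "s' \<le> T" and A: "A \<in> sets (F s)"
  shows "set_integrable N A (\<lambda>\<omega>. frozen_gain s s' (Y t y s \<omega>))"
    and "(LINT x:{s..<s'} \<times> A|time_space. path_reward t y x) = (LINT \<omega>:A|N. frozen_gain s s' (Y t y s \<omega>))"
proof -
  have A_sets[measurable]: "A \<in> sets N" using A sets_F_subset by auto
  define C where "C = (LBINT u:{s..<s'}. exp (\<theta> * u))"
  define D where "D = (LBINT u:{s..<s'}. exp (\<theta> * u) * a u)"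
  define m where "m = (LINT \<omega>:A|N. exp (Y t y s \<omega>))"
  have one: "set_integrable N A (\<lambda>_. c)" "(LINT \<omega>:A|N. c) = prob A * c" for c :: real
    using set_integral_const[of A N c] by (auto simp: set_integrable_def emeasure_eq_measure less_top[symmetric] set_lebesgue_integral_def)
  have exp_int: "set_integrable N A (\<lambda>\<omega>. exp (Y t y u \<omega>))" if "t \<le> u" "u \<le> T" for u
    using integrable_mult_indicator[OF A_sets exp_Y_integrable[OF t(1) that, of 1 y]] by (simp add: set_integrable_def)
  have frozen: "frozen_gain s s' (Y t y s \<omega>) = C - D * exp (Y t y s \<omega>)" for \<omega>
    by (simp add: frozen_gain_affine C_def D_def)
  show "set_integrable N A (\<lambda>\<omega>. frozen_gain s s' (Y t y s \<omega>))"
    unfolding frozen using one exp_int t s by (intro set_integral_diff set_integrable_mult_right) auto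
  have inner: "(LINT \<omega>:A|N. path_reward t y (u, \<omega>)) = exp (\<theta> * u) * prob A - exp (\<theta> * u) * a u * m" if u: "u \<in> {s..<s'}" for u
  proof -
    have "(LINT \<omega>:A|N. path_reward t y (u, \<omega>)) = (LINT \<omega>:A|N. exp (\<theta> * u) - exp (\<theta> * u) * a u * exp (Y t y u \<omega>))"
      by (simp add: path_reward_def reward_def algebra_simps)
    also have "\<dots> = prob A * exp (\<theta> * u) - exp (\<theta> * u) * a u * (LINT \<omega>:A|N. exp (Y t y u \<omega>))"
      using one exp_int[of u] t s u by (subst set_integral_diff) auto
    finally show ?thesis
      using exp_Y_conditional[OF t, of u A 1 y] A s u by (simp add: m_def mult.commute)
  qed
  have "set_integrable time_space ({s..<s'} \<times> A) (path_reward t y)"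
    using t s sets.sets_into_space[OF A_sets] by (intro path_reward_integrable) auto
  then have "(LINT x:{s..<s'} \<times> A|time_space. path_reward t y x) = (LBINT u:{s..<s'}. LINT \<omega>:A|N. path_reward t y (u, \<omega>))"
    by (rule time_space.set_integral_Times)
  also have "\<dots> = (LBINT u:{s..<s'}. exp (\<theta> * u) * prob A - exp (\<theta> * u) * a u * m)"
    by (intro set_lebesgue_integral_cong) (auto simp: inner)
  also have "\<dots> = C * prob A - D * m"
    unfolding C_def D_def
    by (subst set_integral_diff) (auto intro!: set_integrable_Ico continuous_intros a_continuous)
  also have "\<dots> = (LINT \<omega>:A|N. frozen_gain s s' (Y t y s \<omega>))"
    unfolding frozen m_def using one exp_int t s by (subst set_integral_diff) (auto simp: mult.commute)
  finally show "(LINT x:{s..<s'} \<times> A|time_space. path_reward t y x) = (LINT \<omega>:A|N. frozen_gain s s' (Y t y s \<omega>))" .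
qed


subsection \<open>Bermudan values\<close>

text \<open>\<open>bermudan h s y\<close> is the value in state \<open>y\<close> at time \<open>s\<close> when stopping is allowed only at
  the times \<open>s, s + h, s + 2 * h, \<dots>\<close> up to the horizon.\<close>

function bermudan :: "real \<Rightarrow> real \<Rightarrow> real \<Rightarrow> real" where
  "bermudan h s = (if 0 < h \<and> s + h \<le> T
    then (\<lambda>y. max 0 (frozen_gain s (s + h) y + transition h (bermudan h (s + h)) y))
    else (\<lambda>_. 0))"
  by pat_completeness auto
termination
  by (relation "Wellfounded.measure (\<lambda>(h, s). nat \<lfloor>(T - s) / h\<rfloor>)") (use grid_steps_less in auto)

declare bermudan.simps[simp del]

definition continuation_value :: "real \<Rightarrow> real \<Rightarrow> real \<Rightarrow> real" where
  "continuation_value h s y = frozen_gain s (s + h) y + transition h (bermudan h (s + h)) y"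

lemma bermudan_step: "0 < h \<Longrightarrow> s + h \<le> T \<Longrightarrow> bermudan h s y = max 0 (continuation_value h s y)"
  by (subst bermudan.simps) (simp add: continuation_value_def)

lemma bermudan_last: "\<not> (0 < h \<and> s + h \<le> T) \<Longrightarrow> bermudan h s y = 0"
  by (subst bermudan.simps) auto

lemma bermudan_pos_imp: "0 < bermudan h s y \<Longrightarrow> 0 < h \<and> s + h \<le> T"
  using bermudan_last[of h s y] by (cases "0 < h \<and> s + h \<le> T") auto

lemma bermudan_nonneg: "0 \<le> bermudan h s y"
  using bermudan_step[of h s y] bermudan_last[of h s y] by (cases "0 < h \<and> s + h \<le> T") auto

lemma bermudan_measurable[measurable]: "bermudan h s \<in> borel_measurable borel"
proof (induction h s rule: bermudan.induct)
  case (1 h s)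
  show ?case
  proof (cases "0 < h \<and> s + h \<le> T")
    case True
    then have [measurable]: "transition h (bermudan h (s + h)) \<in> borel_measurable borel"
      using 1 by (intro transition_measurable) auto
    show ?thesis using True by (subst bermudan.simps) simp
  next
    case False
    then have "bermudan h s = (\<lambda>_. 0)" by (simp add: fun_eq_iff bermudan_last)
    then show ?thesis by simp
  qed
qed

lemma bermudan_le: "0 \<le> s \<Longrightarrow> s \<le> T \<Longrightarrow> bermudan h s y \<le> (T - s) * reward_max"
proof (induction h s arbitrary: y rule: bermudan.induct)
  case (1 h s)
  show ?case
  proof (cases "0 < h \<and> s + h \<le> T")
    case True
    then have h: "0 < h" "s + h \<le> T" by auto
    interpret gaussian: prob_space "gaussian h" using h(1) by (rule prob_space_gaussian)
    have "\<bar>bermudan h (s + h) x\<bar> \<le> (T - (s + h)) * reward_max" for x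
      using 1 h bermudan_nonneg[of h "s + h" x] by simp
    then have "transition h (bermudan h (s + h)) y \<le> (T - (s + h)) * reward_max"
      unfolding transition_def using h
      by (intro gaussian.integral_le_const transition_integrable AE_I2) (auto simp: abs_le_iff)
    moreover have "frozen_gain s (s + h) y \<le> h * reward_max"
      using frozen_gain_le_reward_max[of s "s + h" y] 1 h by simp
    ultimately have "continuation_value h s y \<le> (T - s) * reward_max"
      by (simp add: continuation_value_def algebra_simps)
    then show ?thesis
      using bermudan_step[OF h] 1 reward_max_pos by simp
  qed (use 1 reward_max_pos in \<open>simp add: bermudan_last\<close>)
qed

lemma abs_bermudan_le: "0 \<le> s \<Longrightarrow> \<bar>bermudan h s y\<bar> \<le> T * reward_max"
proof (cases "s \<le> T")
  case True
  assume "0 \<le> s"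
  then have "bermudan h s y \<le> (T - s) * reward_max" using True by (rule bermudan_le)
  also have "\<dots> \<le> T * reward_max" using \<open>0 \<le> s\<close> reward_max_pos by simp
  finally show ?thesis using bermudan_nonneg[of h s y] by simp
next
  case False
  then have "bermudan h s y = 0" by (intro bermudan_last) auto
  then show ?thesis using horizon_pos reward_max_pos by simp
qed

lemma bermudan_transition_integrable:
  "0 < h \<Longrightarrow> 0 \<le> s \<Longrightarrow> integrable (gaussian h) (\<lambda>z. bermudan h' s (x + \<nu> * z - \<nu>\<^sup>2 / 2 * h))"
  by (rule transition_integrable[OF _ bermudan_measurable abs_bermudan_le])

lemma transition_bermudan_nonneg: "0 \<le> transition h (bermudan h' s) y"
  unfolding transition_def by (simp add: bermudan_nonneg)

lemma bermudan_Y_integrable: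
  assumes "0 \<le> s"
  shows "integrable N (\<lambda>\<omega>. bermudan h s (Y t y u \<omega>))"
  by (rule integrable_const_bound[OF AE_I2]) (use abs_bermudan_le[OF assms] in auto)

lemma bermudan_antimono: "0 \<le> s \<Longrightarrow> y \<le> y' \<Longrightarrow> bermudan h s y' \<le> bermudan h s y"
proof (induction h s arbitrary: y y' rule: bermudan.induct)
  case (1 h s)
  show ?case
  proof (cases "0 < h \<and> s + h \<le> T")
    case True
    have "transition h (bermudan h (s + h)) y' \<le> transition h (bermudan h (s + h)) y"
      unfolding transition_def using 1 True by (intro integral_mono bermudan_transition_integrable) auto
    then have "continuation_value h s y' \<le> continuation_value h s y"
      unfolding continuation_value_def using frozen_gain_antimono[OF 1(3)] by (rule add_mono[rotated])
    then show ?thesis using True by (simp add: bermudan_step)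
  qed (simp add: bermudan_last)
qed

lemma bermudan_time_shift:
  "0 \<le> s' \<Longrightarrow> s' \<le> s \<Longrightarrow> exp (- \<theta> * (s - s')) * bermudan h s y \<le> bermudan h s' (y - L * (s - s'))"
proof (induction h s arbitrary: s' y rule: bermudan.induct)
  case (1 h s)
  define c where "c = exp (- \<theta> * (s - s'))"
  show ?case
  proof (cases "0 < h \<and> s + h \<le> T")
    case True
    then have h: "0 < h" "s + h \<le> T" "s' + h \<le> T" using 1 by auto
    have "c * transition h (bermudan h (s + h)) y \<le> transition h (bermudan h (s' + h)) (y - L * (s - s'))"
      unfolding transition_def Bochner_Integration.integral_mult_right_zero[symmetric]
    proof (rule integral_mono)
      show "integrable (gaussian h) (\<lambda>z. c * bermudan h (s + h) (y + \<nu> * z - \<nu>\<^sup>2 / 2 * h))"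
        "integrable (gaussian h) (\<lambda>z. bermudan h (s' + h) (y - L * (s - s') + \<nu> * z - \<nu>\<^sup>2 / 2 * h))"
        using 1(2,3) h by (intro integrable_mult_right bermudan_transition_integrable; simp)+
      show "c * bermudan h (s + h) (y + \<nu> * z - \<nu>\<^sup>2 / 2 * h)
          \<le> bermudan h (s' + h) (y - L * (s - s') + \<nu> * z - \<nu>\<^sup>2 / 2 * h)" for z
        using 1(1)[OF True, of "s' + h" "y + \<nu> * z - \<nu>\<^sup>2 / 2 * h"] 1(2,3) h(1) by (simp add: c_def algebra_simps)
    qed
    then have "c * continuation_value h s y \<le> continuation_value h s' (y - L * (s - s'))"
      using frozen_gain_time_shift[OF 1(3), of h y] by (simp add: continuation_value_def c_def distrib_left)
    moreover have "c * max 0 (continuation_value h s y) = max 0 (c * continuation_value h s y)"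
      by (simp add: c_def max_def zero_le_mult_iff)
    ultimately show ?thesis
      unfolding bermudan_step[OF h(1,2)] bermudan_step[OF h(1,3)] c_def[symmetric] by (simp add: max.mono)
  qed (simp add: bermudan_last bermudan_nonneg)
qed

lemma continuation_value_integral:
  assumes t: "0 \<le> t" "t \<le> s" and h: "0 < h" "s + h \<le> T" and A: "A \<in> sets (F s)"
  shows "set_integrable N A (\<lambda>\<omega>. continuation_value h s (Y t y s \<omega>))"
    and "(LINT \<omega>:A|N. continuation_value h s (Y t y s \<omega>)) = (LINT x:{s..<s+h} \<times> A|time_space. path_reward t y x)
      + (LINT \<omega>:A|N. bermudan h (s + h) (Y t y (s + h) \<omega>))"
proof -
  have "integrable N (\<lambda>\<omega>. bermudan h (s + h) (Y t y (s + h) \<omega>))"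
    using t h by (intro bermudan_Y_integrable) auto
  note markov = Y_markov[OF t h A bermudan_measurable this]
  note block = path_reward_block[OF t _ h(2) A, of y]
  show "set_integrable N A (\<lambda>\<omega>. continuation_value h s (Y t y s \<omega>))"
    unfolding continuation_value_def using h block(1) markov(1) by (intro set_integral_add) auto
  show "(LINT \<omega>:A|N. continuation_value h s (Y t y s \<omega>)) = (LINT x:{s..<s+h} \<times> A|time_space. path_reward t y x)
      + (LINT \<omega>:A|N. bermudan h (s + h) (Y t y (s + h) \<omega>))"
    unfolding continuation_value_def using h block markov by (subst set_integral_add) auto
qed


definition continuation_event :: "real \<Rightarrow> real \<Rightarrow> real \<Rightarrow> real \<Rightarrow> 'a set" where
  "continuation_event h t y s = {\<omega> \<in> space N. 0 < bermudan h s (Y t y s \<omega>)}"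

lemma sets_continuation_event:
  assumes "0 \<le> t" "t \<le> s" "s \<le> T"
  shows "continuation_event h t y s \<in> sets (F s)" "continuation_event h t y s \<in> sets N"
proof -
  have "(\<lambda>\<omega>. bermudan h s (Y t y s \<omega>)) \<in> borel_measurable (F s)"
    using assms by (intro measurable_compose[OF Y_adapted bermudan_measurable])
  from measurable_sets[OF this, of "{0<..}"] show "continuation_event h t y s \<in> sets (F s)"
    by (simp add: continuation_event_def vimage_def Int_def conj_commute)
  then show "continuation_event h t y s \<in> sets N" using sets_F_subset by blast
qed

lemma set_integrable_bermudan_Y:
  "0 \<le> s \<Longrightarrow> A \<in> sets N \<Longrightarrow> set_integrable N A (\<lambda>\<omega>. bermudan h s (Y t y u \<omega>))"
  unfolding set_integrable_def by (intro integrable_mult_indicator bermudan_Y_integrable)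

lemma set_integral_bermudan_step:
  assumes t: "0 \<le> t" "t \<le> s" and h: "0 < h" "s + h \<le> T" and A: "A \<in> sets (F s)"
  shows "(LINT \<omega>:A|N. bermudan h s (Y t y s \<omega>))
    = (LINT x:{s..<s+h} \<times> (A \<inter> continuation_event h t y s)|time_space. path_reward t y x)
      + (LINT \<omega>:A \<inter> continuation_event h t y s|N. bermudan h (s + h) (Y t y (s + h) \<omega>))"
proof -
  have "A \<subseteq> space N" using sets.sets_into_space[OF A] by simp
  then have "(LINT \<omega>:A|N. bermudan h s (Y t y s \<omega>))
      = (LINT \<omega>:A \<inter> continuation_event h t y s|N. continuation_value h s (Y t y s \<omega>))"
    unfolding set_lebesgue_integral_def bermudan_step[OF h] continuation_event_def
    by (intro Bochner_Integration.integral_cong refl) (auto simp: indicator_def max_def)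
  also have "A \<inter> continuation_event h t y s \<in> sets (F s)"
    using A sets_continuation_event(1)[OF t, of h y] h by auto
  note continuation_value_integral(2)[OF t h this, of y]
  finally show ?thesis .
qed

lemma set_integral_bermudan_ge:
  assumes t: "0 \<le> t" "t \<le> s" and h: "0 < h" "s + h \<le> T"
    and D: "D \<in> sets (F s)" "D \<subseteq> A" and A: "A \<in> sets N"
  shows "(LINT x:{s..<s+h} \<times> D|time_space. path_reward t y x) + (LINT \<omega>:D|N. bermudan h (s + h) (Y t y (s + h) \<omega>))
    \<le> (LINT \<omega>:A|N. bermudan h s (Y t y s \<omega>))"
  unfolding continuation_value_integral(2)[OF t h D(1), symmetric]
  unfolding set_lebesgue_integral_def real_scaleR_def
proof (rule integral_mono)
  show "integrable N (\<lambda>\<omega>. indicator D \<omega> * continuation_value h s (Y t y s \<omega>))"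
    using continuation_value_integral(1)[OF t h D(1)] by (simp add: set_integrable_def)
  show "integrable N (\<lambda>\<omega>. indicator A \<omega> * bermudan h s (Y t y s \<omega>))"
    using set_integrable_bermudan_Y[OF _ A] t by (simp add: set_integrable_def)
qed (use bermudan_step[OF h] D(2) in \<open>auto split: split_indicator\<close>)


subsection \<open>Gains of stopping times\<close>

definition stochastic_interval :: "'a set \<Rightarrow> real \<Rightarrow> ('a \<Rightarrow> real) \<Rightarrow> (real \<times> 'a) set" where
  "stochastic_interval A s \<tau> = {(u, \<omega>). \<omega> \<in> A \<and> s \<le> u \<and> u < \<tau> \<omega>}"

definition gain :: "real \<Rightarrow> real \<Rightarrow> ('a \<Rightarrow> real) \<Rightarrow> real" where
  "gain t y \<tau> = (LINT x:stochastic_interval (space N) t \<tau>|time_space. path_reward t y x)"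

definition profitable :: "real \<Rightarrow> real \<Rightarrow> bool" where
  "profitable s y \<longleftrightarrow> (\<exists>\<tau>. admissible s \<tau> \<and> 0 < gain s y \<tau>)"

lemma mem_stochastic_interval[simp]: "(u, \<omega>) \<in> stochastic_interval A s \<tau> \<longleftrightarrow> \<omega> \<in> A \<and> s \<le> u \<and> u < \<tau> \<omega>"
  by (simp add: stochastic_interval_def)

lemma sets_stochastic_interval:
  assumes [measurable]: "A \<in> sets N" "\<tau> \<in> borel_measurable N"
  shows "stochastic_interval A s \<tau> \<in> sets time_space"
proof -
  have "{x \<in> space time_space. snd x \<in> A \<and> s \<le> fst x \<and> fst x < \<tau> (snd x)} \<in> sets time_space" by measurable
  also have "{x \<in> space time_space. snd x \<in> A \<and> s \<le> fst x \<and> fst x < \<tau> (snd x)} = stochastic_interval A s \<tau>"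
    using sets.sets_into_space[OF assms(1)] by (auto simp: space_pair_measure)
  finally show ?thesis .
qed

lemma stochastic_interval_subset:
  assumes "admissible s' \<tau>" "t \<le> s" "A \<subseteq> space N"
  shows "stochastic_interval A s \<tau> \<subseteq> {t..<T} \<times> space N"
  using assms admissibleD(3)[OF assms(1)] by (fastforce simp: stochastic_interval_def)

lemma path_reward_integrable_stochastic_interval:
  assumes "0 \<le> t" "t \<le> s" "admissible s' \<tau>" "A \<in> sets N"
  shows "set_integrable time_space (stochastic_interval A s \<tau>) (path_reward t y)"
proof (rule path_reward_integrable[OF assms(1)])
  show "stochastic_interval A s \<tau> \<in> sets time_space"
    using assms by (intro sets_stochastic_interval stopping_time_measurable) (auto dest: admissibleD)
  show "stochastic_interval A s \<tau> \<subseteq> {t..<T} \<times> space N"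
    using assms sets.sets_into_space by (intro stochastic_interval_subset)
qed

lemma has_bochner_integral_gain:
  assumes "0 \<le> t" "admissible t \<tau>"
  shows "has_bochner_integral N (\<lambda>\<omega>. LBINT u:{t..<\<tau> \<omega>}. reward u (Y t y u \<omega>)) (gain t y \<tau>)"
proof -
  have "set_integrable time_space (stochastic_interval (space N) t \<tau>) (path_reward t y)"
    using assms by (intro path_reward_integrable_stochastic_interval) auto
  from time_space.has_bochner_integral_set_integral_snd[OF this] show ?thesis
    unfolding gain_def
    by (rule has_bochner_integral_cong[THEN iffD1, rotated -1])
      (auto simp: path_reward_def set_lebesgue_integral_def indicator_def intro!: Bochner_Integration.integral_cong)
qed

lemma gain_le:
  assumes "0 \<le> t" "admissible t \<tau>"
  shows "gain t y \<tau> \<le> (LINT x:{t..<T} \<times> space N|time_space. \<bar>path_reward t y x\<bar>)"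
  unfolding gain_def set_lebesgue_integral_def
proof (rule integral_mono)
  show "integrable time_space (\<lambda>x. indicator (stochastic_interval (space N) t \<tau>) x *\<^sub>R path_reward t y x)"
    using path_reward_integrable_stochastic_interval[OF assms(1) order_refl assms(2) sets.top]
    by (simp add: set_integrable_def)
  show "integrable time_space (\<lambda>x. indicator ({t..<T} \<times> space N) x *\<^sub>R \<bar>path_reward t y x\<bar>)"
    using set_integrable_abs[OF path_reward_integrable[OF assms(1), of "{t..<T} \<times> space N" y]]
    by (simp add: set_integrable_def)
qed (use stochastic_interval_subset[OF assms(2) order_refl order_refl] in \<open>auto split: split_indicator\<close>)

lemma stochastic_interval_split:
  assumes t: "0 \<le> t" "t \<le> s" and h: "0 < h" "s + h \<le> T" and \<tau>: "admissible s' \<tau>" and A: "A \<in> sets N"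
    and late: "\<And>\<omega>. \<omega> \<in> A \<Longrightarrow> s + h \<le> \<tau> \<omega>"
  shows "(LINT x:stochastic_interval A s \<tau>|time_space. path_reward t y x)
    = (LINT x:{s..<s+h} \<times> A|time_space. path_reward t y x)
      + (LINT x:stochastic_interval A (s + h) \<tau>|time_space. path_reward t y x)"
proof -
  have "stochastic_interval A s \<tau> = {s..<s+h} \<times> A \<union> stochastic_interval A (s + h) \<tau>"
    using late h by (force simp: stochastic_interval_def)
  moreover have "{s..<s+h} \<times> A \<inter> stochastic_interval A (s + h) \<tau> = {}" by (auto simp: stochastic_interval_def)
  moreover have "set_integrable time_space ({s..<s+h} \<times> A) (path_reward t y)"
    using t h A sets.sets_into_space[OF A] by (intro path_reward_integrable) auto
  moreover have "set_integrable time_space (stochastic_interval A (s + h) \<tau>) (path_reward t y)"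
    using t h by (intro path_reward_integrable_stochastic_interval[OF _ _ \<tau> A]) auto
  ultimately show ?thesis by (simp add: set_integral_Un)
qed

lemma bermudan_attained:
  assumes t: "0 \<le> t"
  shows "t \<le> s \<Longrightarrow> s \<le> T \<Longrightarrow> \<exists>\<tau>. admissible s \<tau> \<and> (\<forall>A\<in>sets (F s).
    (LINT x:stochastic_interval A s \<tau>|time_space. path_reward t y x) = (LINT \<omega>:A|N. bermudan h s (Y t y s \<omega>)))"
proof (induction h s rule: bermudan.induct)
  case (1 h s)
  show ?case
  proof (cases "0 < h \<and> s + h \<le> T")
    case True
    then have h: "0 < h" "s + h \<le> T" by auto
    obtain \<tau>' where \<tau>': "admissible (s + h) \<tau>'" "\<And>A. A \<in> sets (F (s + h)) \<Longrightarrow>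
        (LINT x:stochastic_interval A (s + h) \<tau>'|time_space. path_reward t y x) = (LINT \<omega>:A|N. bermudan h (s + h) (Y t y (s + h) \<omega>))"
      using 1(1)[OF True] 1(2) h by auto
    define D where "D = continuation_event h t y s"
    define \<tau> where "\<tau> \<omega> = (if \<omega> \<in> D then \<tau>' \<omega> else s)" for \<omega>
    have D: "D \<in> sets (F s)" unfolding D_def using t 1(2,3) by (rule sets_continuation_event)
    show ?thesis
    proof (intro exI[of _ \<tau>] conjI ballI)
      show "admissible s \<tau>"
        unfolding \<tau>_def[abs_def] using h(1) by (intro admissible_if[OF D _ \<tau>'(1)]) simp
      fix A assume A: "A \<in> sets (F s)"
      have AD: "A \<inter> D \<in> sets (F (s + h))" "A \<inter> D \<in> sets N"
        using A D sets_F_mono[of s "s + h"] h(1) sets_F_subset[of s] by auto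
      have late: "s + h \<le> \<tau>' \<omega>" if "\<omega> \<in> A \<inter> D" for \<omega>
        using admissibleD(2)[OF \<tau>'(1)] that by (simp add: D_def continuation_event_def)
      have "D \<subseteq> space N" by (auto simp: D_def continuation_event_def)
      then have "stochastic_interval A s \<tau> = stochastic_interval (A \<inter> D) s \<tau>'"
        by (auto simp: \<tau>_def stochastic_interval_def)
      then show "(LINT x:stochastic_interval A s \<tau>|time_space. path_reward t y x) = (LINT \<omega>:A|N. bermudan h s (Y t y s \<omega>))"
        using stochastic_interval_split[OF t 1(2) h \<tau>'(1) AD(2) late] \<tau>'(2)[OF AD(1)]
          set_integral_bermudan_step[OF t 1(2) h A] by (simp add: D_def)
    qed
  next
    case False
    have "stochastic_interval A s (\<lambda>_. s) = {}" for A by (auto simp: stochastic_interval_def)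
    then show ?thesis
      using 1 False by (intro exI[of _ "\<lambda>_. s"]) (simp add: admissible_const bermudan_last set_lebesgue_integral_def)
  qed
qed

lemma bermudan_pos_imp_profitable:
  assumes "0 \<le> s" "0 < bermudan h s y"
  shows "profitable s y"
proof -
  have "s \<le> T" using bermudan_pos_imp[OF assms(2)] by linarith
  then obtain \<tau> where \<tau>: "admissible s \<tau>" "\<And>A. A \<in> sets (F s) \<Longrightarrow>
      (LINT x:stochastic_interval A s \<tau>|time_space. path_reward s y x) = (LINT \<omega>:A|N. bermudan h s (Y s y s \<omega>))"
    using bermudan_attained[OF assms(1) order_refl, of y h] by auto
  have "gain s y \<tau> = bermudan h s y"
    unfolding gain_def using \<tau>(2)[OF space_in_sets_F] by (simp add: set_integral_space prob_space)
  then show ?thesis using \<tau>(1) assms(2) by (auto simp: profitable_def)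
qed

lemma grid_gain_le_bermudan:
  assumes t: "0 \<le> t"
  shows "0 < h \<Longrightarrow> t \<le> s \<Longrightarrow> admissible s' \<sigma> \<Longrightarrow> A \<in> sets (F s) \<Longrightarrow> (\<And>\<omega>. \<omega> \<in> A \<Longrightarrow> \<exists>i. \<sigma> \<omega> = s + real i * h) \<Longrightarrow>
    (LINT x:stochastic_interval A s \<sigma>|time_space. path_reward t y x) \<le> (LINT \<omega>:A|N. bermudan h s (Y t y s \<omega>))"
proof (induction h s arbitrary: A rule: bermudan.induct)
  case (1 h s)
  note \<sigma> = 1(4) and A = 1(5)
  define D where "D = A \<inter> {\<omega> \<in> space N. s < \<sigma> \<omega>}"
  have D: "D \<in> sets (F s)"
    using A stopping_timeD2[OF admissibleD(1)[OF \<sigma>], of s] by (simp add: D_def pred_def sets.Int)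
  have sub: "A \<subseteq> space N" using sets.sets_into_space[OF A] by simp
  have on_grid: "\<exists>i. \<sigma> \<omega> = s + h + real i * h" if \<omega>: "\<omega> \<in> D" for \<omega>
  proof -
    obtain i where i: "\<sigma> \<omega> = s + real i * h" using 1(6) \<omega> by (auto simp: D_def)
    then obtain j where "i = Suc j" using \<omega> by (cases i) (auto simp: D_def)
    then show ?thesis using i by (intro exI[of _ j]) (simp add: algebra_simps)
  qed
  have late: "s + h \<le> \<sigma> \<omega>" if "\<omega> \<in> D" for \<omega>
    using on_grid[OF that] 1(2) by auto
  have eq: "stochastic_interval A s \<sigma> = stochastic_interval D s \<sigma>"
    using sub by (auto simp: D_def stochastic_interval_def)
  show ?case
  proof (cases "s + h \<le> T")
    case True
    then have h: "0 < h" "s + h \<le> T" using 1(2) by auto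
    have D': "D \<in> sets (F (s + h))" "D \<in> sets N" "D \<subseteq> A" "A \<in> sets N"
      using D A sets_F_mono[of s "s + h"] h(1) sets_F_subset[of s] by (auto simp: D_def)
    have "t \<le> s + h" using 1(3) h(1) by simp
    have "(LINT x:stochastic_interval A s \<sigma>|time_space. path_reward t y x)
        \<le> (LINT x:{s..<s+h} \<times> D|time_space. path_reward t y x) + (LINT \<omega>:D|N. bermudan h (s + h) (Y t y (s + h) \<omega>))"
      using stochastic_interval_split[OF t 1(3) h \<sigma> D'(2) late, of y] 1(1)[OF _ h(1) \<open>t \<le> s + h\<close> \<sigma> D'(1) on_grid] h
      by (simp add: eq)
    also have "\<dots> \<le> (LINT \<omega>:A|N. bermudan h s (Y t y s \<omega>))"
      by (rule set_integral_bermudan_ge[OF t 1(3) h D D'(3,4)])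
    finally show ?thesis .
  next
    case False
    have "s + h \<le> T" if "\<omega> \<in> D" for \<omega>
      using late[OF that] admissibleD(3)[OF \<sigma>] that by (force simp: D_def)
    then have "D = {}" using False by auto
    then have "stochastic_interval A s \<sigma> = {}" unfolding eq by (auto simp: stochastic_interval_def)
    then show ?thesis by (simp add: set_lebesgue_integral_def bermudan_nonneg)
  qed
qed

lemma gain_tendsto:
  assumes t: "0 \<le> t" and \<tau>: "admissible t \<tau>" and \<sigma>: "\<And>n. admissible t (\<sigma> n)"
    and lim: "\<And>\<omega>. \<omega> \<in> space N \<Longrightarrow> (\<lambda>n. \<sigma> n \<omega>) \<longlonglongrightarrow> \<tau> \<omega>"
  shows "(\<lambda>n. gain t y (\<sigma> n)) \<longlonglongrightarrow> gain t y \<tau>"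
  unfolding gain_def
proof (rule set_integral_tendsto_of_eventually_eq)
  have [measurable]: "\<tau> \<in> borel_measurable N" "\<sigma> n \<in> borel_measurable N" for n
    using \<tau> \<sigma> by (auto intro: stopping_time_measurable dest: admissibleD)
  show "set_integrable time_space ({t..<T} \<times> space N) (path_reward t y)"
    using t by (intro path_reward_integrable) auto
  show "stochastic_interval (space N) t \<tau> \<in> sets time_space" "stochastic_interval (space N) t (\<sigma> n) \<in> sets time_space" for n
    by (intro sets_stochastic_interval; measurable)+
  show "stochastic_interval (space N) t \<tau> \<subseteq> {t..<T} \<times> space N" "stochastic_interval (space N) t (\<sigma> n) \<subseteq> {t..<T} \<times> space N" for n
    by (intro stochastic_interval_subset[OF \<tau>] stochastic_interval_subset[OF \<sigma>] order_refl)+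
  have meas: "{x \<in> space time_space. fst x \<noteq> \<tau> (snd x)} \<in> sets time_space" by measurable
  then have "AE u in lborel. AE \<omega> in N. u \<noteq> \<tau> \<omega>"
    by (subst time_space.AE_commute) (simp_all add: AE_lborel_singleton)
  then have "AE x in time_space. fst x \<noteq> \<tau> (snd x)" by (intro time_space.AE_pair_measure meas) simp
  then show "AE x in time_space. \<forall>\<^sub>F n in sequentially.
      indicator (stochastic_interval (space N) t (\<sigma> n)) x * path_reward t y x
        = indicator (stochastic_interval (space N) t \<tau>) x * path_reward t y x"
    using AE_space
  proof eventually_elim
    case (elim x)
    then have \<omega>: "snd x \<in> space N" by (simp add: space_pair_measure mem_Times_iff)
    consider "fst x < \<tau> (snd x)" | "\<tau> (snd x) < fst x" using elim by linarith
    then have "\<forall>\<^sub>F n in sequentially. fst x < \<sigma> n (snd x) \<longleftrightarrow> fst x < \<tau> (snd x)"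
    proof cases
      case 1
      then show ?thesis using order_tendstoD(1)[OF lim[OF \<omega>]] by simp
    next
      case 2
      from order_tendstoD(2)[OF lim[OF \<omega>] this] show ?thesis
        by eventually_elim (use 2 in auto)
    qed
    then show ?case
      by eventually_elim (simp add: stochastic_interval_def indicator_def split_beta')
  qed
qed

lemma profitable_imp_bermudan_pos:
  assumes s: "0 \<le> s" and prof: "profitable s y" and h: "h \<longlonglongrightarrow> 0" "\<And>n. 0 < h n"
  shows "\<forall>\<^sub>F n in sequentially. 0 < bermudan (h n) s y"
proof -
  obtain \<tau> where \<tau>: "admissible s \<tau>" "0 < gain s y \<tau>" using prof by (auto simp: profitable_def)
  define \<sigma> where "\<sigma> n = grid_stop s (h n) \<tau>" for n
  have \<sigma>: "admissible s (\<sigma> n)" for n unfolding \<sigma>_def using h(2) \<tau>(1) by (rule admissible_grid_stop)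
  have "(\<lambda>n. gain s y (\<sigma> n)) \<longlonglongrightarrow> gain s y \<tau>"
    using grid_stop_tendsto[OF \<tau>(1) _ h] by (intro gain_tendsto[OF s \<tau>(1) \<sigma>]) (simp add: \<sigma>_def)
  then have "\<forall>\<^sub>F n in sequentially. 0 < gain s y (\<sigma> n)" using \<tau>(2) by (rule order_tendstoD)
  then show ?thesis
  proof eventually_elim
    case (elim n)
    have "gain s y (\<sigma> n) \<le> (LINT \<omega>:space N|N. bermudan (h n) s (Y s y s \<omega>))"
      unfolding gain_def using grid_stop_on_grid[OF h(2) \<tau>(1)]
      by (intro grid_gain_le_bermudan[OF s h(2) order_refl \<sigma>]) (auto simp: \<sigma>_def)
    then show ?case using elim by (simp add: set_integral_space prob_space)
  qed
qed

theorem profitable_iff_bermudan_pos: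
  assumes "0 \<le> s"
  shows "profitable s y \<longleftrightarrow> (\<exists>h. 0 < bermudan h s y)"
proof
  assume "profitable s y"
  from profitable_imp_bermudan_pos[OF assms this LIMSEQ_Suc[OF lim_const_over_n[of 1]]]
  show "\<exists>h. 0 < bermudan h s y" by (auto dest!: eventually_happens)
qed (use bermudan_pos_imp_profitable[OF assms] in blast)

lemma profitable_time_shift:
  assumes "0 \<le> s'" "s' \<le> s" "profitable s y"
  shows "profitable s' (y - L * (s - s'))"
proof -
  obtain h where "0 < bermudan h s y" using assms by (auto simp: profitable_iff_bermudan_pos)
  then have "0 < exp (- \<theta> * (s - s')) * bermudan h s y" by simp
  also have "\<dots> \<le> bermudan h s' (y - L * (s - s'))" using assms by (intro bermudan_time_shift)
  finally show ?thesis using assms(1) by (rule bermudan_pos_imp_profitable[rotated])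
qed

lemma frozen_gain_pos_imp_profitable:
  assumes "0 \<le> s" "s < s'" "s' \<le> T" "0 < frozen_gain s s' y"
  shows "profitable s y"
proof (rule bermudan_pos_imp_profitable[OF assms(1)])
  show "0 < bermudan (s' - s) s y"
    using bermudan_step[of "s' - s" s y] transition_bermudan_nonneg[of "s' - s" "s' - s" s' y] assms
    by (simp add: continuation_value_def)
qed


subsection \<open>Regions of the Bermudan problem\<close>

definition grid_region :: "real \<Rightarrow> real \<Rightarrow> (real \<Rightarrow> 'a set) \<Rightarrow> (real \<times> 'a) set" where
  "grid_region h s A = {(u, \<omega>). s \<le> u \<and> grid_floor s h u + h \<le> T \<and> \<omega> \<in> A (grid_floor s h u)}"

lemma grid_region_step:
  assumes "0 < h" "s + h \<le> T"
  shows "grid_region h s A = {s..<s+h} \<times> A s \<union> grid_region h (s + h) A"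
proof (intro set_eqI)
  fix x :: "real \<times> 'a"
  show "x \<in> grid_region h s A \<longleftrightarrow> x \<in> {s..<s+h} \<times> A s \<union> grid_region h (s + h) A"
    using assms grid_floor_eq_start[of s "fst x" h] grid_floor_shift[of h s "fst x"]
    by (cases x; cases "fst x < s + h") (auto simp: grid_region_def)
qed

lemma grid_region_empty: "0 < h \<Longrightarrow> T < s + h \<Longrightarrow> grid_region h s A = {}"
  using start_le_grid_floor[of h s] by (force simp: grid_region_def)

lemma sets_grid_region:
  "0 < h \<Longrightarrow> (\<And>v. s \<le> v \<Longrightarrow> v + h \<le> T \<Longrightarrow> A v \<in> sets N) \<Longrightarrow> grid_region h s A \<in> sets time_space"
proof (induction h s rule: bermudan.induct)
  case (1 h s)
  show ?case
  proof (cases "s + h \<le> T")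
    case True
    then have "grid_region h (s + h) A \<in> sets time_space" using 1 by auto
    then show ?thesis using 1(2) 1(3)[of s] True by (simp add: grid_region_step pair_measureI)
  qed (use 1(2) in \<open>simp add: grid_region_empty\<close>)
qed

lemma grid_region_subset:
  assumes "0 < h" "\<And>v. A v \<subseteq> space N"
  shows "grid_region h s A \<subseteq> {s..<T} \<times> space N"
proof
  fix x assume "x \<in> grid_region h s A"
  then show "x \<in> {s..<T} \<times> space N"
    using assms(2) less_grid_floor_add[OF assms(1), of "fst x" s] by (auto simp: grid_region_def)
qed

lemma set_integral_grid_region_step:
  fixes f :: "real \<times> 'a \<Rightarrow> real"
  assumes f: "set_integrable time_space ({t..<T} \<times> space N) f" and "t \<le> s" and h: "0 < h" "s + h \<le> T"
    and A: "\<And>v. s \<le> v \<Longrightarrow> v + h \<le> T \<Longrightarrow> A v \<in> sets N" "\<And>v. A v \<subseteq> space N"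
  shows "(LINT x:grid_region h s A|time_space. f x)
    = (LINT x:{s..<s+h} \<times> A s|time_space. f x) + (LINT x:grid_region h (s + h) A|time_space. f x)"
  unfolding grid_region_step[OF h]
proof (rule set_integral_Un)
  show "{s..<s+h} \<times> A s \<inter> grid_region h (s + h) A = {}" by (auto simp: grid_region_def)
  show "set_integrable time_space ({s..<s+h} \<times> A s) f"
    by (rule set_integrable_subset[OF f]) (use assms A(2)[of s] in \<open>auto intro!: pair_measureI\<close>)
  have "grid_region h (s + h) A \<subseteq> {t..<T} \<times> space N"
    using grid_region_subset[OF h(1) A(2), of "s + h"] assms(2) h(1) by fastforce
  then show "set_integrable time_space (grid_region h (s + h) A) f"
    using A(1) h(1) by (intro set_integrable_subset[OF f] sets_grid_region) auto
qed

lemma reentry_le_abs_reward: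
  assumes t: "0 \<le> t" "t \<le> s" and h: "0 < h" "s + h \<le> T" and A: "A \<in> sets (F s)"
    and stopped: "\<And>\<omega>. \<omega> \<in> A \<Longrightarrow> bermudan h s (Y t y s \<omega>) = 0"
  shows "(LINT \<omega>:A|N. bermudan h (s + h) (Y t y (s + h) \<omega>)) \<le> (LINT x:{s..<s+h} \<times> A|time_space. \<bar>path_reward t y x\<bar>)"
proof -
  note cont = continuation_value_integral[OF t h A, of y]
  have "continuation_value h s (Y t y s \<omega>) \<le> 0" if "\<omega> \<in> A" for \<omega>
    using stopped[OF that] bermudan_step[OF h, of "Y t y s \<omega>"] by (simp add: max_def split: if_splits)
  then have "(LINT \<omega>:A|N. continuation_value h s (Y t y s \<omega>)) \<le> (LINT \<omega>:A|N. 0)"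
    by (intro set_integral_mono cont(1)) (auto simp: set_integrable_def)
  then have "(LINT \<omega>:A|N. bermudan h (s + h) (Y t y (s + h) \<omega>)) \<le> - (LINT x:{s..<s+h} \<times> A|time_space. path_reward t y x)"
    unfolding cont(2) by simp
  also have "\<dots> \<le> (LINT x:{s..<s+h} \<times> A|time_space. \<bar>path_reward t y x\<bar>)"
  proof -
    have "A \<in> sets N" using A sets_F_subset by auto
    then have "set_integrable time_space ({s..<s+h} \<times> A) (path_reward t y)"
      using t h sets.sets_into_space[of A N] by (intro path_reward_integrable pair_measureI) auto
    then show ?thesis
      by (subst set_integral_uminus[symmetric]) (auto intro!: set_integral_mono set_integrable_abs simp: set_integrable_def)
  qed
  finally show ?thesis .
qed


subsection \<open>Behaviour near the horizon\<close>

lemma profitable_if_reward_pos: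
  assumes "0 \<le> s" "s < T" "0 < reward s y"
  shows "profitable s y"
proof -
  have "((\<lambda>u. reward u y) \<longlongrightarrow> reward s y) (at_right s)"
    using reward_continuous[of y] by (simp add: continuous_on_eq_continuous_at isCont_def filterlim_at_split)
  then have "\<forall>\<^sub>F u in at_right s. reward s y / 2 < reward u y"
    using assms(3) by (intro order_tendstoD(1)) auto
  moreover have "\<forall>\<^sub>F u in at_right s. u \<in> {s<..<T}"
    using assms(2) by (rule eventually_at_right_real)
  ultimately have "\<forall>\<^sub>F u in at_right s. u \<in> {s<..<T} \<and> reward s y / 2 < reward u y"
    by (rule eventually_conj[rotated])
  then obtain s' where s': "s < s'" "\<And>u. s < u \<Longrightarrow> u < s' \<Longrightarrow> u \<in> {s<..<T} \<and> reward s y / 2 < reward u y"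
    unfolding eventually_at_right_field by blast
  define u where "u = (s + s') / 2"
  have u: "s < u" "u < s'" "u \<le> T" using s'(1) s'(2)[of "(s + s') / 2"] by (auto simp: u_def)
  have "(u - s) * (reward s y / 2) \<le> frozen_gain s u y"
  proof (rule frozen_gain_ge)
    show "reward s y / 2 \<le> reward v y" if "s \<le> v" "v < u" for v
      using s'(2)[of v] u(2) assms(3) that by (cases "v = s") auto
  qed (use u in simp)
  moreover have "0 < (u - s) * (reward s y / 2)" using u assms(3) by simp
  ultimately show ?thesis
    using u assms(1) by (intro frozen_gain_pos_imp_profitable[of s u]) auto
qed

lemma reward_pos_iff: "0 < reward u y \<longleftrightarrow> a u * exp y < 1"
  by (simp add: reward_def zero_less_mult_iff)

lemma reward_neg_iff: "reward u y < 0 \<longleftrightarrow> 1 < a u * exp y"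
  by (simp add: reward_def mult_less_0_iff)

lemma reward_locally_negative:
  assumes "reward u y < 0"
  obtains y' d k where "y' < y" "0 < d" "0 < k" "\<And>v x. \<bar>v - u\<bar> < d \<Longrightarrow> y' \<le> x \<Longrightarrow> reward v x \<le> - k"
proof -
  define c where "c = ln (a u * exp y)"
  have c: "0 < c" "exp c = a u * exp y"
    using assms a_pos[of u] by (auto simp: c_def reward_neg_iff)
  define y' where "y' = y - c / 2"
  have "a u * exp y' = exp c / exp (c / 2)" by (simp add: y'_def exp_diff c(2))
  also have "\<dots> = exp (c / 2)" by (simp add: exp_diff[symmetric])
  finally have neg: "reward u y' < 0" using c(1) by (simp add: reward_neg_iff)
  define k where "k = - reward u y' / 2"
  have k: "0 < k" "reward u y' < - k" using neg by (auto simp: k_def)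
  have "((\<lambda>v. reward v y') \<longlongrightarrow> reward u y') (at u)"
    using reward_continuous[of y'] by (simp add: continuous_on_eq_continuous_at isCont_def)
  then have "\<forall>\<^sub>F v in at u. reward v y' < - k" using k(2) by (rule order_tendstoD)
  then obtain d where d: "0 < d" "\<And>v. v \<noteq> u \<Longrightarrow> dist v u < d \<Longrightarrow> reward v y' < - k"
    unfolding eventually_at by auto
  show thesis
  proof (rule that[of y' d k])
    fix v x assume "\<bar>v - u\<bar> < d" "y' \<le> x"
    then show "reward v x \<le> - k"
      using d(2)[of v] k(2) reward_antimono[of y' x v] by (cases "v = u") (auto simp: dist_real_def)
  qed (use c d k in \<open>auto simp: y'_def\<close>)
qed

context
  fixes s y y1 k A :: real
  assumes s: "0 \<le> s" and y1: "y1 < y" and k: "0 \<le> k"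
    and reward_neg: "\<And>u x. s \<le> u \<Longrightarrow> u < T \<Longrightarrow> y1 \<le> x \<Longrightarrow> reward u x \<le> - k"
    and drift: "\<nu>\<^sup>2 * (T - s) \<le> y - y1"
  defines "A \<equiv> (reward_max + k) * \<nu>\<^sup>2 / ((y - y1) / 2)\<^sup>2"
begin

lemma quadratic_coeff_nonneg: "0 \<le> A"
  using reward_max_pos k by (simp add: A_def)

lemma frozen_gain_le_quadratic:
  assumes h: "0 < h" "s \<le> u" "u + h \<le> T"
  shows "frozen_gain u (u + h) (y + \<nu> * w - \<nu>\<^sup>2 / 2 * (u - s)) \<le> h * (- k + A * w\<^sup>2)"
proof (cases "y1 \<le> y + \<nu> * w - \<nu>\<^sup>2 / 2 * (u - s)")
  case True
  then have "frozen_gain u (u + h) (y + \<nu> * w - \<nu>\<^sup>2 / 2 * (u - s)) \<le> (u + h - u) * (- k)"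
    using h by (intro frozen_gain_le reward_neg) auto
  also have "\<dots> \<le> h * (- k + A * w\<^sup>2)"
    using h quadratic_coeff_nonneg by (simp add: algebra_simps)
  finally show ?thesis .
next
  case False
  define q where "q = (y - y1) / 2"
  have q: "0 < q" using y1 by (simp add: q_def)
  have "\<nu>\<^sup>2 / 2 * (u - s) \<le> \<nu>\<^sup>2 / 2 * (T - s)" using h by (intro mult_left_mono) auto
  also have "\<dots> \<le> q" using drift by (simp add: q_def)
  finally have "q \<le> - (\<nu> * w)" using False by (simp add: q_def field_simps)
  then have "q\<^sup>2 \<le> (\<nu> * w)\<^sup>2" using q by (intro abs_le_square_iff[THEN iffD1]) auto
  then have "1 \<le> \<nu>\<^sup>2 / q\<^sup>2 * w\<^sup>2" using q by (simp add: power_mult_distrib)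
  then have "(reward_max + k) * 1 \<le> (reward_max + k) * (\<nu>\<^sup>2 / q\<^sup>2 * w\<^sup>2)"
    using reward_max_pos k by (intro mult_left_mono) auto
  then have "h * reward_max \<le> h * (- k + A * w\<^sup>2)"
    using h(1) unfolding A_def q_def[symmetric] by (intro mult_left_mono) auto
  moreover have "frozen_gain u (u + h) (y + \<nu> * w - \<nu>\<^sup>2 / 2 * (u - s)) \<le> h * reward_max"
    using frozen_gain_le_reward_max[of u "u + h"] h s by simp
  ultimately show ?thesis by simp
qed

text \<open>The quadratic is a supersolution of the recursion and vanishes at \<open>w = 0\<close>.\<close>

lemma bermudan_le_quadratic:
  assumes "A * (T - s) \<le> k"
  shows "s \<le> u \<Longrightarrow> u \<le> T \<Longrightarrow> bermudan h u (y + \<nu> * w - \<nu>\<^sup>2 / 2 * (u - s)) \<le> A * (T - u) * w\<^sup>2"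
proof (induction h u arbitrary: w rule: bermudan.induct)
  case (1 h u)
  define x where "x = y + \<nu> * w - \<nu>\<^sup>2 / 2 * (u - s)"
  have rhs_nonneg: "0 \<le> A * (T - u) * w\<^sup>2" using 1 quadratic_coeff_nonneg by simp
  show ?case
  proof (cases "0 < h \<and> u + h \<le> T")
    case True
    then have h: "0 < h" "u + h \<le> T" by auto
    define c where "c = A * (T - (u + h))"
    note second_moment = has_bochner_integral_mult_right[OF gaussian_second_moment_about[OF h(1), of w], of c]
    have "transition h (bermudan h (u + h)) x \<le> (\<integral>z. c * (w + z)\<^sup>2 \<partial>gaussian h)"
      unfolding transition_def
    proof (rule integral_mono)
      show "integrable (gaussian h) (\<lambda>z. bermudan h (u + h) (x + \<nu> * z - \<nu>\<^sup>2 / 2 * h))"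
        using h 1(2) s by (intro bermudan_transition_integrable) auto
      fix z
      have "x + \<nu> * z - \<nu>\<^sup>2 / 2 * h = y + \<nu> * (w + z) - \<nu>\<^sup>2 / 2 * (u + h - s)"
        by (simp add: x_def algebra_simps add_divide_distrib diff_divide_distrib)
      then show "bermudan h (u + h) (x + \<nu> * z - \<nu>\<^sup>2 / 2 * h) \<le> c * (w + z)\<^sup>2"
        using 1(1)[OF True, of "w + z"] h 1(2) by (simp add: c_def)
    qed (use second_moment in \<open>simp add: has_bochner_integral_iff\<close>)
    also have "\<dots> = c * (w\<^sup>2 + h)" using second_moment by (rule has_bochner_integral_integral_eq)
    finally have "continuation_value h u x \<le> h * (- k + A * w\<^sup>2) + c * (w\<^sup>2 + h)"
      using frozen_gain_le_quadratic[OF h(1) 1(2) h(2), of w] by (simp add: continuation_value_def x_def)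
    moreover have "c \<le> k"
    proof -
      have "c \<le> A * (T - s)" unfolding c_def using quadratic_coeff_nonneg 1(2) h by (intro mult_left_mono) auto
      then show ?thesis using assms by simp
    qed
    then have "h * (- k + A * w\<^sup>2) + c * (w\<^sup>2 + h) \<le> A * (T - u) * w\<^sup>2"
      using mult_left_mono[of c k h] h(1) by (simp add: c_def algebra_simps)
    ultimately show ?thesis
      using rhs_nonneg h by (simp add: bermudan_step x_def)
  qed (use rhs_nonneg in \<open>simp add: bermudan_last\<close>)
qed

lemma not_profitable_if_reward_neg:
  assumes "s \<le> T" "A * (T - s) \<le> k"
  shows "\<not> profitable s y"
  using bermudan_le_quadratic[OF assms(2) order_refl assms(1), of _ 0] s
  by (auto simp: profitable_iff_bermudan_pos not_less)

end

lemma not_profitable_near_horizon: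
  assumes "1 < a T * exp y"
  shows "\<forall>\<^sub>F s in at_left T. \<not> profitable s y"
proof -
  obtain y1 d k where y1: "y1 < y" and d: "0 < d" and k: "0 < k"
    and neg: "\<And>u x. \<bar>u - T\<bar> < d \<Longrightarrow> y1 \<le> x \<Longrightarrow> reward u x \<le> - k"
    using assms reward_locally_negative[of T y] by (auto simp: reward_neg_iff)
  define A where "A = (reward_max + k) * \<nu>\<^sup>2 / ((y - y1) / 2)\<^sup>2"
  have "((\<lambda>s. c * (T - s)) \<longlongrightarrow> c * (T - T)) (at_left T)" for c
    by (intro tendsto_intros)
  then have small: "\<forall>\<^sub>F s in at_left T. c * (T - s) < e" if "0 < e" for c e
    using that by (intro order_tendstoD(2)) auto
  have "\<forall>\<^sub>F s in at_left T. s \<in> {0<..<T}" using horizon_pos by (rule eventually_at_left_real)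
  moreover have "0 < y - y1" using y1 by simp
  note small[OF d, of 1] small[OF k, of A] small[OF this, of "\<nu>\<^sup>2"]
  ultimately show ?thesis
  proof eventually_elim
    case (elim s)
    then show ?case
      using y1 k neg by (intro not_profitable_if_reward_neg[of s y1 y k]) (auto simp: A_def)
  qed
qed


subsection \<open>The case of zero volatility\<close>

lemma bermudan_zero_volatility:
  assumes "\<nu> = 0"
  shows "s \<le> T \<Longrightarrow> \<exists>s'\<in>{s..T}. bermudan h s y = frozen_gain s s' y"
proof (induction h s rule: bermudan.induct)
  case (1 h s)
  have stop_now: "frozen_gain s s y = 0" by (simp add: frozen_gain_def set_lebesgue_integral_def)
  show ?case
  proof (cases "0 < h \<and> s + h \<le> T \<and> 0 \<le> continuation_value h s y")
    case True
    then obtain s' where s': "s' \<in> {s+h..T}" "bermudan h (s + h) y = frozen_gain (s + h) s' y"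
      using 1 by auto
    have "continuation_value h s y = frozen_gain s s' y"
      using transition_zero_volatility[OF assms] frozen_gain_add[of s "s + h" s' y] s' True
      by (simp add: continuation_value_def)
    then show ?thesis using True s'(1) by (intro bexI[of _ s']) (auto simp: bermudan_step)
  next
    case False
    then have "bermudan h s y = 0"
      using bermudan_step[of h s y] bermudan_last[of h s y] by (cases "0 < h \<and> s + h \<le> T") auto
    then show ?thesis using 1(2) stop_now by (intro bexI[of _ s]) auto
  qed
qed

lemma profitable_zero_volatility_iff:
  assumes "\<nu> = 0" "0 \<le> s"
  shows "profitable s y \<longleftrightarrow> (\<exists>s'. s < s' \<and> s' \<le> T \<and> 0 < frozen_gain s s' y)"
proof
  assume "profitable s y"
  then obtain h where h: "0 < bermudan h s y" using assms(2) by (auto simp: profitable_iff_bermudan_pos)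
  then have "s \<le> T" using bermudan_pos_imp by fastforce
  then obtain s' where s': "s' \<in> {s..T}" "0 < frozen_gain s s' y"
    using bermudan_zero_volatility[OF assms(1), of s h y] h by auto
  then have "s \<noteq> s'" by (auto simp: frozen_gain_def set_lebesgue_integral_def)
  then show "\<exists>s'. s < s' \<and> s' \<le> T \<and> 0 < frozen_gain s s' y"
    using s' by (intro exI[of _ s']) auto
qed (use frozen_gain_pos_imp_profitable assms(2) in blast)

end


section \<open>The free boundary\<close>

locale stopping_boundary = stopping_problem +
  fixes b :: "real \<Rightarrow> real"
  assumes boundary: "0 \<le> s \<Longrightarrow> s < T \<Longrightarrow> profitable s y \<longleftrightarrow> y < b s"
begin

lemma not_profitable_boundary: "0 \<le> s \<Longrightarrow> s < T \<Longrightarrow> \<not> profitable s (b s)"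
  by (simp add: boundary)

lemma boundary_shift:
  assumes "0 \<le> s'" "s' \<le> s" "s < T"
  shows "b s - L * (s - s') \<le> b s'"
proof (rule ccontr)
  assume "\<not> ?thesis"
  then have "profitable s (b s' + L * (s - s'))" using assms by (simp add: boundary)
  from profitable_time_shift[OF assms(1,2) this] show False
    using not_profitable_boundary assms by simp
qed

lemma reward_boundary_nonpos: "0 \<le> s \<Longrightarrow> s < T \<Longrightarrow> reward s (b s) \<le> 0"
  using profitable_if_reward_pos[of s "b s"] not_profitable_boundary[of s] by force

theorem boundary_tendsto_horizon: "(b \<longlongrightarrow> - ln (a T)) (at_left T)"
proof (rule order_tendstoI)
  fix y assume y: "y < - ln (a T)"
  have "isCont (\<lambda>u. - ln (a u)) T"
    using a_pos[of T] by (intro continuous_intros isCont_a) auto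
  then have "((\<lambda>u. - ln (a u)) \<longlongrightarrow> - ln (a T)) (at_left T)"
    unfolding isCont_def by (rule tendsto_within_subset) auto
  then have "\<forall>\<^sub>F s in at_left T. y < - ln (a s)" using y by (rule order_tendstoD)
  moreover have "\<forall>\<^sub>F s in at_left T. s \<in> {0<..<T}" using horizon_pos by (rule eventually_at_left_real)
  ultimately show "\<forall>\<^sub>F s in at_left T. y < b s"
  proof eventually_elim
    case (elim s)
    then have "1 \<le> a s * exp (b s)"
      using reward_boundary_nonpos[of s] reward_pos_iff[of s "b s"] by force
    then have "0 \<le> ln (a s * exp (b s))" by simp
    then show ?case using elim a_pos[of s] by (simp add: ln_mult)
  qed
next
  fix y assume y: "- ln (a T) < y"
  define z where "z = (y - ln (a T)) / 2"
  have z: "- ln (a T) < z" "z < y" using y by (auto simp: z_def)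
  have "0 < ln (a T * exp z)" using z a_pos[of T] by (simp add: ln_mult)
  then have "1 < a T * exp z" using a_pos[of T] by simp
  then have "\<forall>\<^sub>F s in at_left T. \<not> profitable s z" by (rule not_profitable_near_horizon)
  moreover have "\<forall>\<^sub>F s in at_left T. s \<in> {0<..<T}" using horizon_pos by (rule eventually_at_left_real)
  ultimately show "\<forall>\<^sub>F s in at_left T. b s < y"
    by eventually_elim (use z boundary[of _ z] in force)
qed

lemma boundary_mono_on: "mono_on {0..<T} (\<lambda>s. L * s - b s)"
  using boundary_shift by (intro mono_onI) (fastforce simp: algebra_simps)

lemma boundary_measurable: "(\<lambda>u. indicator {0..<T} u * b u) \<in> borel_measurable borel"
proof -
  have "(\<lambda>s. indicator {0..<T} s * (L * s - b s)) \<in> borel_measurable borel"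
    using borel_measurable_mono_on_fnc[OF boundary_mono_on]
    by (subst (asm) borel_measurable_restrict_space_iff) auto
  then have "(\<lambda>s. indicator {0..<T} s * (L * s) - indicator {0..<T} s * (L * s - b s)) \<in> borel_measurable borel"
    by measurable
  also have "(\<lambda>s. indicator {0..<T} s * (L * s) - indicator {0..<T} s * (L * s - b s)) = (\<lambda>u. indicator {0..<T} u * b u)"
    by (auto split: split_indicator)
  finally show ?thesis .
qed

lemma countable_boundary_discontinuities:
  "countable {u \<in> {0..<T}. \<not> continuous (at u within {0..<T}) b}"
proof -
  have "continuous (at u within {0..<T}) b" if "continuous (at u within {0..<T}) (\<lambda>s. L * s - b s)" for u
  proof -
    have "continuous (at u within {0..<T}) (\<lambda>s. L * s)" by (intro continuous_intros)
    from continuous_diff[OF this that] show ?thesis by simp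
  qed
  then show ?thesis
    by (intro countable_subset[OF _ mono_on_ctble_discont[OF boundary_mono_on]]) auto
qed

lemma zero_volatility_boundary_right_isolated:
  assumes "\<nu> = 0" and u: "0 \<le> u" "u < T" "reward u (b u) \<noteq> 0"
  shows "\<exists>e>0. \<forall>v. u < v \<longrightarrow> v < u + e \<longrightarrow> v < T \<longrightarrow> b v \<noteq> b u"
proof -
  define y where "y = b u"
  have "reward u y < 0" using reward_boundary_nonpos[OF u(1,2)] u(3) by (simp add: y_def)
  then obtain y' d k where y': "y' < y" and d: "0 < d" and k: "0 < k"
    and neg: "\<And>v x. \<bar>v - u\<bar> < d \<Longrightarrow> y' \<le> x \<Longrightarrow> reward v x \<le> - k"
    using reward_locally_negative by blast
  have "b v \<noteq> y" if v: "u < v" "v < u + d" "v < T" for v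
  proof
    assume bv: "b v = y"
    define D where "D = (LBINT u:{v..<T}. exp (\<theta> * u) * a u)"
    have "(v - u) * k < D * (exp y - exp z)" if z: "y' < z" "z < y" for z
    proof -
      have initial_loss: "frozen_gain u w z \<le> (w - u) * (- k)" if "u \<le> w" "w \<le> v" for w
        using that v z by (intro frozen_gain_le neg) auto
      obtain w where w: "u < w" "w \<le> T" "0 < frozen_gain u w z"
        using boundary[OF u(1,2), of z] z profitable_zero_volatility_iff[OF assms(1) u(1)] by (auto simp: y_def)
      have "\<not> w \<le> v"
        using initial_loss[of w] w mult_pos_pos[of "w - u" k] k by fastforce
      then have vw: "v < w" by simp
      have "0 < - ((v - u) * k) + frozen_gain v w z"
        using frozen_gain_add[of u v w z] initial_loss[of v] w v vw by simp
      moreover have "frozen_gain v w y \<le> 0"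
        using not_profitable_boundary[of v] profitable_zero_volatility_iff[OF assms(1), of v y] bv u v vw w(2)
        by (auto simp: not_less)
      moreover have "frozen_gain v w z - frozen_gain v w y \<le> D * (exp y - exp z)"
        unfolding D_def using w(2) z by (intro frozen_gain_diff_le) auto
      ultimately show ?thesis by simp
    qed
    moreover have "((\<lambda>z. D * (exp y - exp z)) \<longlongrightarrow> D * (exp y - exp y)) (at_left y)"
      by (intro tendsto_intros)
    then have "\<forall>\<^sub>F z in at_left y. D * (exp y - exp z) < (v - u) * k"
      using v k by (intro order_tendstoD(2)) auto
    with eventually_at_left_real[OF y'] have "\<forall>\<^sub>F z in at_left y. z \<in> {y'<..<y} \<and> D * (exp y - exp z) < (v - u) * k"
      by (rule eventually_conj)
    ultimately show False by (force dest!: eventually_happens' [rotated])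
  qed
  then show ?thesis using d by (intro exI[of _ d]) (auto simp: y_def)
qed

lemma AE_zero_volatility_off_boundary:
  assumes "\<nu> = 0"
  shows "AE u in lborel. u \<in> {0..<T} \<longrightarrow> y \<noteq> b u \<or> reward u y = 0"
proof -
  let ?E = "{u \<in> {0..<T}. b u = y \<and> reward u y \<noteq> 0}"
  have "countable ?E"
    using zero_volatility_boundary_right_isolated[OF assms]
    by (intro countable_if_right_isolated) (metis (mono_tags, lifting) atLeastLessThan_iff mem_Collect_eq not_less)
  then show ?thesis
    by (intro AE_I'[OF countable_imp_null_set_lborel]) auto
qed

lemma AE_off_boundary:
  assumes "0 \<le> t"
  shows "AE u in lborel. u \<in> {t<..<T} \<longrightarrow> (AE \<omega> in N. Y t y u \<omega> \<noteq> b u \<or> reward u (Y t y u \<omega>) = 0)"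
proof (cases "\<nu> = 0")
  case True
  note Y_zero_volatility[OF this, simp]
  show ?thesis
    using AE_zero_volatility_off_boundary[OF True, of y] by eventually_elim (use assms in auto)
next
  case False
  have "AE \<omega> in N. Y t y u \<omega> \<noteq> b u \<or> reward u (Y t y u \<omega>) = 0" if "u \<in> {t<..<T}" for u
  proof -
    have "AE \<omega> in N. Y t y u \<omega> \<noteq> b u" using AE_Y_neq[OF False assms, of u] that by simp
    then show ?thesis by eventually_elim simp
  qed
  then show ?thesis by simp
qed


subsection \<open>Re-entry into the continuation region\<close>

definition layer_event :: "real \<Rightarrow> real \<Rightarrow> real \<Rightarrow> real \<Rightarrow> real \<Rightarrow> 'a set" where
  "layer_event h l t y s = {\<omega> \<in> space N. bermudan h s (Y t y s \<omega>) = 0 \<and> Y t y s \<omega> < b s + l}"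

definition reentry_const :: real where
  "reentry_const = 16 * 3 * T * reward_max * \<nu> ^ 4"

definition reentry_tail :: "real \<Rightarrow> real \<Rightarrow> real \<Rightarrow> 'a \<Rightarrow> real" where
  "reentry_tail h l s \<omega> = T * reward_max * (16 * \<nu> ^ 4 / l ^ 4 * (W (s + h) \<omega> - W s \<omega>) ^ 4)"

lemma sets_layer_event:
  assumes "0 \<le> t" "t \<le> s" "s \<le> T"
  shows "layer_event h l t y s \<in> sets (F s)" "layer_event h l t y s \<in> sets N"
proof -
  have Y_meas: "Y t y s \<in> borel_measurable (F s)" using assms by (rule Y_adapted)
  have "layer_event h l t y s = ((\<lambda>\<omega>. bermudan h s (Y t y s \<omega>)) -` {0} \<inter> space (F s)) \<inter> (Y t y s -` {..<b s + l} \<inter> space (F s))"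
    by (auto simp: layer_event_def)
  then show "layer_event h l t y s \<in> sets (F s)"
    using measurable_sets[OF measurable_compose[OF Y_meas bermudan_measurable], of "{0}"]
      measurable_sets[OF Y_meas, of "{..<b s + l}"] by (simp add: sets.Int)
  then show "layer_event h l t y s \<in> sets N" using sets_F_subset by blast
qed

lemma reentry_tail_nonneg: "0 \<le> reentry_tail h l s \<omega>"
  unfolding reentry_tail_def using horizon_pos reward_max_pos by (intro mult_nonneg_nonneg divide_nonneg_nonneg) auto

lemma has_bochner_integral_reentry_tail:
  assumes "0 \<le> s" "0 < h" "s + h \<le> T"
  shows "has_bochner_integral N (reentry_tail h l s) (h * (h * reentry_const / l ^ 4))"
proof -
  have "has_bochner_integral N (\<lambda>\<omega>. (W (s + h) \<omega> - W s \<omega>) ^ 4) (3 * h\<^sup>2)"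
    using assms gaussian_fourth_moment[of h] by (intro has_bochner_integral_increment) auto
  then have "has_bochner_integral N (reentry_tail h l s) (T * reward_max * (16 * \<nu> ^ 4 / l ^ 4 * (3 * h\<^sup>2)))"
    unfolding reentry_tail_def by (intro has_bochner_integral_mult_right)
  then show ?thesis by (simp add: reentry_const_def power2_eq_square mult_ac)
qed

text \<open>Re-entry from above the layer requires an increment of order \<open>l\<close>, as the boundary rises at most linearly.\<close>

lemma far_reentry_le:
  assumes s: "0 \<le> s" "0 < h" "s + h \<le> T" and l: "0 < l" "(L + \<nu>\<^sup>2 / 2) * h \<le> l / 2"
    and far: "b s + l \<le> Y t y s \<omega>"
  shows "bermudan h (s + h) (Y t y (s + h) \<omega>) \<le> reentry_tail h l s \<omega>"
proof (cases "0 < bermudan h (s + h) (Y t y (s + h) \<omega>)")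
  case True
  define D where "D = W (s + h) \<omega> - W s \<omega>"
  have sh: "s + h < T" using bermudan_pos_imp[OF True] by simp
  have "Y t y (s + h) \<omega> < b (s + h)"
    using bermudan_pos_imp_profitable[OF _ True] boundary[of "s + h"] s sh by simp
  also have "\<dots> \<le> b s + L * h" using boundary_shift[of s "s + h"] s sh by simp
  also have "\<dots> \<le> Y t y s \<omega> - l + L * h" using far by simp
  finally have "\<nu> * D - \<nu>\<^sup>2 / 2 * h < - l + L * h"
    using Y_increment[of t y "s + h" \<omega> s] by (simp add: D_def)
  then have "l / 2 \<le> \<bar>\<nu> * D\<bar>" using l by (simp add: algebra_simps)
  then have "1 \<le> (\<bar>\<nu> * D\<bar> / (l / 2)) ^ 4" using l by (intro one_le_power) simp
  also have "\<dots> = 16 * \<nu> ^ 4 / l ^ 4 * D ^ 4" by (simp add: power_divide power_mult_distrib power_even_abs)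
  finally have "T * reward_max * 1 \<le> T * reward_max * (16 * \<nu> ^ 4 / l ^ 4 * D ^ 4)"
    using horizon_pos reward_max_pos by (intro mult_left_mono) auto
  then show ?thesis
    using abs_bermudan_le[of "s + h" h "Y t y (s + h) \<omega>"] s by (simp add: reentry_tail_def D_def)
next
  case False
  then show ?thesis using reentry_tail_nonneg[of h l s \<omega>] by linarith
qed

lemma reentry_le:
  assumes t: "0 \<le> t" "t \<le> s" and h: "0 < h" "s + h \<le> T" and l: "0 < l" "(L + \<nu>\<^sup>2 / 2) * h \<le> l / 2"
  shows "(LINT \<omega>:space N - continuation_event h t y s|N. bermudan h (s + h) (Y t y (s + h) \<omega>))
    \<le> (LINT x:{s..<s+h} \<times> layer_event h l t y s|time_space. \<bar>path_reward t y x\<bar>) + h * (h * reentry_const / l ^ 4)"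
proof -
  define V where "V \<omega> = bermudan h (s + h) (Y t y (s + h) \<omega>)" for \<omega>
  define R where "R = reentry_tail h l s"
  define P where "P = continuation_event h t y s"
  define A where "A = layer_event h l t y s"
  have s: "0 \<le> s" "0 \<le> s + h" "s \<le> T" using t h by auto
  have P: "P \<in> sets N" and A: "A \<in> sets (F s)" "A \<in> sets N"
    unfolding P_def A_def by (intro sets_continuation_event sets_layer_event t s)+
  have V_int: "set_integrable N E V" if "E \<in> sets N" for E
    unfolding V_def using s(2) that by (rule set_integrable_bermudan_Y)
  have R: "has_bochner_integral N R (h * (h * reentry_const / l ^ 4))" "\<And>\<omega>. 0 \<le> R \<omega>"
    unfolding R_def using has_bochner_integral_reentry_tail[OF s(1) h] by (auto intro: reentry_tail_nonneg)
  have "(LINT \<omega>:space N - P|N. V \<omega>) \<le> (\<integral>\<omega>. indicator A \<omega> * V \<omega> + R \<omega> \<partial>N)"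
    unfolding set_lebesgue_integral_def real_scaleR_def
  proof (rule integral_mono)
    show "integrable N (\<lambda>\<omega>. indicator (space N - P) \<omega> * V \<omega>)"
      using V_int[of "space N - P"] P by (simp add: set_integrable_def sets.Diff)
    show "integrable N (\<lambda>\<omega>. indicator A \<omega> * V \<omega> + R \<omega>)"
      using V_int[OF A(2)] R(1) by (simp add: set_integrable_def has_bochner_integral_iff)
    fix \<omega> assume \<omega>: "\<omega> \<in> space N"
    consider "\<omega> \<in> P" | "\<omega> \<in> A" | "\<omega> \<notin> A" "b s + l \<le> Y t y s \<omega>"
      using \<omega> bermudan_nonneg[of h s "Y t y s \<omega>"] by (force simp: P_def A_def continuation_event_def layer_event_def)
    then show "indicator (space N - P) \<omega> * V \<omega> \<le> indicator A \<omega> * V \<omega> + R \<omega>"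
    proof cases
      case 3
      then show ?thesis
        using far_reentry_le[OF s(1) h l, of t y \<omega>] R(2)[of \<omega>] by (simp add: V_def R_def indicator_def)
    qed (use R(2)[of \<omega>] bermudan_nonneg in \<open>auto simp: V_def indicator_def\<close>)
  qed
  also have "\<dots> = (LINT \<omega>:A|N. V \<omega>) + h * (h * reentry_const / l ^ 4)"
    using V_int[OF A(2)] R(1) by (simp add: set_integrable_def set_lebesgue_integral_def has_bochner_integral_iff)
  also have "(LINT \<omega>:A|N. V \<omega>) \<le> (LINT x:{s..<s+h} \<times> A|time_space. \<bar>path_reward t y x\<bar>)"
    unfolding V_def by (rule reentry_le_abs_reward[OF t h A(1)]) (simp add: A_def layer_event_def)
  finally show ?thesis by (simp add: P_def A_def V_def)
qed

lemma expected_bermudan_step_bounds: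
  fixes h t y
  defines "V \<equiv> \<lambda>s. \<integral>\<omega>. bermudan h s (Y t y s \<omega>) \<partial>N"
  assumes t: "0 \<le> t" "t \<le> s" and h: "0 < h" "s + h \<le> T" and l: "0 < l" "(L + \<nu>\<^sup>2 / 2) * h \<le> l / 2"
  shows "V s \<le> (LINT x:{s..<s+h} \<times> continuation_event h t y s|time_space. path_reward t y x) + V (s + h)"
    and "(LINT x:{s..<s+h} \<times> continuation_event h t y s|time_space. path_reward t y x) + V (s + h)
      \<le> V s + (LINT x:{s..<s+h} \<times> layer_event h l t y s|time_space. \<bar>path_reward t y x\<bar>) + h * (h * reentry_const / l ^ 4)"
proof -
  define P where "P = continuation_event h t y s"
  define V' where "V' \<omega> = bermudan h (s + h) (Y t y (s + h) \<omega>)" for \<omega>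
  have P: "P \<in> sets N" unfolding P_def using h by (intro sets_continuation_event t) simp
  have V'_int: "set_integrable N E V'" if "E \<in> sets N" for E
    unfolding V'_def using t h that by (intro set_integrable_bermudan_Y) auto
  have "(LINT \<omega>:P \<union> (space N - P)|N. V' \<omega>) = (LINT \<omega>:P|N. V' \<omega>) + (LINT \<omega>:space N - P|N. V' \<omega>)"
    using P V'_int by (intro set_integral_Un) auto
  moreover have "P \<union> (space N - P) = space N" using sets.sets_into_space[OF P] by auto
  moreover have "(LINT \<omega>:space N|N. V' \<omega>) = V (s + h)"
    unfolding V_def V'_def using t h by (intro set_integral_space bermudan_Y_integrable) auto
  ultimately have split: "V (s + h) = (LINT \<omega>:P|N. V' \<omega>) + (LINT \<omega>:space N - P|N. V' \<omega>)"
    by simp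
  have step: "V s = (LINT x:{s..<s+h} \<times> P|time_space. path_reward t y x) + (LINT \<omega>:P|N. V' \<omega>)"
    using set_integral_bermudan_step[OF t h space_in_sets_F, of y] t h P sets.sets_into_space[OF P]
    by (simp add: V_def P_def[symmetric] V'_def set_integral_space bermudan_Y_integrable Int_absorb1)
  have "0 \<le> (LINT \<omega>:space N - P|N. V' \<omega>)"
    unfolding set_lebesgue_integral_def V'_def by (simp add: bermudan_nonneg)
  then show "V s \<le> (LINT x:{s..<s+h} \<times> continuation_event h t y s|time_space. path_reward t y x) + V (s + h)"
    using split step by (simp add: P_def)
  show "(LINT x:{s..<s+h} \<times> continuation_event h t y s|time_space. path_reward t y x) + V (s + h)
      \<le> V s + (LINT x:{s..<s+h} \<times> layer_event h l t y s|time_space. \<bar>path_reward t y x\<bar>) + h * (h * reentry_const / l ^ 4)"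
    using reentry_le[OF t h l, of y] split step by (simp add: P_def V'_def)
qed

lemma grid_region_gain_bounds:
  fixes h l t y
  defines "V \<equiv> \<lambda>s. \<integral>\<omega>. bermudan h s (Y t y s \<omega>) \<partial>N"
    and "gains \<equiv> \<lambda>s. LINT x:grid_region h s (continuation_event h t y)|time_space. path_reward t y x"
    and "losses \<equiv> \<lambda>s. LINT x:grid_region h s (layer_event h l t y)|time_space. \<bar>path_reward t y x\<bar>"
  assumes t: "0 \<le> t" and h: "0 < h" and l: "0 < l" "(L + \<nu>\<^sup>2 / 2) * h \<le> l / 2"
  shows "t \<le> s \<Longrightarrow> s \<le> T \<Longrightarrow>
    V s \<le> gains s \<and> gains s \<le> V s + losses s + (T - s) * (h * reentry_const / l ^ 4)"
proof (induction h' \<equiv> h s rule: bermudan.induct)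
  case (1 s)
  define c where "c = h * reentry_const / l ^ 4"
  have c: "0 \<le> c"
    using h l horizon_pos reward_max_pos by (simp add: c_def reentry_const_def)
  show ?case
  proof (cases "s + h \<le> T")
    case True
    have events: "continuation_event h t y v \<in> sets N" "layer_event h l t y v \<in> sets N" if "s \<le> v" "v + h \<le> T" for v
      using that h 1(2) by (intro sets_continuation_event sets_layer_event t; simp)+
    have int: "set_integrable time_space ({t..<T} \<times> space N) (path_reward t y)"
      using t by (intro path_reward_integrable) auto
    have "gains s = (LINT x:{s..<s+h} \<times> continuation_event h t y s|time_space. path_reward t y x) + gains (s + h)"
      unfolding gains_def using events
      by (intro set_integral_grid_region_step[OF int 1(2) h True]) (auto simp: continuation_event_def)
    moreover have "losses s = (LINT x:{s..<s+h} \<times> layer_event h l t y s|time_space. \<bar>path_reward t y x\<bar>) + losses (s + h)"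
      unfolding losses_def using events
      by (intro set_integral_grid_region_step[OF set_integrable_abs[OF int] 1(2) h True]) (auto simp: layer_event_def)
    moreover have "V (s + h) \<le> gains (s + h) \<and> gains (s + h) \<le> V (s + h) + losses (s + h) + (T - (s + h)) * c"
      using 1(1) h True 1(2) by (simp add: c_def)
    ultimately show ?thesis
      using expected_bermudan_step_bounds[OF t 1(2) h True l, of y] unfolding V_def c_def[symmetric]
      by (simp add: algebra_simps)
  next
    case False
    then have "V s = 0" "gains s = 0" "losses s = 0"
      using h by (simp_all add: V_def gains_def losses_def grid_region_empty bermudan_last set_lebesgue_integral_def)
    then show ?thesis using c 1(3) by (simp add: c_def[symmetric])
  qed
qed


subsection \<open>The integral equation\<close>

lemma bermudan_pos_eventually:
  assumes u: "0 \<le> u" "u < T" and below: "y < b u" and h: "h \<longlonglongrightarrow> 0" "\<And>n. 0 < h n"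
    and s: "s \<longlonglongrightarrow> u" "\<And>n. 0 \<le> s n" "\<And>n. s n \<le> u" and x: "x \<longlonglongrightarrow> y"
  shows "\<forall>\<^sub>F n in sequentially. 0 < bermudan (h n) (s n) (x n)"
proof -
  define y' where "y' = (y + b u) / 2"
  have y': "y < y'" "y' < b u" using below by (auto simp: y'_def)
  then have "profitable u y'" using boundary[OF u] by simp
  from profitable_imp_bermudan_pos[OF u(1) this h]
  have "\<forall>\<^sub>F n in sequentially. 0 < bermudan (h n) u y'" .
  moreover have "(\<lambda>n. x n + L * (u - s n)) \<longlonglongrightarrow> y + L * (u - u)"
    by (intro tendsto_intros x s)
  then have "\<forall>\<^sub>F n in sequentially. x n + L * (u - s n) < y'"
    using y' by (intro order_tendstoD(2)) auto
  ultimately show ?thesis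
  proof eventually_elim
    case (elim n)
    have "0 < exp (- \<theta> * (u - s n)) * bermudan (h n) u y'" using elim(1) by simp
    also have "\<dots> \<le> bermudan (h n) (s n) (y' - L * (u - s n))" by (intro bermudan_time_shift s)
    also have "\<dots> \<le> bermudan (h n) (s n) (x n)" using elim(2) by (intro bermudan_antimono s) simp
    finally show ?case .
  qed
qed

lemma mem_grid_region_eventually:
  assumes t: "0 \<le> t" and u: "t < u" "u < T" and \<omega>: "\<omega> \<in> space N"
    and b_cont: "continuous (at u within {0..<T}) b" and off: "Y t y u \<omega> \<noteq> b u"
    and h: "h \<longlonglongrightarrow> 0" "\<And>n. 0 < h n" and l: "l \<longlonglongrightarrow> 0" "\<And>n. 0 < l n"
  shows "\<forall>\<^sub>F n in sequentially.
    ((u, \<omega>) \<in> grid_region (h n) t (continuation_event (h n) t y) \<longleftrightarrow> Y t y u \<omega> < b u) \<and>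
    (u, \<omega>) \<notin> grid_region (h n) t (layer_event (h n) (l n) t y)"
proof -
  define s where "s n = grid_floor t (h n) u" for n
  have s: "s \<longlonglongrightarrow> u" "\<And>n. t \<le> s n" "\<And>n. s n \<le> u"
    unfolding s_def using grid_floor_tendsto[OF h] start_le_grid_floor[OF h(2)] grid_floor_le[OF h(2)] u by auto
  have s_range: "0 \<le> s n" "s n < T" for n using s(2,3)[of n] t u by auto
  have Y_lim: "(\<lambda>n. Y t y (s n) \<omega>) \<longlonglongrightarrow> Y t y u \<omega>"
    using continuous_on_tendsto_compose[OF Y_continuous[OF \<omega>] s(1)] by simp
  have "(\<lambda>n. s n + h n) \<longlonglongrightarrow> u + 0" by (intro tendsto_add s h)
  then have step_fits: "\<forall>\<^sub>F n in sequentially. s n + h n < T" using u by (intro order_tendstoD(2)) auto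
  consider "Y t y u \<omega> < b u" | "b u < Y t y u \<omega>" using off by linarith
  then show ?thesis
  proof cases
    case 1
    have "\<forall>\<^sub>F n in sequentially. 0 < bermudan (h n) (s n) (Y t y (s n) \<omega>)"
      using t u by (intro bermudan_pos_eventually[OF _ u(2) 1 h s(1) s_range(1) s(3) Y_lim]) simp
    then show ?thesis
      using step_fits by eventually_elim
        (use 1 \<omega> u in \<open>auto simp: grid_region_def continuation_event_def layer_event_def s_def[symmetric]\<close>)
  next
    case 2
    have "\<forall>n. s n \<in> {0..<T}" using s_range by auto
    then have "(\<lambda>n. b (s n)) \<longlonglongrightarrow> b u"
      using b_cont s(1) unfolding continuous_within_sequentially comp_def by blast
    then have "(\<lambda>n. Y t y (s n) \<omega> - (b (s n) + l n)) \<longlonglongrightarrow> Y t y u \<omega> - (b u + 0)"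
      by (intro tendsto_intros Y_lim l)
    then have "\<forall>\<^sub>F n in sequentially. 0 < Y t y (s n) \<omega> - (b (s n) + l n)"
      using 2 by (intro order_tendstoD(1)) auto
    then show ?thesis
    proof eventually_elim
      case (elim n)
      then have above: "\<not> Y t y (s n) \<omega> < b (s n) + l n" by simp
      then have "\<not> 0 < bermudan (h n) (s n) (Y t y (s n) \<omega>)"
        using bermudan_pos_imp_profitable[OF s_range(1)] boundary[OF s_range, of n] l(2)[of n] by force
      then show ?case
        using 2 above by (auto simp: grid_region_def continuation_event_def layer_event_def s_def[symmetric])
    qed
  qed
qed

lemma AE_time_space_off_boundary:
  assumes t: "0 \<le> t"
  shows "AE x in time_space. fst x \<in> {t<..<T} \<longrightarrow>
    continuous (at (fst x) within {0..<T}) b \<and> (Y t y (fst x) (snd x) \<noteq> b (fst x) \<or> path_reward t y x = 0)"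
proof -
  define D where "D = {u \<in> {0..<T}. \<not> continuous (at u within {0..<T}) b}"
  define b' where "b' u = indicator {0..<T} u * b u" for u
  have D: "countable D" unfolding D_def by (rule countable_boundary_discontinuities)
  then have [measurable]: "D \<in> sets borel" by (rule sets.countable[rotated]) simp
  have [measurable]: "b' \<in> borel_measurable borel" unfolding b'_def by (rule boundary_measurable)
  let ?P = "\<lambda>x. fst x \<in> {t<..<T} \<longrightarrow> fst x \<notin> D \<and> (Y t y (fst x) (snd x) \<noteq> b' (fst x) \<or> path_reward t y x = 0)"
  have meas: "{x \<in> space time_space. ?P x} \<in> sets time_space"
    unfolding path_reward_def reward_def by measurable
  have "AE u in lborel. u \<notin> D" using countable_imp_null_set_lborel[OF D] by (rule AE_not_in)
  then have "AE u in lborel. AE \<omega> in N. ?P (u, \<omega>)"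
    using AE_off_boundary[OF t, of y]
  proof eventually_elim
    case (elim u)
    show ?case
    proof (cases "u \<in> {t<..<T}")
      case True
      then have "b' u = b u" using t by (simp add: b'_def)
      moreover have "AE \<omega> in N. Y t y u \<omega> \<noteq> b u \<or> reward u (Y t y u \<omega>) = 0" using elim True by simp
      ultimately show ?thesis
        using elim(1) by (simp add: path_reward_def)
    qed (auto intro!: AE_I2)
  qed
  then have "AE x in time_space. ?P x"
    by (rule time_space.AE_pair_measure[OF meas])
  then show ?thesis
    by eventually_elim (use t in \<open>auto simp: D_def b'_def\<close>)
qed

definition continuation_region :: "real \<Rightarrow> real \<Rightarrow> (real \<times> 'a) set" where
  "continuation_region t y = {(u, \<omega>). \<omega> \<in> space N \<and> t < u \<and> u < T \<and> Y t y u \<omega> < b u}"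

lemma sets_continuation_region:
  assumes "0 \<le> t"
  shows "continuation_region t y \<in> sets time_space"
proof -
  note [measurable] = boundary_measurable
  have "{x \<in> space time_space. t < fst x \<and> fst x < T \<and> Y t y (fst x) (snd x) < indicator {0..<T} (fst x) * b (fst x)} \<in> sets time_space"
    by measurable
  also have "{x \<in> space time_space. t < fst x \<and> fst x < T \<and> Y t y (fst x) (snd x) < indicator {0..<T} (fst x) * b (fst x)}
      = continuation_region t y"
    using assms by (auto simp: continuation_region_def space_pair_measure)
  finally show ?thesis .
qed

lemma continuation_region_subset: "continuation_region t y \<subseteq> {t..<T} \<times> space N"
  by (auto simp: continuation_region_def)

lemma grid_region_events_subset:
  assumes "0 < h"
  shows "grid_region h t (continuation_event h t y) \<subseteq> {t..<T} \<times> space N"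
    and "grid_region h t (layer_event h l t y) \<subseteq> {t..<T} \<times> space N"
  using assms by (intro grid_region_subset; auto simp: continuation_event_def layer_event_def)+

lemma AE_grid_regions_eventually:
  assumes t: "0 \<le> t" and h: "h \<longlonglongrightarrow> 0" "\<And>n. 0 < h n" and l: "l \<longlonglongrightarrow> 0" "\<And>n. 0 < l n"
  shows "AE x in time_space. \<forall>\<^sub>F n in sequentially.
    indicator (grid_region (h n) t (continuation_event (h n) t y)) x * path_reward t y x
      = indicator (continuation_region t y) x * path_reward t y x \<and>
    indicator (grid_region (h n) t (layer_event (h n) (l n) t y)) x * \<bar>path_reward t y x\<bar> = 0"
    (is "AE x in time_space. \<forall>\<^sub>F n in sequentially. ?P n x")
proof -
  have "{x \<in> space time_space. fst x \<noteq> t} \<in> sets time_space" by measurable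
  then have "AE x in time_space. fst x \<noteq> t"
    by (rule time_space.AE_pair_measure) (use AE_lborel_singleton[of t] in \<open>eventually_elim, simp\<close>)
  with AE_time_space_off_boundary[OF t, of y] AE_space show ?thesis
  proof eventually_elim
    case (elim x)
    obtain u \<omega> where x: "x = (u, \<omega>)" by (cases x)
    consider "path_reward t y x = 0" | "u \<notin> {t..<T}" | "u \<in> {t<..<T}" "Y t y u \<omega> \<noteq> b u" "continuous (at u within {0..<T}) b"
      using elim by (force simp: x)
    then show ?case
    proof cases
      case 2
      then have "?P n x" for n
        using grid_region_events_subset(1)[OF h(2)[of n], where t = t and y = y]
          grid_region_events_subset(2)[OF h(2)[of n], where t = t and y = y and l = "l n"]
        by (auto simp: x continuation_region_def indicator_def)
      then show ?thesis by simp
    next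
      case 3
      have "\<omega> \<in> space N" using elim by (simp add: x space_pair_measure)
      with mem_grid_region_eventually[OF t _ _ this 3(3,2) h l] 3(1) show ?thesis
        by (auto simp: x continuation_region_def indicator_def elim!: eventually_mono)
    qed simp
  qed
qed

lemma grid_region_integrals_tendsto:
  assumes t: "0 \<le> t" and h: "h \<longlonglongrightarrow> 0" "\<And>n. 0 < h n" and l: "l \<longlonglongrightarrow> 0" "\<And>n. 0 < l n"
  shows "(\<lambda>n. LINT x:grid_region (h n) t (continuation_event (h n) t y)|time_space. path_reward t y x)
      \<longlonglongrightarrow> (LINT x:continuation_region t y|time_space. path_reward t y x)"
    and "(\<lambda>n. LINT x:grid_region (h n) t (layer_event (h n) (l n) t y)|time_space. \<bar>path_reward t y x\<bar>) \<longlonglongrightarrow> 0"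
proof -
  let ?C = "\<lambda>n. grid_region (h n) t (continuation_event (h n) t y)"
  let ?A = "\<lambda>n. grid_region (h n) t (layer_event (h n) (l n) t y)"
  have events: "continuation_event (h n) t y v \<in> sets N" "layer_event (h n) (l n) t y v \<in> sets N" if "t \<le> v" "v + h n \<le> T" for n v
    using that h(2)[of n] by (intro sets_continuation_event sets_layer_event t; simp)+
  then have sets: "?C n \<in> sets time_space" "?A n \<in> sets time_space" for n
    using h(2) by (intro sets_grid_region; blast)+
  note sub = grid_region_events_subset[OF h(2)]
  note lim = AE_grid_regions_eventually[OF t h l, of y]
  have int: "set_integrable time_space ({t..<T} \<times> space N) (path_reward t y)"
    using t by (intro path_reward_integrable) auto
  show "(\<lambda>n. LINT x:?C n|time_space. path_reward t y x) \<longlonglongrightarrow> (LINT x:continuation_region t y|time_space. path_reward t y x)"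
    by (rule set_integral_tendsto_of_eventually_eq[OF int sets(1) sub(1) sets_continuation_region[OF t] continuation_region_subset])
      (use lim in \<open>eventually_elim, elim eventually_mono conjunct1\<close>)
  have "(\<lambda>n. LINT x:?A n|time_space. \<bar>path_reward t y x\<bar>) \<longlonglongrightarrow> (LINT x:{}|time_space. \<bar>path_reward t y x\<bar>)"
    by (rule set_integral_tendsto_of_eventually_eq[OF set_integrable_abs[OF int] sets(2) sub(2)])
      (use lim in \<open>simp, simp, eventually_elim, elim eventually_mono, simp\<close>)
  then show "(\<lambda>n. LINT x:?A n|time_space. \<bar>path_reward t y x\<bar>) \<longlonglongrightarrow> 0"
    by (simp add: set_lebesgue_integral_def)
qed

lemma grid_region_gain_bounds_at_boundary:
  assumes t: "0 \<le> t" "t < T" and h: "0 < h" and l: "0 < l" "(L + \<nu>\<^sup>2 / 2) * h \<le> l / 2"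
  shows "0 \<le> (LINT x:grid_region h t (continuation_event h t (b t))|time_space. path_reward t (b t) x)"
    and "(LINT x:grid_region h t (continuation_event h t (b t))|time_space. path_reward t (b t) x)
      \<le> (LINT x:grid_region h t (layer_event h l t (b t))|time_space. \<bar>path_reward t (b t) x\<bar>)
        + (T - t) * (h * reentry_const / l ^ 4)"
proof -
  have "\<not> 0 < bermudan h t (b t)"
    using bermudan_pos_imp_profitable[OF t(1)] not_profitable_boundary[OF t] by blast
  then have "bermudan h t (b t) = 0" using bermudan_nonneg[of h t "b t"] by simp
  then show "0 \<le> (LINT x:grid_region h t (continuation_event h t (b t))|time_space. path_reward t (b t) x)"
    "(LINT x:grid_region h t (continuation_event h t (b t))|time_space. path_reward t (b t) x)
      \<le> (LINT x:grid_region h t (layer_event h l t (b t))|time_space. \<bar>path_reward t (b t) x\<bar>)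
        + (T - t) * (h * reentry_const / l ^ 4)"
    using grid_region_gain_bounds[OF t(1) h l order_refl, of "b t"] t(2) by simp_all
qed

theorem boundary_integral_equation:
  assumes t: "0 \<le> t" "t < T"
  shows "(LINT x:continuation_region t (b t)|time_space. path_reward t (b t) x) = 0"
proof -
  define y where "y = b t"
  define h where "h n = 1 / real (Suc n)" for n
  define l where "l n = root 8 (h n)" for n \<comment> \<open>any root of degree above 4 makes \<open>h / l ^ 4\<close> vanish\<close>
  have h: "h \<longlonglongrightarrow> 0" "\<And>n. 0 < h n"
    unfolding h_def using LIMSEQ_Suc[OF lim_const_over_n[of 1]] by simp_all
  have l: "l \<longlonglongrightarrow> 0" "\<And>n. 0 < l n"
    unfolding l_def using tendsto_real_root[OF h(1), of 8] h(2) by simp_all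
  have l_pow_8: "l n ^ 8 = h n" for n
    using real_root_pow_pos2[of 8 "h n"] h(2)[of n] by (simp add: l_def)
  define gains where "gains n = (LINT x:grid_region (h n) t (continuation_event (h n) t y)|time_space. path_reward t y x)" for n
  define losses where "losses n = (LINT x:grid_region (h n) t (layer_event (h n) (l n) t y)|time_space. \<bar>path_reward t y x\<bar>)" for n
  note lims = grid_region_integrals_tendsto[OF t(1) h l, of y, folded gains_def losses_def]
  have "(\<lambda>n. (L + \<nu>\<^sup>2 / 2) * l n ^ 7) \<longlonglongrightarrow> (L + \<nu>\<^sup>2 / 2) * 0 ^ 7"
    by (intro tendsto_intros l)
  then have "\<forall>\<^sub>F n in sequentially. (L + \<nu>\<^sup>2 / 2) * l n ^ 7 < 1 / 2"
    by (intro order_tendstoD(2)) auto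
  then have bounds: "\<forall>\<^sub>F n in sequentially. 0 \<le> gains n \<and> gains n \<le> losses n + (T - t) * (l n ^ 4 * reentry_const)"
  proof eventually_elim
    case (elim n)
    have "(L + \<nu>\<^sup>2 / 2) * h n = (L + \<nu>\<^sup>2 / 2) * l n ^ 7 * l n"
      by (simp add: l_pow_8[symmetric] power_Suc2[symmetric] del: power_Suc)
    also have "\<dots> \<le> 1 / 2 * l n" using elim l(2)[of n] by (intro mult_right_mono) auto
    finally have small: "(L + \<nu>\<^sup>2 / 2) * h n \<le> l n / 2" by simp
    have "h n / l n ^ 4 = l n ^ 4"
      using l(2)[of n] power_diff[of "l n" 4 8] by (simp add: l_pow_8[symmetric])
    then have "h n * reentry_const / l n ^ 4 = l n ^ 4 * reentry_const"
      by (simp only: times_divide_eq_left[symmetric])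
    then show ?case
      using grid_region_gain_bounds_at_boundary[OF t h(2) l(2) small] by (simp add: gains_def losses_def y_def)
  qed
  have "(\<lambda>n. losses n + (T - t) * (l n ^ 4 * reentry_const)) \<longlonglongrightarrow> 0 + (T - t) * (0 ^ 4 * reentry_const)"
    by (intro tendsto_intros lims(2) l(1))
  from tendsto_le[OF _ this lims(1)] bounds
  have "(LINT x:continuation_region t y|time_space. path_reward t y x) \<le> 0"
    by (simp add: eventually_mono)
  moreover have "0 \<le> (LINT x:continuation_region t y|time_space. path_reward t y x)"
    using bounds by (intro tendsto_lowerbound[OF lims(1)]) (auto elim: eventually_mono)
  ultimately show ?thesis by (simp add: y_def)
qed

end


section \<open>Power utilities\<close>

lemma power_utility_le_tangent:
  assumes "0 < \<gamma>" "\<gamma> \<noteq> 1" "0 < (x::real)"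
  shows "x powr (1 - \<gamma>) / (1 - \<gamma>) - x \<le> \<gamma> / (1 - \<gamma>)"
proof (cases "\<gamma> < 1")
  case True
  have "1 powr \<gamma> * x powr (1 - \<gamma>) \<le> \<gamma> * 1 + (1 - \<gamma>) * x"
    using True assms by (intro Youngs_inequality_0) auto
  then have "x powr (1 - \<gamma>) / (1 - \<gamma>) \<le> (\<gamma> + (1 - \<gamma>) * x) / (1 - \<gamma>)"
    using True by (intro divide_right_mono) auto
  then show ?thesis using True by (simp add: add_divide_distrib)
next
  case False
  then have \<gamma>: "1 < \<gamma>" using assms by simp
  have "x powr (1 - 1 / \<gamma>) * (x powr (1 - \<gamma>)) powr (1 / \<gamma>) \<le> (1 - 1 / \<gamma>) * x + 1 / \<gamma> * x powr (1 - \<gamma>)"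
    using \<gamma> assms by (intro Youngs_inequality_0) auto
  moreover have "x powr (1 - 1 / \<gamma>) * (x powr (1 - \<gamma>)) powr (1 / \<gamma>) = x powr 0"
    unfolding powr_powr powr_add[symmetric] using \<gamma> by (intro arg_cong2[of _ _ _ _ "(powr)"]) (simp_all add: field_simps)
  ultimately have "\<gamma> * 1 \<le> \<gamma> * ((1 - 1 / \<gamma>) * x + 1 / \<gamma> * x powr (1 - \<gamma>))"
    using \<gamma> assms by (intro mult_left_mono) auto
  then have "\<gamma> + (1 - \<gamma>) * x \<le> x powr (1 - \<gamma>)" using \<gamma> by (simp add: algebra_simps)
  then have "x powr (1 - \<gamma>) / (1 - \<gamma>) \<le> (\<gamma> + (1 - \<gamma>) * x) / (1 - \<gamma>)"
    using \<gamma> by (intro divide_right_mono_neg) auto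
  then show ?thesis using \<gamma> by (simp add: add_divide_distrib)
qed

lemma power_utility_conjugate:
  assumes \<gamma>: "0 < \<gamma>" "\<gamma> \<noteq> 1" and k: "0 < k" and p: "0 < p"
  shows "(SUP c\<in>{0<..}. k * c powr (1 - \<gamma>) / (1 - \<gamma>) - p * c) = k powr (1 / \<gamma>) * p powr (- gtilde \<gamma>) / gtilde \<gamma>"
proof -
  define c0 where "c0 = (k / p) powr (1 / \<gamma>)"
  have c0: "0 < c0" and ln_c0: "ln c0 = (ln k - ln p) / \<gamma>" using k p by (simp_all add: c0_def ln_powr ln_div)
  have "ln k + (1 - \<gamma>) * ln c0 = ln p + ln c0"
    using \<gamma> by (simp add: ln_c0 field_simps)
  then have "exp (ln k) * exp ((1 - \<gamma>) * ln c0) = exp (ln p) * exp (ln c0)"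
    unfolding exp_add[symmetric] by simp
  then have first_order: "k * c0 powr (1 - \<gamma>) = p * c0" using k p c0 by (simp add: powr_def)
  have "1 / \<gamma> * ln k + - gtilde \<gamma> * ln p = ln p + ln c0"
    using \<gamma> by (simp add: ln_c0 gtilde_def field_simps)
  then have "exp (1 / \<gamma> * ln k) * exp (- gtilde \<gamma> * ln p) = exp (ln p) * exp (ln c0)"
    unfolding exp_add[symmetric] by simp
  then have conjugate: "k powr (1 / \<gamma>) * p powr (- gtilde \<gamma>) = p * c0" using k p c0 by (simp add: powr_def)
  show ?thesis unfolding conjugate
  proof (rule cSup_eq_maximum)
    have "p * c0 / gtilde \<gamma> = k * c0 powr (1 - \<gamma>) / (1 - \<gamma>) - p * c0"
      unfolding first_order using \<gamma> by (simp add: gtilde_def field_simps)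
    then show "p * c0 / gtilde \<gamma> \<in> (\<lambda>c. k * c powr (1 - \<gamma>) / (1 - \<gamma>) - p * c) ` {0<..}"
      using c0 by auto
    fix w assume "w \<in> (\<lambda>c. k * c powr (1 - \<gamma>) / (1 - \<gamma>) - p * c) ` {0<..}"
    then obtain c where c: "0 < c" "w = k * c powr (1 - \<gamma>) / (1 - \<gamma>) - p * c" by auto
    define x where "x = c / c0"
    have x: "0 < x" "c = c0 * x" using c c0 by (auto simp: x_def)
    have "k * c powr (1 - \<gamma>) = (p * c0) * x powr (1 - \<gamma>)"
      unfolding x(2) first_order[symmetric] using c0 x(1) by (simp add: powr_mult)
    then have "w = (p * c0) * (x powr (1 - \<gamma>) / (1 - \<gamma>) - x)"
      unfolding c(2) using x(2) by (simp add: right_diff_distrib)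
    also have "\<dots> \<le> (p * c0) * (\<gamma> / (1 - \<gamma>))"
      using p c0 power_utility_le_tangent[OF \<gamma> x(1)] by (intro mult_left_mono) auto
    finally show "w \<le> p * c0 / gtilde \<gamma>" by (simp add: gtilde_def)
  qed
qed


section \<open>Continuously differentiable coefficients\<close>

text \<open>Unlike \<open>C1_differentiable_on\<close>, this allows one-sided derivatives at the end points of an interval.\<close>

definition C1_on :: "real set \<Rightarrow> (real \<Rightarrow> real) \<Rightarrow> bool" where
  "C1_on S f \<longleftrightarrow> (\<exists>f'. (\<forall>x\<in>S. (f has_real_derivative f' x) (at x within S)) \<and> continuous_on S f')"

lemma C1_onI:
  assumes "\<And>x. x \<in> S \<Longrightarrow> (f has_real_derivative f' x) (at x within S)" "continuous_on S f'"
  shows "C1_on S f"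
  using assms by (auto simp: C1_on_def)

lemma C1_onE:
  assumes "C1_on S f"
  obtains f' where "\<And>x. x \<in> S \<Longrightarrow> (f has_real_derivative f' x) (at x within S)" "continuous_on S f'"
  using assms by (auto simp: C1_on_def)

lemma C1_on_imp_continuous_on: "C1_on S f \<Longrightarrow> continuous_on S f"
  by (meson C1_onE DERIV_continuous_on)

lemma C1_on_subset: "C1_on S f \<Longrightarrow> R \<subseteq> S \<Longrightarrow> C1_on R f"
  unfolding C1_on_def by (meson DERIV_subset continuous_on_subset subsetD)

lemma C1_on_cong:
  assumes "C1_on S f" "\<And>x. x \<in> S \<Longrightarrow> f x = g x"
  shows "C1_on S g"
proof -
  obtain f' where f': "\<And>x. x \<in> S \<Longrightarrow> (f has_real_derivative f' x) (at x within S)" "continuous_on S f'"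
    using assms(1) C1_onE by blast
  show ?thesis
    using has_field_derivative_transform_within[OF f'(1) zero_less_one] f'(2) assms(2) by (intro C1_onI) auto
qed

lemma C1_on_const: "C1_on S (\<lambda>_. c)"
  by (rule C1_onI[where f' = "\<lambda>_. 0"]) auto

lemma C1_on_diff:
  assumes "C1_on S f" "C1_on S g"
  shows "C1_on S (\<lambda>x. f x - g x)"
proof -
  obtain f' where "\<And>x. x \<in> S \<Longrightarrow> (f has_real_derivative f' x) (at x within S)" "continuous_on S f'"
    using assms(1) C1_onE by blast
  moreover obtain g' where "\<And>x. x \<in> S \<Longrightarrow> (g has_real_derivative g' x) (at x within S)" "continuous_on S g'"
    using assms(2) C1_onE by blast
  ultimately show ?thesis
    by (intro C1_onI[where f' = "\<lambda>x. f' x - g' x"] DERIV_diff continuous_intros)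
qed

lemma C1_on_mult:
  assumes "C1_on S f" "C1_on S g"
  shows "C1_on S (\<lambda>x. f x * g x)"
proof -
  obtain f' where "\<And>x. x \<in> S \<Longrightarrow> (f has_real_derivative f' x) (at x within S)" "continuous_on S f'"
    using assms(1) C1_onE by blast
  moreover obtain g' where "\<And>x. x \<in> S \<Longrightarrow> (g has_real_derivative g' x) (at x within S)" "continuous_on S g'"
    using assms(2) C1_onE by blast
  ultimately show ?thesis
    using C1_on_imp_continuous_on[OF assms(1)] C1_on_imp_continuous_on[OF assms(2)]
    by (intro C1_onI[where f' = "\<lambda>x. f' x * g x + g' x * f x"] DERIV_mult continuous_intros)
qed

lemma C1_on_exp_linear: "C1_on S (\<lambda>x. exp (c * x))"
  by (rule C1_onI[where f' = "\<lambda>x. exp (c * x) * c"]) (auto intro!: derivative_eq_intros continuous_intros)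

lemma C1_on_ln:
  assumes "C1_on S f" "\<And>x. x \<in> S \<Longrightarrow> 0 < f x"
  shows "C1_on S (\<lambda>x. ln (f x))"
proof -
  obtain f' where f': "\<And>x. x \<in> S \<Longrightarrow> (f has_real_derivative f' x) (at x within S)" "continuous_on S f'"
    using assms(1) C1_onE by blast
  show ?thesis
  proof (rule C1_onI)
    show "((\<lambda>x. ln (f x)) has_real_derivative 1 / f x * f' x) (at x within S)" if "x \<in> S" for x
      using assms(2)[OF that] f'(1)[OF that] by (rule DERIV_chain'[OF _ DERIV_ln_divide, rotated])
    show "continuous_on S (\<lambda>x. 1 / f x * f' x)"
      using assms(2) by (intro continuous_intros f'(2) C1_on_imp_continuous_on[OF assms(1)]) (auto simp: less_imp_neq[symmetric])
  qed
qed

lemma C1_on_powr: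
  assumes "C1_on S f" "\<And>x. x \<in> S \<Longrightarrow> 0 < f x"
  shows "C1_on S (\<lambda>x. f x powr c)"
proof -
  obtain g' where g': "\<And>x. x \<in> S \<Longrightarrow> ((\<lambda>x. ln (f x)) has_real_derivative g' x) (at x within S)" "continuous_on S g'"
    using C1_on_ln[OF assms] C1_onE by blast
  have "C1_on S (\<lambda>x. exp (c * ln (f x)))"
  proof (rule C1_onI)
    show "((\<lambda>x. exp (c * ln (f x))) has_real_derivative exp (c * ln (f x)) * (c * g' x)) (at x within S)" if "x \<in> S" for x
      by (intro DERIV_chain'[OF _ DERIV_exp] DERIV_cmult g' that)
    show "continuous_on S (\<lambda>x. exp (c * ln (f x)) * (c * g' x))"
      by (intro continuous_intros g'(2) C1_on_imp_continuous_on[OF C1_on_ln[OF assms]])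
  qed
  moreover have "exp (c * ln (f x)) = f x powr c" if "x \<in> S" for x
    using assms(2)[OF that] by (simp add: powr_def)
  ultimately show ?thesis by (rule C1_on_cong)
qed

lemma smooth_on_imp_C1_on:
  assumes "smooth_on S f"
  shows "C1_on S f"
proof -
  from assms obtain D where D: "\<And>x. x \<in> S \<Longrightarrow> D 0 x = f x"
    "\<And>n x. x \<in> S \<Longrightarrow> (D n has_real_derivative D (Suc n) x) (at x within S)"
    unfolding smooth_on_def by blast
  have "C1_on S (D 0)"
  proof (rule C1_onI)
    show "(D 0 has_real_derivative D (Suc 0) x) (at x within S)" if "x \<in> S" for x using that by (rule D(2))
    show "continuous_on S (D (Suc 0))" using D(2) by (rule DERIV_continuous_on)
  qed
  then show ?thesis using D(1) by (rule C1_on_cong)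
qed

lemma clamp_in_Icc: "a \<le> b \<Longrightarrow> clamp a b u \<in> {a..b::real}"
  using clamp_in_interval[of a b u] by simp

lemma C1_on_clamp_growth:
  assumes f: "C1_on {a..b} f" "\<And>x. x \<in> {a..b} \<Longrightarrow> 0 < f x" and ab: "a \<le> b"
  obtains L where "\<And>v w. v \<le> w \<Longrightarrow> f (clamp a b v) \<le> exp (L * (w - v)) * f (clamp a b w)"
proof -
  obtain g' where g': "\<And>x. x \<in> {a..b} \<Longrightarrow> ((\<lambda>x. ln (f x)) has_real_derivative g' x) (at x within {a..b})" "continuous_on {a..b} g'"
    using C1_on_ln[OF f] C1_onE by blast
  obtain L where "\<forall>x\<in>{a..b}. \<bar>g' x\<bar> \<le> L"
    using compact_imp_bounded[OF compact_continuous_image[OF g'(2)]] by (auto simp: bounded_iff)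
  then have L: "\<bar>g' x\<bar> \<le> L" if "x \<in> {a..b}" for x using that by blast
  have L_nonneg: "0 \<le> L" using L[of a] ab by force
  show thesis
  proof (rule that)
    fix v w :: real assume vw: "v \<le> w"
    define v' w' where "v' = clamp a b v" and "w' = clamp a b w"
    have in_ab: "v' \<in> {a..b}" "w' \<in> {a..b}" using ab by (simp_all add: v'_def w'_def clamp_in_Icc del: atLeastAtMost_iff)
    have "\<bar>ln (f v') - ln (f w')\<bar> \<le> L * \<bar>v' - w'\<bar>"
      using field_differentiable_bound[of "{a..b}" "\<lambda>x. ln (f x)" g' L v' w'] g'(1) L in_ab by simp
    also have "\<dots> \<le> L * (w - v)"
      using L_nonneg vw dist_clamps_le_dist_args[of a b v w] by (intro mult_left_mono) (auto simp: dist_real_def v'_def w'_def)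
    finally have "exp (ln (f v')) \<le> exp (L * (w - v) + ln (f w'))" by simp
    then show "f v' \<le> exp (L * (w - v)) * f w'" using f(2) in_ab by (simp add: exp_add)
  qed
qed

lemma pT_antiderivative:
  obtains G where "\<And>u. (G has_real_derivative exp ((\<alpha> - \<beta> - r) * u)) (at u)"
    "pT \<alpha> \<beta> r T = (\<lambda>s. exp (- (\<alpha> - \<beta> - r) * s) * (G T - G s))"
proof -
  define k where "k = \<alpha> - \<beta> - r"
  obtain G where "\<forall>u::real. (G has_vector_derivative exp (k * u)) (at u)"
    using einterval_antiderivative[of "-\<infinity>" \<infinity> "\<lambda>u. exp (k * u)"] by auto
  then have G: "(G has_real_derivative exp (k * u)) (at u)" for u
    by (simp add: has_real_derivative_iff_has_vector_derivative)
  have "pT \<alpha> \<beta> r T s = exp (- k * s) * G T - exp (- k * s) * G s" for s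
    unfolding pT_def k_def[symmetric]
  proof (rule interval_integral_FTC_finite)
    show "((\<lambda>u. exp (- k * s) * G u) has_vector_derivative exp (k * (u - s))) (at u within {min s T..max s T})" for u
      using DERIV_cmult[OF has_field_derivative_at_within[OF G], of "exp (- k * s)" u]
      by (simp add: has_real_derivative_iff_has_vector_derivative exp_add[symmetric] algebra_simps)
  qed (intro continuous_intros)
  then show thesis using G that[of G] by (simp add: k_def fun_eq_iff right_diff_distrib)
qed

lemma C1_on_pT: "C1_on S (pT \<alpha> \<beta> r T)"
proof -
  obtain G where G: "\<And>u. (G has_real_derivative exp ((\<alpha> - \<beta> - r) * u)) (at u)"
    and pT: "pT \<alpha> \<beta> r T = (\<lambda>s. exp (- (\<alpha> - \<beta> - r) * s) * (G T - G s))"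
    using pT_antiderivative by blast
  have "C1_on S G"
    by (rule C1_onI[OF has_field_derivative_at_within[OF G]]) (intro continuous_intros)
  then show ?thesis
    unfolding pT by (intro C1_on_mult C1_on_diff C1_on_const C1_on_exp_linear)
qed

lemma pT_nonneg:
  assumes "s \<le> T"
  shows "0 \<le> pT \<alpha> \<beta> r T s"
proof -
  have "pT \<alpha> \<beta> r T s = (LBINT u:{s..T}. exp ((\<alpha> - \<beta> - r) * (u - s)))"
    unfolding pT_def using assms by (intro interval_integral_Icc) simp
  then show ?thesis by (simp add: set_lebesgue_integral_def)
qed

lemma muT_pos: "0 < \<alpha> \<Longrightarrow> s \<le> T \<Longrightarrow> 0 < muT \<alpha> \<beta> r T s"
  using pT_nonneg[of s T \<alpha> \<beta> r] by (simp add: muT_def add_pos_nonneg)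

lemma C1_on_muT: "C1_on S (muT \<alpha> \<beta> r T)"
proof -
  have "C1_on S (\<lambda>s. 1 - (- \<alpha>) * pT \<alpha> \<beta> r T s)"
    by (intro C1_on_diff C1_on_mult C1_on_const C1_on_pT)
  then show ?thesis by (simp add: muT_def[abs_def])
qed

lemma LBINT_exp_linear:
  fixes k a b :: real
  assumes "k \<noteq> 0" "a \<le> b"
  shows "(LBINT u:{a..<b}. exp (k * u)) = (exp (k * b) - exp (k * a)) / k"
proof -
  have "(LBINT u=a..b. exp (k * u)) = exp (k * b) / k - exp (k * a) / k"
    using assms
    by (intro interval_integral_FTC_finite)
      (auto intro!: continuous_intros derivative_eq_intros simp: has_real_derivative_iff_has_vector_derivative[symmetric])
  then show ?thesis using interval_integral_Ico[of a b "\<lambda>u. exp (k * u)"] assms(2) by (simp add: diff_divide_distrib)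
qed


section \<open>The retirement problem\<close>

text \<open>The path is frozen outside \<open>[0, T]\<close> because \<open>brownian_on\<close> asks for continuity on the whole line.\<close>

lemma brownian_motion_imp_brownian_on:
  assumes "prob_space M" "usual_filtration M F" "brownian_motion M F B" "0 \<le> T"
  shows "brownian_on M F (\<lambda>u \<omega>. B (clamp 0 T u) \<omega>) T"
proof -
  interpret prob_space M by fact
  have F: "filtration (space M) F" "\<And>u. sets (F u) \<subseteq> sets M"
    using assms(2) unfolding usual_filtration_def by blast+
  have B_cont: "\<And>\<omega>. \<omega> \<in> space M \<Longrightarrow> continuous_on {0..} (\<lambda>t. B t \<omega>)"
    and B_adapted: "\<And>t. 0 \<le> t \<Longrightarrow> B t \<in> borel_measurable (F t)"
    and B_indep: "\<And>s t. 0 \<le> s \<Longrightarrow> s < t \<Longrightarrow> indep_set (sets (F s)) {(\<lambda>\<omega>. B t \<omega> - B s \<omega>) -` A \<inter> space M |A. A \<in> sets borel}"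
    and B_normal: "\<And>s t. 0 \<le> s \<Longrightarrow> s < t \<Longrightarrow>
      distributed M lborel (\<lambda>\<omega>. B t \<omega> - B s \<omega>) (\<lambda>x. ennreal (normal_density 0 (sqrt (t - s)) x))"
    using assms(3) unfolding brownian_motion_def by blast+
  have B_meas: "B u \<in> borel_measurable M" if "0 \<le> u" for u
    using B_adapted[OF that] F(2)[of u] F(1) by (auto simp: measurable_def filtration_def)
  have clamp_nonneg: "0 \<le> clamp 0 T u" for u using clamp_in_Icc[OF assms(4)] by simp
  show ?thesis
  proof (intro brownian_on.intro brownian_on_axioms.intro)
    show "prob_space M" "filtration (space M) F" "\<And>u. sets (F u) \<subseteq> sets M" by fact+
    show "continuous_on UNIV (\<lambda>u. B (clamp 0 T u) \<omega>)" if "\<omega> \<in> space M" for \<omega>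
      by (rule clamp_continuous_on) (auto intro: continuous_on_subset[OF B_cont[OF that]])
    show "(\<lambda>\<omega>. B (clamp 0 T u) \<omega>) \<in> borel_measurable (F u)" if "0 \<le> u" "u \<le> T" for u
      using B_adapted[OF that(1)] that by simp
    show "(\<lambda>\<omega>. B (clamp 0 T u) \<omega>) \<in> borel_measurable M" for u
      by (rule B_meas[OF clamp_nonneg])
    fix s u A C assume su: "0 \<le> s" "s < u" "u \<le> T" and A: "A \<in> sets (F s)" and C: "C \<in> sets (borel :: real measure)"
    define D where "D = (\<lambda>\<omega>. B u \<omega> - B s \<omega>) -` C \<inter> space M"
    have "prob (A \<inter> D) = prob A * prob D"
      using indep_setD[OF B_indep[OF su(1,2)] A, of D] C by (auto simp: D_def)
    then have "emeasure M (A \<inter> D) = emeasure M A * emeasure M D"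
      by (simp add: emeasure_eq_measure ennreal_mult[symmetric])
    moreover have "emeasure M D = emeasure (gaussian (u - s)) C"
      unfolding gaussian_def distributed_distr_eq_density[OF B_normal[OF su(1,2)], symmetric] D_def
      using C B_meas[of u] B_meas[of s] su by (subst emeasure_distr) auto
    moreover have "A \<inter> {\<omega> \<in> space M. B u \<omega> - B s \<omega> \<in> C} = A \<inter> D" by (auto simp: D_def)
    ultimately show "emeasure M (A \<inter> {\<omega> \<in> space M. B (clamp 0 T u) \<omega> - B (clamp 0 T s) \<omega> \<in> C}) = emeasure M A * emeasure (gaussian (u - s)) C"
      using su by simp
  qed
qed

locale power_market =
  fixes M :: "'a measure" and F :: "real \<Rightarrow> 'a measure" and B :: "real \<Rightarrow> 'a \<Rightarrow> real"
    and T1 T r \<kappa> \<rho> \<mu>w \<sigma>w \<alpha> \<beta> \<gamma> :: real and K :: "real \<Rightarrow> real"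
  assumes prob: "prob_space M" and usual: "usual_filtration M F" and brownian: "brownian_motion M F B"
    and T1: "0 < T1" "T1 < T" and alpha: "0 < \<alpha>" and gamma: "0 < \<gamma>" "\<gamma> \<noteq> 1"
    and K_smooth: "smooth_on {0..T} K" and K_pos: "t \<in> {0..T} \<Longrightarrow> 0 < K t"
    and Delta_neg: "t \<in> {0..T1} \<Longrightarrow> Delta \<gamma> K t < 0"
    and theta_nonzero: "theta r \<mu>w \<kappa> \<sigma>w \<noteq> 0"
begin

abbreviation gt :: real where "gt \<equiv> gtilde \<gamma>"
abbreviation th :: real where "th \<equiv> theta r \<mu>w \<kappa> \<sigma>w"
abbreviation mu :: "real \<Rightarrow> real" where "mu \<equiv> muT \<alpha> \<beta> r T"
abbreviation Z :: "real \<Rightarrow> real \<Rightarrow> real \<Rightarrow> 'a \<Rightarrow> real" where "Z \<equiv> Zproc \<gamma> \<rho> \<kappa> r \<mu>w \<sigma>w B"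
abbreviation V :: "real \<Rightarrow> real \<Rightarrow> real" where "V \<equiv> Vtilde M B \<gamma> K \<alpha> \<beta> r T \<rho> \<kappa>"

subsection \<open>Logarithmic coordinates\<close>

text \<open>With \<open>y = log_level t z\<close>, the process \<open>log_level u (Z t z u)\<close> becomes a log-martingale under the
  changed measure, which is what determines \<open>volatility\<close> and \<open>level_drift\<close>.\<close>

definition girsanov_drift :: real where
  "girsanov_drift = \<sigma>w - \<kappa>"

definition volatility :: real where
  "volatility = \<kappa> / \<gamma> - \<sigma>w"

definition level_drift :: real where
  "level_drift = volatility * girsanov_drift + volatility\<^sup>2 / 2 - (\<rho> - \<kappa>\<^sup>2 / 2 - r) / \<gamma> - \<mu>w + \<sigma>w\<^sup>2 / 2"

definition log_level :: "real \<Rightarrow> real \<Rightarrow> real" where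
  "log_level t z = - gt * ln z - level_drift * t"

definition reward_coeff :: "real \<Rightarrow> real" where
  "reward_coeff u = - Delta \<gamma> K u * mu u powr (- gt) * exp (level_drift * u)"

definition growth_rate :: real where
  "growth_rate = (SOME L. \<forall>v w. v \<le> w \<longrightarrow> reward_coeff (clamp 0 T1 v) \<le> exp (L * (w - v)) * reward_coeff (clamp 0 T1 w))"

definition Vhat2_coeff :: "real \<Rightarrow> real" where
  "Vhat2_coeff u = K u powr (1 / \<gamma>) * mu u powr (- gt) / gt"

lemma gt_nonzero: "gt \<noteq> 0"
  using gamma by (simp add: gtilde_def)

lemma gt_pos_iff: "0 < gt \<longleftrightarrow> \<gamma> < 1"
  using gamma by (simp add: gtilde_def zero_less_divide_iff)

lemma mu_pos: "s \<le> T \<Longrightarrow> 0 < mu s"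
  using alpha by (rule muT_pos)

lemma C1_on_K: "C1_on {0..T} K"
  using K_smooth by (rule smooth_on_imp_C1_on)

lemma continuous_on_Vhat2_coeff_clamp: "continuous_on UNIV (\<lambda>u. Vhat2_coeff (clamp 0 T u))"
proof -
  have "continuous_on {0..T} Vhat2_coeff"
    unfolding Vhat2_coeff_def using K_pos mu_pos gt_nonzero
    by (intro continuous_intros C1_on_imp_continuous_on C1_on_K C1_on_muT) (auto simp: less_imp_neq[symmetric])
  then show ?thesis by (intro clamp_continuous_on) simp
qed

lemma reward_coeff_pos: "u \<in> {0..T1} \<Longrightarrow> 0 < reward_coeff u"
  unfolding reward_coeff_def using Delta_neg[of u] mu_pos[of u] T1 by (intro mult_pos_pos) auto

lemma C1_on_reward_coeff: "C1_on {0..T1} reward_coeff"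
proof -
  have sub: "{0..T1} \<subseteq> {0..T}" using T1 by auto
  then have "C1_on {0..T1} (\<lambda>u. ((- 1 / gt) * (1 - K u powr (1 / \<gamma>))) * mu u powr (- gt) * exp (level_drift * u))"
    using K_pos mu_pos T1
    by (intro C1_on_mult C1_on_diff C1_on_const C1_on_powr C1_on_exp_linear C1_on_muT C1_on_subset[OF C1_on_K]) auto
  then show ?thesis by (rule C1_on_cong) (simp add: reward_coeff_def Delta_def)
qed

lemma growth_rate:
  assumes "v \<le> w"
  shows "reward_coeff (clamp 0 T1 v) \<le> exp (growth_rate * (w - v)) * reward_coeff (clamp 0 T1 w)"
proof -
  have "\<exists>L. \<forall>v w. v \<le> w \<longrightarrow> reward_coeff (clamp 0 T1 v) \<le> exp (L * (w - v)) * reward_coeff (clamp 0 T1 w)"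
    using C1_on_clamp_growth[OF C1_on_reward_coeff reward_coeff_pos less_imp_le[OF T1(1)]] by blast
  from someI_ex[OF this] show ?thesis unfolding growth_rate_def[symmetric] using assms by blast
qed

sublocale BM: brownian_on M F "\<lambda>u \<omega>. B (clamp 0 T1 u) \<omega>" T1
  using T1 by (intro brownian_motion_imp_brownian_on prob usual brownian) simp

abbreviation N :: "'a measure" where "N \<equiv> BM.tilted girsanov_drift"

sublocale SP: stopping_problem N F "\<lambda>u \<omega>. B (clamp 0 T1 u) \<omega> - girsanov_drift * u" T1
  volatility th growth_rate "\<lambda>u. reward_coeff (clamp 0 T1 u)"
proof (intro stopping_problem.intro log_martingale.intro stopping_problem_axioms.intro)
  show "brownian_on N F (\<lambda>u \<omega>. B (clamp 0 T1 u) \<omega> - girsanov_drift * u) T1"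
    using T1 by (intro BM.girsanov) simp
  show "continuous_on UNIV (\<lambda>u. reward_coeff (clamp 0 T1 u))"
    using C1_on_imp_continuous_on[OF C1_on_reward_coeff] by (intro clamp_continuous_on) simp
  show "0 < reward_coeff (clamp 0 T1 u)" for u
    using T1 by (intro reward_coeff_pos clamp_in_Icc) simp
qed (use T1 growth_rate in auto)

lemma Etilde_eq:
  assumes "has_bochner_integral N G v" and eq: "\<And>\<omega>. \<omega> \<in> space M \<Longrightarrow> X \<omega> = G \<omega>"
  shows "Etilde M \<sigma>w \<kappa> B T1 X = v"
proof -
  have G: "G \<in> borel_measurable M" using borel_measurable_has_bochner_integral[OF assms(1)] by simp
  have "Etilde M \<sigma>w \<kappa> B T1 X = (\<integral>\<omega>. BM.tilt girsanov_drift 0 T1 \<omega> *\<^sub>R G \<omega> \<partial>M)"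
    unfolding Etilde_def
  proof (intro Bochner_Integration.integral_cong refl)
    fix \<omega> assume \<omega>: "\<omega> \<in> space M"
    then have "B 0 \<omega> = 0" using brownian by (simp add: brownian_motion_def)
    then have "Ecal \<sigma>w \<kappa> B T1 \<omega> = BM.tilt girsanov_drift 0 T1 \<omega>"
      using T1 by (simp add: Ecal_def BM.tilt_def girsanov_drift_def)
    then show "Ecal \<sigma>w \<kappa> B T1 \<omega> * X \<omega> = BM.tilt girsanov_drift 0 T1 \<omega> *\<^sub>R G \<omega>" using eq[OF \<omega>] by simp
  qed
  also have "\<dots> = (\<integral>\<omega>. G \<omega> \<partial>N)"
    unfolding BM.tilted_def using G by (subst integral_density) (auto simp: BM.tilt_def intro: BM.tilt_measurable[unfolded BM.tilt_def])
  finally show ?thesis using assms(1) by (simp add: has_bochner_integral_iff)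
qed

lemma powr_log_level: "0 < z \<Longrightarrow> z powr (- gt) = exp (log_level t z + level_drift * t)"
  by (simp add: powr_def log_level_def)

lemma log_level_less_iff:
  assumes "0 < z" "0 < z'"
  shows "log_level s z < log_level s z' \<longleftrightarrow> (if \<gamma> < 1 then z' < z else z < z')"
proof (cases "\<gamma> < 1")
  case True
  then have "0 < gt" by (simp add: gt_pos_iff)
  then show ?thesis using assms True by (simp add: log_level_def)
next
  case False
  then have "gt < 0" using gt_pos_iff gt_nonzero by auto
  then show ?thesis using assms False by (simp add: log_level_def)
qed

lemma Yproc_eq_exp: "Yproc \<rho> \<kappa> r B t z u \<omega> = z * exp ((\<rho> - \<kappa>\<^sup>2 / 2 - r) * (u - t) - \<kappa> * (B u \<omega> - B t \<omega>))"
  unfolding Yproc_def xi_from_def xi_def exp_diff[symmetric] mult.assoc exp_add[symmetric]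
  by (simp add: field_simps)

lemma Z_pos: "0 < z \<Longrightarrow> 0 < Z t z u \<omega>"
  by (simp add: Zproc_def Yproc_eq_exp Wproc_def)

lemma log_level_Z:
  assumes t: "0 \<le> t" "t \<le> u" "u \<le> T1" and z: "0 < z"
  shows "log_level u (Z t z u \<omega>) = SP.Y t (log_level t z) u \<omega>"
proof -
  define e1 where "e1 = (\<rho> - \<kappa>\<^sup>2 / 2 - r) * (u - t) - \<kappa> * (B u \<omega> - B t \<omega>)"
  define e2 where "e2 = (\<mu>w - \<sigma>w\<^sup>2 / 2) * (u - t) + \<sigma>w * (B u \<omega> - B t \<omega>)"
  define i where "i = 1 / \<gamma>"
  have "ln (Z t z u \<omega>) = ln z + 1 / (1 - \<gamma>) * e1 + \<gamma> / (1 - \<gamma>) * e2"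
    using z by (simp add: Zproc_def Yproc_eq_exp Wproc_def e1_def e2_def ln_mult powr_def)
  moreover have "gt * (1 / (1 - \<gamma>)) = i" "gt * (\<gamma> / (1 - \<gamma>)) = 1"
    using gamma by (simp_all add: gtilde_def i_def)
  ultimately have "gt * ln (Z t z u \<omega>) = gt * ln z + i * e1 + e2"
    by (simp only: distrib_left mult.assoc[symmetric] mult_1)
  moreover have "x / \<gamma> = x * i" for x by (simp add: i_def)
  ultimately show ?thesis
    using t unfolding SP.Y_def unfolding log_level_def e1_def e2_def level_drift_def volatility_def girsanov_drift_def
    by (simp add: power2_eq_square field_simps)
qed

lemma reward_eq:
  assumes "0 \<le> u" "u \<le> T1" "0 < z"
  shows "exp (th * u) * (1 + Delta \<gamma> K u * (mu u * z) powr (- gt)) = SP.reward u (log_level u z)"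
  unfolding SP.reward_def
  using assms mu_pos[of u] T1 powr_log_level[OF assms(3), of u]
  by (simp add: reward_coeff_def powr_mult exp_add)


subsection \<open>Conjugate utilities and the value after retirement\<close>

lemma Vhat1_eq:
  assumes "u \<le> T" "0 < z"
  shows "Vhat (U1 \<gamma>) mu u z = (z * mu u) powr (- gt) / gt"
  using power_utility_conjugate[OF gamma, of 1 "z * mu u"] mu_pos[OF assms(1)] assms(2) by (simp add: Vhat_def U1_def)

lemma Vhat2_eq:
  assumes "0 \<le> u" "u \<le> T" "0 < z"
  shows "Vhat (U2 \<gamma> K) mu u z = Vhat2_coeff u * z powr (- gt)"
  using power_utility_conjugate[OF gamma, of "K u" "z * mu u"] mu_pos[OF assms(2)] assms K_pos[of u]
  by (simp add: Vhat_def U2_def Vhat2_coeff_def powr_mult)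

text \<open>The exponential rate left when the discounted \<open>- gt\<close>-th power of the dual process is divided by its martingale part.\<close>

lemma discount_rate_eq: "- \<rho> - gt * (\<rho> - \<kappa>\<^sup>2 / 2 - r) + (gt * \<kappa>)\<^sup>2 / 2 = th + level_drift"
proof -
  define i where "i = 1 / \<gamma>"
  have gt: "gt = i - 1" using gamma by (simp add: gtilde_def i_def field_simps)
  have div: "x / \<gamma> = x * i" for x by (simp add: i_def)
  show ?thesis
    unfolding gt theta_def level_drift_def volatility_def girsanov_drift_def div
    by (simp add: power2_eq_square field_simps)
qed

definition Vtilde_density :: "real \<Rightarrow> real" where
  "Vtilde_density u = Vhat2_coeff (clamp 0 T u) * exp ((th + level_drift) * u)"

lemma continuous_on_Vtilde_density: "continuous_on UNIV Vtilde_density"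
  unfolding Vtilde_density_def by (intro continuous_intros continuous_on_Vhat2_coeff_clamp)

lemma integral_Vtilde_density_split:
  assumes "s \<le> T1"
  shows "(LBINT u:{s..<T}. Vtilde_density u) = (LBINT u:{T1..<T}. Vtilde_density u) + (LBINT u:{s..<T1}. Vtilde_density u)"
proof -
  have "{s..<T} = {T1..<T} \<union> {s..<T1}" using assms T1 by auto
  then show ?thesis by (simp add: set_integral_Un set_integrable_Ico continuous_on_Vtilde_density)
qed

lemma Vtilde_eq:
  assumes s: "0 \<le> s" "s \<le> T" and z: "0 < z"
  shows "exp (th * s) * V s z = exp (log_level s z) * (LBINT u:{s..<T}. Vtilde_density u)"
proof -
  interpret dual: log_martingale M F "\<lambda>u \<omega>. B (clamp 0 T u) \<omega>" T "gt * \<kappa>"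
    using T1 by (intro log_martingale.intro brownian_motion_imp_brownian_on prob usual brownian) simp
  define c where "c = th + level_drift"
  define E where "E x = exp (dual.Y s 0 (fst x) (snd x))" for x
  have "has_bochner_integral M (\<lambda>\<omega>. LBINT u:{s..<T}. Vtilde_density u * E (u, \<omega>)) (LBINT u:{s..<T}. Vtilde_density u * 1)"
  proof (rule BM.time_product_integrals(2))
    show "has_bochner_integral M (\<lambda>\<omega>. E (u, \<omega>)) 1" if "u \<in> {s..<T}" for u
      using dual.exp_Y_moment[OF s(1), of u 1 0] that by (simp add: E_def)
  qed (auto simp: E_def intro!: set_integrable_Ico continuous_intros continuous_on_Vtilde_density borel_measurable_continuous_onI)
  from has_bochner_integral_mult_right[OF this, of "z powr (- gt) * exp (- c * s)"]
  have "has_bochner_integral M (\<lambda>\<omega>. z powr (- gt) * exp (- c * s) * (LBINT u:{s..<T}. Vtilde_density u * E (u, \<omega>)))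
      (z powr (- gt) * exp (- c * s) * (LBINT u:{s..<T}. Vtilde_density u))" by simp
  moreover have "(LBINT u=s..T. exp (- \<rho> * (u - s)) * Vhat (U2 \<gamma> K) mu u (Yproc \<rho> \<kappa> r B s z u \<omega>))
      = z powr (- gt) * exp (- c * s) * (LBINT u:{s..<T}. Vtilde_density u * E (u, \<omega>))" for \<omega>
  proof -
    have "exp (- \<rho> * (u - s)) * Vhat (U2 \<gamma> K) mu u (Yproc \<rho> \<kappa> r B s z u \<omega>)
        = z powr (- gt) * exp (- c * s) * (Vtilde_density u * E (u, \<omega>))" if u: "u \<in> {s..<T}" for u
    proof -
      define e where "e = (\<rho> - \<kappa>\<^sup>2 / 2 - r) * (u - s) - \<kappa> * (B u \<omega> - B s \<omega>)"
      have "Vhat (U2 \<gamma> K) mu u (Yproc \<rho> \<kappa> r B s z u \<omega>) = Vhat2_coeff u * (z powr (- gt) * exp (- gt * e))"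
        using u s z by (simp add: Yproc_eq_exp Vhat2_eq e_def[symmetric] powr_mult) (simp add: powr_def)
      moreover have "exp (- \<rho> * (u - s)) * exp (- gt * e) = exp (- c * s) * (exp (c * u) * E (u, \<omega>))"
        using u s unfolding E_def dual.Y_def c_def discount_rate_eq[symmetric] e_def exp_add[symmetric]
        by (simp add: field_simps)
      ultimately show ?thesis
        using u s by (simp add: Vtilde_density_def c_def[symmetric] algebra_simps)
    qed
    then have "(LBINT u:{s..<T}. exp (- \<rho> * (u - s)) * Vhat (U2 \<gamma> K) mu u (Yproc \<rho> \<kappa> r B s z u \<omega>))
        = (LBINT u:{s..<T}. z powr (- gt) * exp (- c * s) * (Vtilde_density u * E (u, \<omega>)))"
      by (intro set_lebesgue_integral_cong) auto
    then show ?thesis using s by (simp add: interval_integral_Ico)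
  qed
  ultimately have "V s z = z powr (- gt) * exp (- c * s) * (LBINT u:{s..<T}. Vtilde_density u)"
    by (simp add: Vtilde_def has_bochner_integral_iff)
  then show ?thesis
    using powr_log_level[OF z, of s] by (simp add: c_def exp_add[symmetric] algebra_simps)
qed

lemma Vhat1_eq_reward:
  assumes u: "0 \<le> u" "u \<le> T1" and z: "0 < z"
  shows "exp (th * u) * Vhat (U1 \<gamma>) mu u z
    = SP.reward u (log_level u z) + Vtilde_density u * exp (log_level u z) - exp (th * u)"
proof -
  have uT: "u \<le> T" using u T1 by simp
  have "1 = gt * Delta \<gamma> K u + K u powr (1 / \<gamma>)" using gt_nonzero by (simp add: Delta_def)
  then have "exp (th * u) * Vhat (U1 \<gamma>) mu u z
      = exp (th * u) * (z powr (- gt) * (mu u powr (- gt) * (gt * Delta \<gamma> K u + K u powr (1 / \<gamma>)) / gt))"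
    using z mu_pos[OF uT] by (simp add: Vhat1_eq[OF uT z] powr_mult)
  also have "\<dots> = exp (th * u) * (Delta \<gamma> K u * (mu u * z) powr (- gt)) + Vhat2_coeff u * (exp (th * u) * z powr (- gt))"
    using gt_nonzero z mu_pos[OF uT] by (simp add: Vhat2_coeff_def powr_mult field_simps)
  also have "Vhat2_coeff u * (exp (th * u) * z powr (- gt)) = Vtilde_density u * exp (log_level u z)"
    using u uT powr_log_level[OF z, of u] by (simp add: Vtilde_density_def exp_add[symmetric] algebra_simps)
  finally show ?thesis using reward_eq[OF u z] by (simp add: algebra_simps)
qed

lemma discounted_qfun:
  assumes "t \<le> s"
  shows "exp (th * (s - t)) * qfun th T1 s = qfun th T1 t - exp (- th * t) * (LBINT u:{t..<s}. exp (th * u))"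
  unfolding LBINT_exp_linear[OF theta_nonzero assms] qfun_def using theta_nonzero
  by (simp add: field_simps exp_add[symmetric])


subsection \<open>Reduction to the stopping problem\<close>

definition payoff :: "real \<Rightarrow> real \<Rightarrow> real \<Rightarrow> 'a \<Rightarrow> real" where
  "payoff t z s \<omega> = (LBINT u=t..s. exp (th * (u - t)) * Vhat (U1 \<gamma>) mu u (Z t z u \<omega>))
    + exp (th * (s - t)) * (V s (Z t z s \<omega>) - qfun th T1 s)"

lemma exp_discount_shift: "exp (th * (u - t)) = exp (- th * t) * exp (th * u)"
  by (simp add: exp_add[symmetric] algebra_simps)

lemma payoff_eq:
  assumes t: "0 \<le> t" "t \<le> s" "s \<le> T1" and z: "0 < z" and \<omega>: "\<omega> \<in> space M"
  defines "y \<equiv> log_level t z"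
  shows "payoff t z s \<omega> = exp (- th * t) * ((LBINT u:{t..<s}. SP.reward u (SP.Y t y u \<omega>))
    + ((LBINT u:{t..<s}. Vtilde_density u * exp (SP.Y t y u \<omega>))
      + exp (SP.Y t y s \<omega>) * ((LBINT u:{T1..<T}. Vtilde_density u) + (LBINT u:{s..<T1}. Vtilde_density u)))) - qfun th T1 t"
proof -
  have Y_cont: "continuous_on UNIV (\<lambda>u. SP.Y t y u \<omega>)" using \<omega> by (intro SP.Y_continuous) simp
  note Z = Z_pos[OF z, of t _ \<omega>]
  have "(LBINT u=t..s. exp (th * (u - t)) * Vhat (U1 \<gamma>) mu u (Z t z u \<omega>))
      = (LBINT u:{t..<s}. exp (- th * t) * (SP.reward u (SP.Y t y u \<omega>) + Vtilde_density u * exp (SP.Y t y u \<omega>) - exp (th * u)))"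
    unfolding interval_integral_Ico[of t s, simplified, OF t(2)]
  proof (intro set_lebesgue_integral_cong allI impI)
    fix u assume "u \<in> {t..<s}"
    then have u: "t \<le> u" "u \<le> T1" "0 \<le> u" using t by auto
    then show "exp (th * (u - t)) * Vhat (U1 \<gamma>) mu u (Z t z u \<omega>)
        = exp (- th * t) * (SP.reward u (SP.Y t y u \<omega>) + Vtilde_density u * exp (SP.Y t y u \<omega>) - exp (th * u))"
      using Vhat1_eq_reward[OF u(3,2) Z] log_level_Z[OF t(1) u(1,2) z, of \<omega>]
      unfolding exp_discount_shift[of u] mult.assoc by (simp add: y_def)
  qed simp
  also have "\<dots> = exp (- th * t) * ((LBINT u:{t..<s}. SP.reward u (SP.Y t y u \<omega>))
      + (LBINT u:{t..<s}. Vtilde_density u * exp (SP.Y t y u \<omega>)) - (LBINT u:{t..<s}. exp (th * u)))"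
    unfolding SP.reward_def
    by (simp add: set_integral_diff set_integral_add set_integrable_Ico continuous_intros continuous_on_Vtilde_density SP.a_continuous Y_cont)
  finally have running: "(LBINT u=t..s. exp (th * (u - t)) * Vhat (U1 \<gamma>) mu u (Z t z u \<omega>))
      = exp (- th * t) * ((LBINT u:{t..<s}. SP.reward u (SP.Y t y u \<omega>))
        + (LBINT u:{t..<s}. Vtilde_density u * exp (SP.Y t y u \<omega>)) - (LBINT u:{t..<s}. exp (th * u)))" .
  have "exp (th * (s - t)) * V s (Z t z s \<omega>) = exp (- th * t) * (exp (SP.Y t y s \<omega>)
      * ((LBINT u:{T1..<T}. Vtilde_density u) + (LBINT u:{s..<T1}. Vtilde_density u)))"
    using Vtilde_eq[of s, OF _ _ Z] t T1 log_level_Z[OF t z, of \<omega>]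
    unfolding exp_discount_shift[of s] mult.assoc by (simp add: y_def integral_Vtilde_density_split[OF t(3)])
  then show ?thesis
    unfolding payoff_def running right_diff_distrib[of "exp (th * (s - t))"] discounted_qfun[OF t(2)]
    by (simp add: algebra_simps)
qed

lemma stopping_value:
  assumes t: "0 \<le> t" and \<tau>: "SP.admissible t \<tau>" and z: "0 < z"
  shows "Etilde M \<sigma>w \<kappa> B T1 (\<lambda>\<omega>. payoff t z (\<tau> \<omega>) \<omega>)
    = V t z - qfun th T1 t + exp (- th * t) * SP.gain t (log_level t z) \<tau>"
proof -
  define y where "y = log_level t z"
  define v where "v = (LBINT u:{T1..<T}. Vtilde_density u)"
  define G where "G \<omega> = (LBINT u:{t..<\<tau> \<omega>}. SP.reward u (SP.Y t y u \<omega>))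
    + ((LBINT u:{t..<\<tau> \<omega>}. Vtilde_density u * exp (SP.Y t y u \<omega>))
      + exp (SP.Y t y (\<tau> \<omega>) \<omega>) * (v + (LBINT u:{\<tau> \<omega>..<T1}. Vtilde_density u)))" for \<omega>
  have "t \<le> T1" using \<tau> by (rule SP.admissible_le_horizon)
  then have V_t: "exp (- th * t) * (exp y * (v + (LBINT u:{t..<T1}. Vtilde_density u))) = V t z"
    using Vtilde_eq[OF t _ z] T1
    by (simp add: y_def v_def integral_Vtilde_density_split[symmetric] exp_minus divide_simps mult.commute)
  have "has_bochner_integral N G (SP.gain t y \<tau> + exp y * (v + (LBINT u:{t..<T1}. Vtilde_density u)))"
    unfolding G_def
    by (intro has_bochner_integral_add SP.has_bochner_integral_gain SP.exp_Y_optional_stopping_tail t \<tau> continuous_on_Vtilde_density)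
  from has_bochner_integral_diff[OF has_bochner_integral_mult_right[OF this, of "exp (- th * t)"]]
  have "has_bochner_integral N (\<lambda>\<omega>. exp (- th * t) * G \<omega> - qfun th T1 t)
      (exp (- th * t) * (SP.gain t y \<tau> + exp y * (v + (LBINT u:{t..<T1}. Vtilde_density u))) - qfun th T1 t)"
    by (auto simp: has_bochner_integral_iff SP.prob_space[simplified])
  then have "Etilde M \<sigma>w \<kappa> B T1 (\<lambda>\<omega>. payoff t z (\<tau> \<omega>) \<omega>)
      = exp (- th * t) * (SP.gain t y \<tau> + exp y * (v + (LBINT u:{t..<T1}. Vtilde_density u))) - qfun th T1 t"
  proof (rule Etilde_eq)
    fix \<omega> assume "\<omega> \<in> space M"
    then show "payoff t z (\<tau> \<omega>) \<omega> = exp (- th * t) * G \<omega> - qfun th T1 t"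
      using payoff_eq[OF t _ _ z] SP.admissibleD(2,3)[OF \<tau>] by (simp add: G_def y_def v_def)
  qed
  then show ?thesis using V_t by (simp add: distrib_left y_def)
qed

lemma contregion_iff_profitable:
  assumes t: "0 \<le> t" "t < T1" and z: "0 < z"
  shows "(t, z) \<in> contregion M F B \<gamma> K \<alpha> \<beta> r T T1 \<rho> \<kappa> \<mu>w \<sigma>w \<longleftrightarrow> SP.profitable t (log_level t z)"
proof -
  define y where "y = log_level t z"
  define v where "v = V t z - qfun th T1 t"
  define S where "S = {\<tau>. SP.admissible t \<tau>}"
  have "wtilde M F B \<gamma> K \<alpha> \<beta> r T T1 \<rho> \<kappa> \<mu>w \<sigma>w t z = (SUP \<tau>\<in>S. Etilde M \<sigma>w \<kappa> B T1 (\<lambda>\<omega>. payoff t z (\<tau> \<omega>) \<omega>))"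
    by (simp add: wtilde_def Let_def payoff_def S_def SP.admissible_def)
  also have "\<dots> = (SUP \<tau>\<in>S. v + exp (- th * t) * SP.gain t y \<tau>)"
    unfolding v_def y_def by (intro SUP_cong refl stopping_value[OF t(1) _ z]) (simp add: S_def)
  finally have wtilde: "wtilde M F B \<gamma> K \<alpha> \<beta> r T T1 \<rho> \<kappa> \<mu>w \<sigma>w t z = (SUP \<tau>\<in>S. v + exp (- th * t) * SP.gain t y \<tau>)" .
  have "(\<lambda>_. t) \<in> S" using t by (simp add: S_def SP.admissible_const)
  then have nonempty: "S \<noteq> {}" by blast
  obtain C where "\<And>\<tau>. \<tau> \<in> S \<Longrightarrow> SP.gain t y \<tau> \<le> C"
    using SP.gain_le[OF t(1)] unfolding S_def by blast
  then have "bdd_above ((\<lambda>\<tau>. v + exp (- th * t) * SP.gain t y \<tau>) ` S)"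
    by (intro bdd_aboveI2[where M = "v + exp (- th * t) * C"] add_left_mono mult_left_mono) auto
  from less_cSUP_iff[OF nonempty this]
  have "v < (SUP \<tau>\<in>S. v + exp (- th * t) * SP.gain t y \<tau>) \<longleftrightarrow> (\<exists>\<tau>\<in>S. v < v + exp (- th * t) * SP.gain t y \<tau>)" .
  also have "\<dots> \<longleftrightarrow> SP.profitable t y"
    by (auto simp: SP.profitable_def S_def zero_less_mult_iff)
  finally show ?thesis
    using t z by (simp add: contregion_def wtilde v_def y_def)
qed

end


subsection \<open>The optimal retirement boundary\<close>

locale retirement_boundary = power_market +
  fixes zstar :: "real \<Rightarrow> real"
  assumes zstar_pos: "t \<in> {0..<T1} \<Longrightarrow> 0 < zstar t"
    and contregion_iff: "t \<in> {0..<T1} \<Longrightarrow> 0 < z \<Longrightarrow>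
      (t, z) \<in> contregion M F B \<gamma> K \<alpha> \<beta> r T T1 \<rho> \<kappa> \<mu>w \<sigma>w \<longleftrightarrow> (if \<gamma> < 1 then z > zstar t else z < zstar t)"
begin

sublocale FB: stopping_boundary N F "\<lambda>u \<omega>. B (clamp 0 T1 u) \<omega> - girsanov_drift * u" T1
  volatility th growth_rate "\<lambda>u. reward_coeff (clamp 0 T1 u)" "\<lambda>s. log_level s (zstar s)"
proof
  fix s y assume s: "0 \<le> s" "s < T1"
  define z where "z = exp (- (y + level_drift * s) / gt)"
  have z: "0 < z" "log_level s z = y" using gt_nonzero by (auto simp: z_def log_level_def)
  have "SP.profitable s y \<longleftrightarrow> (if \<gamma> < 1 then z > zstar s else z < zstar s)"
    using contregion_iff_profitable[OF s z(1)] contregion_iff[of s z] s z by simp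
  then show "SP.profitable s y \<longleftrightarrow> y < log_level s (zstar s)"
    using log_level_less_iff[OF z(1) zstar_pos, of s s] s z(2) by simp
qed

lemma below_boundary_iff:
  assumes t: "0 \<le> t" "t \<le> u" "u < T1"
  shows "SP.Y t (log_level t (zstar t)) u \<omega> < log_level u (zstar u) \<longleftrightarrow>
    (if \<gamma> > 1 then Z t (zstar t) u \<omega> < zstar u else Z t (zstar t) u \<omega> > zstar u)"
proof -
  have "0 < zstar t" "0 < zstar u" using t by (auto intro: zstar_pos)
  then show ?thesis
    using log_level_less_iff[OF Z_pos, of "zstar t" "zstar u" u t u \<omega>] log_level_Z[of t u "zstar t" \<omega>] t gamma by auto
qed

theorem integral_equation:
  assumes t: "t \<in> {0..<T1}"
  shows "Etilde M \<sigma>w \<kappa> B T1 (\<lambda>\<omega>. LBINT u=t..T1. exp (th * (u - t)) *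
    (1 + Delta \<gamma> K u * (mu u * Z t (zstar t) u \<omega>) powr (- gt)) *
    (if \<gamma> > 1 then of_bool (Z t (zstar t) u \<omega> < zstar u) else of_bool (Z t (zstar t) u \<omega> > zstar u))) = 0"
proof -
  define y where "y = log_level t (zstar t)"
  have t0: "0 \<le> t" "t < T1" using t by auto
  have "set_integrable SP.time_space (FB.continuation_region t y) (SP.path_reward t y)"
    by (rule SP.path_reward_integrable[OF t0(1) FB.sets_continuation_region[OF t0(1)] FB.continuation_region_subset])
  from SP.time_space.has_bochner_integral_set_integral_snd[OF this]
  have "has_bochner_integral N (\<lambda>\<omega>. LBINT u:{u. (u, \<omega>) \<in> FB.continuation_region t y}. SP.path_reward t y (u, \<omega>)) 0"
    using FB.boundary_integral_equation[OF t0] by (simp add: y_def)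
  from has_bochner_integral_mult_right[OF this, of "exp (- th * t)"]
  have "has_bochner_integral N (\<lambda>\<omega>. exp (- th * t) * (LBINT u:{u. (u, \<omega>) \<in> FB.continuation_region t y}. SP.path_reward t y (u, \<omega>))) 0"
    by simp
  then show ?thesis
  proof (rule Etilde_eq)
    fix \<omega> assume \<omega>: "\<omega> \<in> space M"
    let ?f = "\<lambda>u. exp (th * (u - t)) * (1 + Delta \<gamma> K u * (mu u * Z t (zstar t) u \<omega>) powr (- gt)) *
      (if \<gamma> > 1 then of_bool (Z t (zstar t) u \<omega> < zstar u) else of_bool (Z t (zstar t) u \<omega> > zstar u))"
    have "indicator {t<..<T1} u * ?f u
        = exp (- th * t) * (indicator {u. (u, \<omega>) \<in> FB.continuation_region t y} u * SP.path_reward t y (u, \<omega>))" for u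
    proof (cases "u \<in> {t<..<T1}")
      case True
      then have u: "t \<le> u" "u < T1" "0 \<le> u" "u \<le> T1" using t0 by auto
      have "exp (th * (u - t)) * (1 + Delta \<gamma> K u * (mu u * Z t (zstar t) u \<omega>) powr (- gt))
          = exp (- th * t) * SP.path_reward t y (u, \<omega>)"
        using reward_eq[OF u(3,4) Z_pos[OF zstar_pos[OF t]]] log_level_Z[OF t0(1) u(1,4) zstar_pos[OF t], of \<omega>]
        unfolding exp_discount_shift mult.assoc by (simp add: SP.path_reward_def y_def)
      then show ?thesis
        using True \<omega> below_boundary_iff[OF t0(1) u(1,2), of \<omega>]
        by (auto simp: FB.continuation_region_def y_def indicator_def)
    qed (auto simp: FB.continuation_region_def indicator_def)
    then show "(LBINT u=t..T1. ?f u)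
        = exp (- th * t) * (LBINT u:{u. (u, \<omega>) \<in> FB.continuation_region t y}. SP.path_reward t y (u, \<omega>))"
      using t0 by (simp add: interval_integral_Ioo set_lebesgue_integral_def)
  qed
qed

theorem zstar_tendsto_horizon: "(zstar \<longlongrightarrow> (- Delta \<gamma> K T1) powr (1 / gt) / mu T1) (at_left T1)"
proof -
  have pos: "0 < - Delta \<gamma> K T1" "0 < mu T1" using Delta_neg[of T1] mu_pos[of T1] T1 by auto
  have "((\<lambda>s. exp (- (log_level s (zstar s) + level_drift * s) / gt)) \<longlongrightarrow>
      exp (- (- ln (reward_coeff T1) + level_drift * T1) / gt)) (at_left T1)"
    using FB.boundary_tendsto_horizon gt_nonzero T1 by (intro tendsto_intros) auto
  moreover have "\<forall>\<^sub>F s in at_left T1. exp (- (log_level s (zstar s) + level_drift * s) / gt) = zstar s"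
    using eventually_at_left_real[OF T1(1)]
    by eventually_elim (use zstar_pos gt_nonzero in \<open>simp add: log_level_def\<close>)
  moreover have "- (- ln (reward_coeff T1) + level_drift * T1) / gt = 1 / gt * ln (- Delta \<gamma> K T1) - ln (mu T1)"
  proof -
    have "ln (d * m powr (- gt) * exp x) = ln d - gt * ln m + x" if "0 < d" "0 < m" for d m x
      using that by (simp add: ln_mult_pos ln_powr)
    from this[OF pos] have "ln (reward_coeff T1) = ln (- Delta \<gamma> K T1) - gt * ln (mu T1) + level_drift * T1"
      by (simp add: reward_coeff_def)
    then show ?thesis using gt_nonzero by (simp add: field_simps)
  qed
  then have "exp (- (- ln (reward_coeff T1) + level_drift * T1) / gt) = (- Delta \<gamma> K T1) powr (1 / gt) / mu T1"
    using pos by (simp add: exp_diff powr_def)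
  ultimately show ?thesis using Lim_transform_eventually by simp
qed

end


theorem mainTheorem9:
  fixes M :: "'a measure" and F :: "real \<Rightarrow> 'a measure" and B :: "real \<Rightarrow> 'a \<Rightarrow> real"
    and T1 T r \<mu> \<sigma> \<rho> \<mu>w \<sigma>w \<alpha> \<beta> \<gamma> \<delta> Mb :: real
    and K :: "real \<Rightarrow> real" and zstar :: "real \<Rightarrow> real"
  assumes "prob_space M"
    and "usual_filtration M F"
    and "brownian_motion M F B"
    and "0 < T1" "T1 < T"
    and "0 < r" "0 < \<mu>" "0 < \<sigma>" "0 < \<rho>" "0 < \<mu>w" "0 < \<sigma>w" "0 < \<alpha>" "0 < \<beta>"
    and "theta r \<mu>w (kappa \<mu> r \<sigma>) \<sigma>w < 0"
    and "0 < \<gamma>" "\<gamma> \<noteq> 1"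
    and "smooth_on {0..T} K" "\<forall>t\<in>{0..T}. 0 < K t"
    and "0 < \<delta>" "\<delta> \<le> Mb"
    and "\<forall>t\<in>{0..T1}. - Mb \<le> Delta \<gamma> K t \<and> Delta \<gamma> K t \<le> - \<delta>"
    and "\<forall>t\<in>{0..<T1}. 0 < zstar t"
    and "\<forall>t\<in>{0..<T1}. \<forall>z>0.
           (t, z) \<in> contregion M F B \<gamma> K \<alpha> \<beta> r T T1 \<rho> (kappa \<mu> r \<sigma>) \<mu>w \<sigma>w \<longleftrightarrow>
           (if \<gamma> < 1 then z > zstar t else z < zstar t)"
  shows "(\<forall>t\<in>{0..<T1}.
            Etilde M \<sigma>w (kappa \<mu> r \<sigma>) B T1 (\<lambda>\<omega>.
              LBINT u=t..T1.
                exp (theta r \<mu>w (kappa \<mu> r \<sigma>) \<sigma>w * (u - t)) *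
                (1 + Delta \<gamma> K u *
                   (muT \<alpha> \<beta> r T u * Zproc \<gamma> \<rho> (kappa \<mu> r \<sigma>) r \<mu>w \<sigma>w B t (zstar t) u \<omega>)
                     powr (- gtilde \<gamma>)) *
                (if \<gamma> > 1
                 then of_bool (Zproc \<gamma> \<rho> (kappa \<mu> r \<sigma>) r \<mu>w \<sigma>w B t (zstar t) u \<omega> < zstar u)
                 else of_bool (Zproc \<gamma> \<rho> (kappa \<mu> r \<sigma>) r \<mu>w \<sigma>w B t (zstar t) u \<omega> > zstar u)))
            = 0)
         \<and> (zstar \<longlongrightarrow> (- Delta \<gamma> K T1) powr (1 / gtilde \<gamma>) / muT \<alpha> \<beta> r T T1) (at_left T1)"
proof -
  define \<kappa> where "\<kappa> = kappa \<mu> r \<sigma>"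
  interpret retirement_boundary M F B T1 T r \<kappa> \<rho> \<mu>w \<sigma>w \<alpha> \<beta> \<gamma> K zstar
  proof (intro retirement_boundary.intro power_market.intro retirement_boundary_axioms.intro)
    show "Delta \<gamma> K t < 0" if "t \<in> {0..T1}" for t
      using that assms(19,21) by (meson le_less_trans neg_less_0_iff_less)
    show "(t, z) \<in> contregion M F B \<gamma> K \<alpha> \<beta> r T T1 \<rho> \<kappa> \<mu>w \<sigma>w \<longleftrightarrow> (if \<gamma> < 1 then z > zstar t else z < zstar t)"
      if "t \<in> {0..<T1}" "0 < z" for t z
      using that assms(23) unfolding \<kappa>_def by blast
  qed (use assms(1-5,12,14-18,22) in \<open>simp_all add: \<kappa>_def\<close>)
  show ?thesis
    using integral_equation zstar_tendsto_horizon unfolding \<kappa>_def by blast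
qed

end
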